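(* Let $k$ be an algebraically closed field, $n\ge2$, $G=\mathrm{GL}_n(k)$, $\mathfrak g=\mathfrak{gl}_n(k)$, and $k[\mathfrak g]=k[\xi_{ij}:1\le i,j\le n]$ the polynomial functions on $\mathfrak g$, where $\xi_{ij}$ is the $(i,j)$-entry function. Let $t\in\{1,\dots,n-1\}$, put $\lambda^t=(t,0,\dots,0,-1,\dots,-1)$ (with $t$ entries $-1$) and $\mu^t=(1,\dots,1,0,\dots,0,-t)$ (with $t$ entries $1$), and for $I\subseteq\{2,\dots,n\}$ with $|I|=t$ define $$u_{t,I}=\det\big((\partial_{1i}s_j)_{n-t+1\le i\le n,\ j\in I}\big),\qquad v_{t,I}=\det\big((\partial_{in}s_j)_{1\le i\le t,\ j\in I}\big),$$ where the indices in $I$ are taken in increasing order. Then: (i) The elements $u_{t,I}$, $I\subseteq\{2,\dots,n\}$ with $|I|=t$, form a basis of the $k[\mathfrak g]^G$-module $k[\mathfrak g]^U_{\lambda^t}$; likewise the $v_{t,I}$ form a basis of the $k[\mathfrak g]^G$-module $k[\mathfrak g]^U_{\mu^t}$. (ii) Every nontrivial $k$-linear combination of the $u_{t,I}$ ($I\subseteq\{2,\dots,n\}$, $|I|=t$) is an irreducible element of $k[\mathfrak g]$ and a $B$-semi-invariant of weight $\lambda^t$; likewise every nontrivial $k$-linear combination of the $v_{t,I}$ is irreducible and a $B$-semi-invariant of weight $\mu^t$.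
   Context: $G$ acts on $\mathfrak g$ by conjugation and on $k[\mathfrak g]$ by $(g\cdot f)(x)=f(g^{-1}xg)$. $U$ is the subgroup of upper unitriangular matrices, $B$ the subgroup of invertible upper triangular matrices, $T$ the diagonal torus; $(\lambda_1,\dots,\lambda_n)\in\mathbb Z^n$ denotes the character $\mathrm{diag}(a_1,\dots,a_n)\mapsto\prod a_i^{\lambda_i}$ of $T$, extended to $B$ via $B\to T$. $k[\mathfrak g]^U_\lambda$ is the space of $U$-invariant polynomials of $T$-weight $\lambda$; it is a module over the invariant algebra $k[\mathfrak g]^G$. A $B$-semi-invariant of weight $\lambda$ is an $f$ with $b\cdot f=\lambda(b)f$ for all $b\in B$. $s_i\in k[\mathfrak g]$ ($1\le i\le n$) is defined by $s_i(x)=\mathrm{tr}(\wedge^i x)$, and $\partial_{ij}=\partial/\partial\xi_{ij}$. *)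

theory Defs
  imports "HOL-Computational_Algebra.Polynomial" "Jordan_Normal_Form.Determinant"
begin

text \<open>An n x n matrix over k is modelled as a function nat => nat => k, of which only the
entries with indices in {1..n} are relevant.  Polynomial functions on gl_n(k) are
functions ('k gl) => 'k; since k is algebraically closed (hence infinite), the ring
k[gl_n] = k[xi_ij] is identified with its image in the ring of functions.\<close>

type_synonym 'k gl = "nat \<Rightarrow> nat \<Rightarrow> 'k"

definition is_mat :: "nat \<Rightarrow> 'k::zero gl \<Rightarrow> bool" where
  "is_mat n x \<longleftrightarrow> (\<forall>i j. i \<notin> {1..n} \<or> j \<notin> {1..n} \<longrightarrow> x i j = 0)"

definition mmult :: "nat \<Rightarrow> 'k::comm_ring_1 gl \<Rightarrow> 'k gl \<Rightarrow> 'k gl" where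
  "mmult n a b = (\<lambda>i j. if i \<in> {1..n} \<and> j \<in> {1..n} then (\<Sum>l=1..n. a i l * b l j) else 0)"

definition idm :: "nat \<Rightarrow> 'k::comm_ring_1 gl" where
  "idm n = (\<lambda>i j. if i \<in> {1..n} \<and> i = j then 1 else 0)"

definition GL :: "nat \<Rightarrow> 'k::comm_ring_1 gl set" where
  "GL n = {g. is_mat n g \<and> (\<exists>h. is_mat n h \<and> mmult n g h = idm n \<and> mmult n h g = idm n)}"

definition minv :: "nat \<Rightarrow> 'k::comm_ring_1 gl \<Rightarrow> 'k gl" where
  "minv n g = (THE h. is_mat n h \<and> mmult n g h = idm n \<and> mmult n h g = idm n)"

definition Borel :: "nat \<Rightarrow> 'k::comm_ring_1 gl set" where
  "Borel n = {b \<in> GL n. \<forall>i j. j < i \<longrightarrow> b i j = 0}"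

definition Unip :: "nat \<Rightarrow> 'k::comm_ring_1 gl set" where
  "Unip n = {u \<in> Borel n. \<forall>i\<in>{1..n}. u i i = 1}"

definition Torus :: "nat \<Rightarrow> 'k::comm_ring_1 gl set" where
  "Torus n = {d \<in> GL n. \<forall>i j. i \<noteq> j \<longrightarrow> d i j = 0}"

definition act :: "nat \<Rightarrow> 'k::comm_ring_1 gl \<Rightarrow> ('k gl \<Rightarrow> 'k) \<Rightarrow> ('k gl \<Rightarrow> 'k)" where
  "act n g f = (\<lambda>x. f (mmult n (mmult n (minv n g) x) g))"

text \<open>The character (lambda_1,...,lambda_n) of T, extended to B via B -> T.\<close>
definition character :: "nat \<Rightarrow> (nat \<Rightarrow> int) \<Rightarrow> 'k::field gl \<Rightarrow> 'k" where
  "character n lam b = (\<Prod>i=1..n. power_int (b i i) (lam i))"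

inductive_set polyfun :: "nat \<Rightarrow> ('k::comm_ring_1 gl \<Rightarrow> 'k) set" for n where
  const: "(\<lambda>x. c) \<in> polyfun n"
| coord: "i \<in> {1..n} \<Longrightarrow> j \<in> {1..n} \<Longrightarrow> (\<lambda>x. x i j) \<in> polyfun n"
| add: "f \<in> polyfun n \<Longrightarrow> g \<in> polyfun n \<Longrightarrow> (\<lambda>x. f x + g x) \<in> polyfun n"
| mult: "f \<in> polyfun n \<Longrightarrow> g \<in> polyfun n \<Longrightarrow> (\<lambda>x. f x * g x) \<in> polyfun n"

definition invariants :: "nat \<Rightarrow> ('k::field gl \<Rightarrow> 'k) set" where
  "invariants n = {f \<in> polyfun n. \<forall>g\<in>GL n. act n g f = f}"

definition Uinv_weight :: "nat \<Rightarrow> (nat \<Rightarrow> int) \<Rightarrow> ('k::field gl \<Rightarrow> 'k) set" where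
  "Uinv_weight n lam = {f \<in> polyfun n. (\<forall>u\<in>Unip n. act n u f = f) \<and>
      (\<forall>d\<in>Torus n. act n d f = (\<lambda>x. character n lam d * f x))}"

definition B_semi_invariant :: "nat \<Rightarrow> (nat \<Rightarrow> int) \<Rightarrow> ('k::field gl \<Rightarrow> 'k) \<Rightarrow> bool" where
  "B_semi_invariant n lam f \<longleftrightarrow> (\<forall>b\<in>Borel n. act n b f = (\<lambda>x. character n lam b * f x))"

definition polyfun_unit :: "nat \<Rightarrow> ('k::comm_ring_1 gl \<Rightarrow> 'k) \<Rightarrow> bool" where
  "polyfun_unit n f \<longleftrightarrow> f \<in> polyfun n \<and> (\<exists>g\<in>polyfun n. (\<lambda>x. f x * g x) = (\<lambda>x. 1))"

definition polyfun_irreducible :: "nat \<Rightarrow> ('k::comm_ring_1 gl \<Rightarrow> 'k) \<Rightarrow> bool" where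
  "polyfun_irreducible n f \<longleftrightarrow> f \<in> polyfun n \<and> f \<noteq> (\<lambda>x. 0) \<and> \<not> polyfun_unit n f \<and>
     (\<forall>g\<in>polyfun n. \<forall>h\<in>polyfun n. f = (\<lambda>x. g x * h x) \<longrightarrow> polyfun_unit n g \<or> polyfun_unit n h)"

definition elem :: "nat \<Rightarrow> nat \<Rightarrow> 'k::comm_ring_1 gl" where
  "elem i j = (\<lambda>a b. if a = i \<and> b = j then 1 else 0)"

definition pdiff :: "nat \<Rightarrow> nat \<Rightarrow> ('k::comm_ring_1 gl \<Rightarrow> 'k) \<Rightarrow> ('k gl \<Rightarrow> 'k)" where
  "pdiff i j f = (\<lambda>x. THE c. \<exists>p. (\<forall>\<tau>. poly p \<tau> = f (\<lambda>a b. x a b + \<tau> * elem i j a b)) \<and> coeff p 1 = c)"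

text \<open>s_i(x) = tr(wedge^i x), i.e. the sum of the principal i x i minors of x.\<close>
definition submat :: "'k gl \<Rightarrow> nat set \<Rightarrow> 'k mat" where
  "submat x S = (let l = sorted_list_of_set S in
     mat (card S) (card S) (\<lambda>(a, b). x (l ! a) (l ! b)))"

definition s_inv :: "nat \<Rightarrow> nat \<Rightarrow> ('k::comm_ring_1 gl \<Rightarrow> 'k)" where
  "s_inv n i = (\<lambda>x. \<Sum>S\<in>{S. S \<subseteq> {1..n} \<and> card S = i}. det (submat x S))"

definition lam_t :: "nat \<Rightarrow> nat \<Rightarrow> nat \<Rightarrow> int" where
  "lam_t n t i = (if i = 1 then int t else if n - t + 1 \<le> i \<and> i \<le> n then -1 else 0)"

definition mu_t :: "nat \<Rightarrow> nat \<Rightarrow> nat \<Rightarrow> int" where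
  "mu_t n t i = (if i = n then - int t else if 1 \<le> i \<and> i \<le> t then 1 else 0)"

definition u_tI :: "nat \<Rightarrow> nat \<Rightarrow> nat set \<Rightarrow> ('k::comm_ring_1 gl \<Rightarrow> 'k)" where
  "u_tI n t I = (\<lambda>x. let l = sorted_list_of_set I in
     det (mat t t (\<lambda>(a, b). pdiff 1 (n - t + 1 + a) (s_inv n (l ! b)) x)))"

definition v_tI :: "nat \<Rightarrow> nat \<Rightarrow> nat set \<Rightarrow> ('k::comm_ring_1 gl \<Rightarrow> 'k)" where
  "v_tI n t I = (\<lambda>x. let l = sorted_list_of_set I in
     det (mat t t (\<lambda>(a, b). pdiff (1 + a) n (s_inv n (l ! b)) x)))"

definition is_module_basis :: "('k::comm_ring_1 gl \<Rightarrow> 'k) set \<Rightarrow> ('k gl \<Rightarrow> 'k) set \<Rightarrow>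
    'i set \<Rightarrow> ('i \<Rightarrow> ('k gl \<Rightarrow> 'k)) \<Rightarrow> bool" where
  "is_module_basis R M Is u \<longleftrightarrow>
     (\<forall>I\<in>Is. u I \<in> M) \<and>
     (\<forall>f\<in>M. \<exists>c. (\<forall>I\<in>Is. c I \<in> R) \<and> f = (\<lambda>x. \<Sum>I\<in>Is. c I x * u I x)) \<and>
     (\<forall>c. (\<forall>I\<in>Is. c I \<in> R) \<and> (\<lambda>x. \<Sum>I\<in>Is. c I x * u I x) = (\<lambda>x. 0) \<longrightarrow>
          (\<forall>I\<in>Is. c I = (\<lambda>x. 0)))"

definition index_sets :: "nat \<Rightarrow> nat \<Rightarrow> nat set set" where
  "index_sets n t = {I. I \<subseteq> {2..n} \<and> card I = t}"

end

theory Submission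
  imports Defs
begin

text \<open>The gradient of \<open>s\<^sub>j\<close> with respect to the trace form is an equivariant matrix \<open>A\<^sub>j(x)\<close> with
  \<open>A\<^sub>1 = 1\<close>, \<open>A\<^sub>j\<^sub>+\<^sub>1 = s\<^sub>j - x A\<^sub>j\<close> and \<open>A\<^sub>n\<^sub>+\<^sub>1 = 0\<close>.  Let \<open>M(x)\<close> have the first columns of
  \<open>A\<^sub>1, \<dots>, A\<^sub>n\<close> as its columns; then \<open>u\<^sub>t\<^sub>,\<^sub>I(x)\<close> is the minor of \<open>M(x)\<close> with the last \<open>t\<close> rows and
  the columns in \<open>I\<close>, and for \<open>det M(x) \<noteq> 0\<close> the recursion says \<open>x = M Y M\<^sup>-\<^sup>1\<close>, where the
  companion matrix \<open>Y\<close> depends only on the \<open>s\<^sub>j(x)\<close>.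

  If \<open>f\<close> is a semi-invariant of weight \<open>\<lambda>\<^sup>t\<close>, then on the stabilizer of the first basis vector the
  function \<open>g \<mapsto> f(g Y g\<^sup>-\<^sup>1)\<close> is a section of the line bundle of a fundamental weight, hence (by an
  \<open>SL\<^sub>2\<close> computation and Gauss elimination) a linear combination of the minors of the last \<open>t\<close>
  rows, with coefficients the values of \<open>f\<close> at conjugates of \<open>Y\<close> by permutation matrices.
  Setting \<open>g = M(x)\<close> expands \<open>f\<close> in the \<open>u\<^sub>t\<^sub>,\<^sub>I\<close> with invariant coefficients.  Independence
  follows by conjugating a generic \<open>x\<close> so that \<open>M(x)\<close> becomes a permutation matrix.

  The factors of a semi-invariant are semi-invariant, and their weights are dominant with
  coordinate sum \<open>0\<close>.  Since \<open>\<lambda>\<^sup>t\<close> is not a sum of two nonzero such weights, in a factorization of a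
  \<open>k\<close>-linear combination of the \<open>u\<^sub>t\<^sub>,\<^sub>I\<close> one factor is an invariant (the case \<open>t = 0\<close> of the
  expansion), and it is a unit by the basis property.  The \<open>v\<^sub>t\<^sub>,\<^sub>I\<close> are obtained from the
  \<open>u\<^sub>t\<^sub>,\<^sub>I\<close> by reflecting matrices in the antidiagonal.\<close>

section \<open>Polynomials over an infinite field\<close>

text \<open>If the field were finite, the product of all \<open>X - a\<close> plus 1 would be a
  nonconstant polynomial without roots.\<close>

lemma infinite_UNIV_alg_closed_field: "infinite (UNIV :: 'k::alg_closed_field set)"
proof
  assume fin: "finite (UNIV :: 'k set)"
  define p :: "'k poly" where "p = (\<Prod>a\<in>UNIV. [:- a, 1:]) + 1"
  have d: "degree (\<Prod>a\<in>(UNIV::'k set). [:- a, 1:]) = card (UNIV :: 'k set)"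
    by (subst degree_prod_eq_sum_degree) auto
  have c: "card (UNIV :: 'k set) > 0" using fin by (simp add: card_gt_0_iff)
  have "degree p > 0"
    unfolding p_def using d c by (subst degree_add_eq_left) auto
  then obtain z where z: "poly p z = 0" using alg_closed_imp_poly_has_root by blast
  have "poly (\<Prod>a\<in>(UNIV::'k set). [:- a, 1:]) z = 0"
    using fin by (auto simp: poly_prod)
  then show False using z by (simp add: p_def)
qed

text \<open>Finitely many roots cannot exhaust an infinite field minus one point. The point 0 is
  left out because identities along a torus hold for invertible parameters only.\<close>

lemma poly_eqI_nonzero:
  fixes p q :: "'k::alg_closed_field poly"
  assumes "\<And>x. x \<noteq> 0 \<Longrightarrow> poly p x = poly q x"
  shows "p = q"
proof (rule ccontr)
  assume "p \<noteq> q"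
  then have "finite {x. poly (p - q) x = 0}" by (intro poly_roots_finite) auto
  moreover have "UNIV - {0} \<subseteq> {x. poly (p - q) x = 0}" using assms by auto
  ultimately have "finite (UNIV - {0::'k})" using finite_subset by blast
  then show False using infinite_UNIV_alg_closed_field[where 'k='k] by simp
qed

lemma poly_eqI_field:
  fixes p q :: "'k::alg_closed_field poly"
  assumes "\<And>x. poly p x = poly q x"
  shows "p = q"
  using assms by (intro poly_eqI_nonzero) auto

text \<open>Different exponents would make a monomial of positive degree equal to 1 away from 0.
  This lets weights be read off from characters.\<close>

lemma power_int_inj:
  fixes a b :: int
  assumes "\<And>x::'k::alg_closed_field. x \<noteq> 0 \<Longrightarrow> power_int x a = power_int x b"
  shows "a = b"
proof -
  have *: "a \<le> b" if h: "\<And>x::'k. x \<noteq> 0 \<Longrightarrow> power_int x a = power_int x b" for a b :: int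
  proof (rule ccontr)
    assume "\<not> a \<le> b"
    define m where "m = nat (a - b)"
    have m: "int m = a - b" "m > 0" using \<open>\<not> a \<le> b\<close> by (auto simp: m_def)
    have "poly (monom (1::'k) m) x = poly 1 x" if "x \<noteq> 0" for x
    proof -
      have "x ^ m = power_int x (a - b)" using m(1) by (metis power_int_of_nat)
      also have "\<dots> = 1" using h[OF that] that by (simp add: power_int_diff)
      finally show ?thesis by (simp add: poly_monom)
    qed
    then have "monom (1::'k) m = 1" by (rule poly_eqI_nonzero)
    then have "degree (monom (1::'k) m) = 0" by simp
    then show False using m by (simp add: degree_monom_eq)
  qed
  show ?thesis using *[of a b] *[of b a] assms by fastforce
qed

text \<open>Order at 0 and degree are both additive, and the order is at most the degree; equality
  for the product forces equality for each factor.\<close>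

lemma monom_factor:
  fixes p q :: "'k::field poly"
  assumes "p * q = monom c K" "c \<noteq> 0"
  shows "\<exists>a e. a \<noteq> 0 \<and> p = monom a e"
proof -
  have nz: "p \<noteq> 0" "q \<noteq> 0" using assms by auto
  have od: "order 0 r \<le> degree r" if "r \<noteq> 0" for r :: "'k poly" using that by (rule order_degree)
  have om: "order 0 (monom c K) = K"
    using assms(2) by (simp add: order_0_monom)
  have "order 0 p + order 0 q = K" using nz assms om by (metis order_mult mult_eq_0_iff)
  moreover have "degree p + degree q = K" using nz assms by (metis degree_mult_eq degree_monom_eq)
  ultimately have e: "order 0 p = degree p" using od[OF nz(1)] od[OF nz(2)] by linarith
  have "[:-0, 1:] ^ order 0 p dvd p" by (rule order_1)
  then obtain r where r: "p = [:0,1:] ^ degree p * r" using e by (auto elim: dvdE)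
  have rn: "r \<noteq> 0" using nz r by auto
  have "degree p = degree ([:0,1::'k:] ^ degree p) + degree r"
    using r rn by (metis degree_mult_eq nz(1) mult_zero_left)
  then have "degree r = 0" by (simp add: degree_power_eq)
  then obtain a where a: "r = [:a:]" by (metis degree_eq_zeroE)
  have "p = monom a (degree p)" by (subst r) (simp add: a monom_altdef mult.commute)
  moreover have "a \<noteq> 0" using rn a by auto
  ultimately show ?thesis by blast
qed

text \<open>Transition between the two standard charts of the projective line.\<close>
lemma poly_reciprocal:
  fixes P Q :: "'k::alg_closed_field poly"
  assumes h: "\<And>x. x \<noteq> 0 \<Longrightarrow> poly P x = power_int x e * poly Q (inverse x)"
  shows "e < 0 \<Longrightarrow> P = 0"
    and "e = 0 \<Longrightarrow> P = [:poly Q 0:]"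
    and "e = 1 \<Longrightarrow> P = [:poly P 0, poly Q 0:]"
proof -
  define d where "d = degree Q"
  have refl: "poly (reflect_poly Q) x = x ^ d * poly Q (inverse x)" if "x \<noteq> 0" for x
    using poly_reflect_poly_nz[OF that] by (simp add: d_def)
  have dr: "degree (reflect_poly Q) \<le> d" unfolding d_def by (rule degree_reflect_poly_le)
  {
    assume e: "e < 0"
    define m where "m = nat (-e)"
    have m: "power_int x e * x ^ m = 1" if "x \<noteq> 0" for x :: 'k
      using that e by (simp add: m_def power_int_def field_simps)
    \<comment> \<open>Reflecting \<open>Q\<close> clears the denominators: a nonzero
      \<open>P\<close> would give degree at least \<open>m + d > d\<close> on the left and at most
      \<open>d\<close> on the right.\<close>
    have "monom 1 (m + d) * P = reflect_poly Q"
    proof (rule poly_eqI_nonzero)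
      fix x :: 'k assume x: "x \<noteq> 0"
      have "poly (monom 1 (m + d) * P) x = (power_int x e * x ^ m) * (x ^ d * poly Q (inverse x))"
        using h[OF x] by (simp add: poly_monom power_add)
      also have "\<dots> = poly (reflect_poly Q) x" using m[OF x] refl[OF x] by simp
      finally show "poly (monom 1 (m + d) * P) x = poly (reflect_poly Q) x" .
    qed
    then have "P \<noteq> 0 \<Longrightarrow> m + d + degree P \<le> d"
      using dr by (metis degree_mult_eq degree_monom_eq monom_eq_0_iff zero_neq_one one_neq_zero)
    then show "P = 0" using e by (cases "P = 0") (auto simp: m_def)
  }
  have nn: "degree P \<le> m" if "e = int m" for m
  proof -
    have "monom 1 d * P = monom 1 m * reflect_poly Q"
      by (rule poly_eqI_nonzero) (simp add: poly_monom refl h that)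
    then have "degree (monom 1 d * P) \<le> degree (monom (1::'k) m) + degree (reflect_poly Q)"
      by (metis degree_mult_le)
    then have "P \<noteq> 0 \<Longrightarrow> d + degree P \<le> m + d"
      using dr by (simp add: degree_mult_eq degree_monom_eq)
    then show ?thesis by (cases "P = 0") auto
  qed
  {
    assume e: "e = 0"
    then have "degree P = 0" using nn[of 0] by simp
    then obtain a where a: "P = [:a:]" by (metis degree_eq_zeroE)
    have "Q = [:a:]"
    proof (rule poly_eqI_nonzero)
      fix x :: 'k assume "x \<noteq> 0"
      then show "poly Q x = poly [:a:] x" using h[of "inverse x"] e a by simp
    qed
    then show "P = [:poly Q 0:]" using a by simp
  }
  {
    assume e: "e = 1"
    then have "degree P \<le> 1" using nn[of 1] by simp
    then have "P = [:coeff P 0, coeff P 1:]"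
      by (intro poly_eqI) (auto simp: coeff_pCons coeff_eq_0 split: nat.split)
    then obtain a b where ab: "P = [:a, b:]" by blast
    \<comment> \<open>The other chart reverses the coefficients, so its value at 0 is the slope of
      \<open>P\<close>.\<close>
    have "Q = [:b, a:]"
    proof (rule poly_eqI_nonzero)
      fix x :: 'k assume "x \<noteq> 0"
      then show "poly Q x = poly [:b, a:] x" using h[of "inverse x"] e ab by (simp add: field_simps)
    qed
    then show "P = [:poly P 0, poly Q 0:]" using ab by simp
  }
qed

section \<open>Polynomial functions\<close>

text \<open>A predicate instead of a polynomial term, so that polynomial dependence on a parameter
  can be derived by introduction rules.\<close>

definition poly1 :: "('k::comm_ring_1 \<Rightarrow> 'k) \<Rightarrow> bool" where
  "poly1 F \<longleftrightarrow> (\<exists>p. \<forall>\<tau>. poly p \<tau> = F \<tau>)"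

lemma poly1_const: "poly1 (\<lambda>\<tau>. c)"
  unfolding poly1_def by (rule exI[of _ "[:c:]"]) simp

lemma poly1_id: "poly1 (\<lambda>\<tau>. \<tau>)"
  unfolding poly1_def by (rule exI[of _ "[:0,1:]"]) simp

lemma poly1_add: "poly1 F \<Longrightarrow> poly1 G \<Longrightarrow> poly1 (\<lambda>\<tau>. F \<tau> + G \<tau>)"
  unfolding poly1_def by (metis poly_add)

lemma poly1_mult: "poly1 F \<Longrightarrow> poly1 G \<Longrightarrow> poly1 (\<lambda>\<tau>. F \<tau> * G \<tau>)"
  unfolding poly1_def by (metis poly_mult)

lemma poly1_uminus: "poly1 F \<Longrightarrow> poly1 (\<lambda>\<tau>. - F \<tau>)"
  unfolding poly1_def by (metis poly_minus)

lemma poly1_diff: "poly1 F \<Longrightarrow> poly1 G \<Longrightarrow> poly1 (\<lambda>\<tau>. F \<tau> - G \<tau>)"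
  unfolding poly1_def by (metis poly_diff)

lemma poly1_sum: "(\<And>i. i \<in> A \<Longrightarrow> poly1 (F i)) \<Longrightarrow> poly1 (\<lambda>\<tau>. \<Sum>i\<in>A. F i \<tau>)"
  by (induction A rule: infinite_finite_induct) (auto intro: poly1_const poly1_add)

lemmas poly1_intros = poly1_const poly1_id poly1_add poly1_mult poly1_uminus poly1_diff poly1_sum

lemma polyfun_cong:
  assumes "f \<in> polyfun n" "\<And>i j. i \<in> {1..n} \<Longrightarrow> j \<in> {1..n} \<Longrightarrow> x i j = y i j"
  shows "f x = f y"
  using assms by (induction rule: polyfun.induct) auto

lemma polyfun_compose:
  assumes "f \<in> polyfun n" "\<And>i j. i \<in> {1..n} \<Longrightarrow> j \<in> {1..n} \<Longrightarrow> (\<lambda>x. G x i j) \<in> polyfun m"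
  shows "(\<lambda>x. f (G x)) \<in> polyfun m"
  using assms by (induction rule: polyfun.induct) (auto intro: polyfun.intros)

lemma poly1_curve:
  assumes "f \<in> polyfun n" "\<And>i j. i \<in> {1..n} \<Longrightarrow> j \<in> {1..n} \<Longrightarrow> poly1 (\<lambda>\<tau>. G \<tau> i j)"
  shows "poly1 (\<lambda>\<tau>. f (G \<tau>))"
  using assms by (induction rule: polyfun.induct) (auto intro: poly1_intros)

lemma polyfun_uminus: "f \<in> polyfun n \<Longrightarrow> (\<lambda>x. - f x) \<in> polyfun n"
  using polyfun.mult[OF polyfun.const[of "-1" n], of f] by simp

lemma polyfun_diff: "f \<in> polyfun n \<Longrightarrow> g \<in> polyfun n \<Longrightarrow> (\<lambda>x. f x - g x) \<in> polyfun n"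
  using polyfun.add[OF _ polyfun_uminus, of f n g] by simp

lemma polyfun_sum: "(\<And>i. i \<in> A \<Longrightarrow> F i \<in> polyfun n) \<Longrightarrow> (\<lambda>x. \<Sum>i\<in>A. F i x) \<in> polyfun n"
  by (induction A rule: infinite_finite_induct) (auto intro: polyfun.const polyfun.add)

lemma polyfun_prod: "(\<And>i. i \<in> A \<Longrightarrow> F i \<in> polyfun n) \<Longrightarrow> (\<lambda>x. \<Prod>i\<in>A. F i x) \<in> polyfun n"
  by (induction A rule: infinite_finite_induct) (auto intro: polyfun.const polyfun.mult)

lemma polyfun_det:
  assumes "\<And>a b. a < m \<Longrightarrow> b < m \<Longrightarrow> (\<lambda>x. F x a b) \<in> polyfun n"
  shows "(\<lambda>x. det (mat m m (\<lambda>(a, b). F x a b))) \<in> polyfun n"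
proof -
  have "(\<lambda>x. \<Sum>p\<in>{p. p permutes {0..<m}}. signof p * (\<Prod>i = 0..<m. F x i (p i))) \<in> polyfun n"
  proof (intro polyfun_sum polyfun.mult polyfun.const polyfun_prod)
    fix p i assume "p \<in> {p. p permutes {0..<m}}" "i \<in> {0..<m}"
    then have "p i < m" using permutes_in_image[of p "{0..<m}" i] by auto
    then show "(\<lambda>x. F x i (p i)) \<in> polyfun n" using assms[of i "p i"] \<open>i \<in> _\<close> by simp
  qed
  moreover have "det (mat m m (\<lambda>(a, b). F x a b)) =
     (\<Sum>p\<in>{p. p permutes {0..<m}}. signof p * (\<Prod>i = 0..<m. F x i (p i)))" for x
    by (subst det_def'[of _ m])
       (auto intro!: sum.cong prod.cong arg_cong2[where f = "(*)"] dest: permutes_in_image)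
  ultimately show ?thesis by simp
qed

text \<open>Restrict both functions to the line through a point where \<open>f\<close> and a point
  where \<open>g\<close> does not vanish; univariate polynomials over a field have no zero
  divisors.\<close>

lemma polyfun_mult_eq_0:
  fixes f g :: "'k::alg_closed_field gl \<Rightarrow> 'k"
  assumes f: "f \<in> polyfun n" and g: "g \<in> polyfun n" and fg: "\<And>x. f x * g x = 0"
  shows "f = (\<lambda>x. 0) \<or> g = (\<lambda>x. 0)"
proof (rule ccontr)
  assume "\<not> ?thesis"
  then obtain x y where xy: "f x \<noteq> 0" "g y \<noteq> 0" by (auto simp: fun_eq_iff)
  let ?c = "\<lambda>\<tau> i j. x i j + \<tau> * (y i j - x i j)"
  have "poly1 (\<lambda>\<tau>. f (?c \<tau>))" "poly1 (\<lambda>\<tau>. g (?c \<tau>))"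
    by (rule poly1_curve[OF f] poly1_curve[OF g]; intro poly1_intros)+
  then obtain p q where p: "\<And>\<tau>. poly p \<tau> = f (?c \<tau>)" and q: "\<And>\<tau>. poly q \<tau> = g (?c \<tau>)"
    unfolding poly1_def by metis
  have "p * q = 0" by (rule poly_eqI_field) (simp add: p q fg)
  then have "p = 0 \<or> q = 0" by simp
  moreover have "poly p 0 \<noteq> 0" "poly q 1 \<noteq> 0" using xy by (simp_all add: p q)
  ultimately show False by auto
qed

text \<open>The product of \<open>f - g\<close> and \<open>D\<close> vanishes everywhere, and there
  are no zero divisors. This is the Zariski density of the set where \<open>D\<close> is nonzero,
  which allows arguing at generic matrices.\<close>

lemma polyfun_dense:
  fixes f g D :: "'k::alg_closed_field gl \<Rightarrow> 'k"
  assumes "f \<in> polyfun n" "g \<in> polyfun n" "D \<in> polyfun n" "D z \<noteq> 0"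
    and "\<And>x. D x \<noteq> 0 \<Longrightarrow> f x = g x"
  shows "f = g"
proof -
  have "(\<lambda>x. f x - g x) = (\<lambda>x. 0) \<or> D = (\<lambda>x. 0)"
    by (rule polyfun_mult_eq_0[OF polyfun_diff[OF assms(1,2)] assms(3)]) (use assms(5) in auto)
  then show ?thesis using assms(4) by (auto simp: fun_eq_iff)
qed

section \<open>Matrices as functions\<close>

lemma mmult_in: "i \<in> {1..n} \<Longrightarrow> j \<in> {1..n} \<Longrightarrow> mmult n a b i j = (\<Sum>l=1..n. a i l * b l j)"
  by (simp add: mmult_def)

lemma is_mat_mmult [simp]: "is_mat n (mmult n a b)"
  by (simp add: is_mat_def mmult_def)

lemma is_mat_idm [simp]: "is_mat n (idm n)"
  by (auto simp: is_mat_def idm_def)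

lemma mmult_assoc: "mmult n (mmult n a b) c = mmult n a (mmult n b c)"
proof (intro ext)
  fix i j
  show "mmult n (mmult n a b) c i j = mmult n a (mmult n b c) i j"
  proof (cases "i \<in> {1..n} \<and> j \<in> {1..n}")
    case True
    have "mmult n (mmult n a b) c i j = (\<Sum>l=1..n. (\<Sum>k=1..n. a i k * b k l) * c l j)"
      using True by (simp add: mmult_def)
    also have "\<dots> = (\<Sum>l=1..n. \<Sum>k=1..n. a i k * (b k l * c l j))"
      by (simp add: sum_distrib_right mult.assoc)
    also have "\<dots> = (\<Sum>k=1..n. a i k * (\<Sum>l=1..n. b k l * c l j))"
      by (subst sum.swap) (simp add: sum_distrib_left)
    also have "\<dots> = mmult n a (mmult n b c) i j"
      using True by (simp add: mmult_def)
    finally show ?thesis .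
  qed (auto simp: mmult_def)
qed

lemma idm_mmult: "is_mat n a \<Longrightarrow> mmult n (idm n) a = a"
  by (auto simp: fun_eq_iff mmult_def idm_def is_mat_def if_distrib[of "\<lambda>x. x * _"] cong: if_cong)

lemma mmult_idm: "is_mat n a \<Longrightarrow> mmult n a (idm n) = a"
  by (auto simp: fun_eq_iff mmult_def idm_def is_mat_def if_distrib[of "\<lambda>x. _ * x"] cong: if_cong)

lemma GL_I: "is_mat n g \<Longrightarrow> is_mat n h \<Longrightarrow> mmult n g h = idm n \<Longrightarrow> mmult n h g = idm n \<Longrightarrow> g \<in> GL n"
  by (auto simp: GL_def)

lemma minv_eq:
  assumes "is_mat n g" "is_mat n h" "mmult n g h = idm n" "mmult n h g = idm n"
  shows "minv n g = h"
  unfolding minv_def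
proof (rule the_equality)
  fix k assume k: "is_mat n k \<and> mmult n g k = idm n \<and> mmult n k g = idm n"
  then show "k = h" using assms by (metis mmult_assoc mmult_idm idm_mmult)
qed (use assms in auto)

lemma GL_minv:
  assumes "g \<in> GL n"
  shows "is_mat n g" "is_mat n (minv n g)" "mmult n g (minv n g) = idm n"
    "mmult n (minv n g) g = idm n" "minv n g \<in> GL n" "minv n (minv n g) = g"
proof -
  obtain h where h: "is_mat n h" "mmult n g h = idm n" "mmult n h g = idm n" and g: "is_mat n g"
    using assms by (auto simp: GL_def)
  then have [simp]: "minv n g = h" by (intro minv_eq)
  show "is_mat n g" "is_mat n (minv n g)" "mmult n g (minv n g) = idm n"
    "mmult n (minv n g) g = idm n" using h g by auto
  show "minv n g \<in> GL n" using h g by (auto intro: GL_I)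
  show "minv n (minv n g) = g" using h g by (auto intro: minv_eq)
qed

lemma GL_mmult:
  assumes "g \<in> GL n" "h \<in> GL n"
  shows "mmult n g h \<in> GL n" "minv n (mmult n g h) = mmult n (minv n h) (minv n g)"
proof -
  note G = GL_minv[OF assms(1)] GL_minv[OF assms(2)]
  have 1: "mmult n (mmult n g h) (mmult n (minv n h) (minv n g)) = idm n"
    using G by (metis mmult_assoc idm_mmult)
  have 2: "mmult n (mmult n (minv n h) (minv n g)) (mmult n g h) = idm n"
    using G by (metis mmult_assoc idm_mmult)
  show "mmult n g h \<in> GL n" "minv n (mmult n g h) = mmult n (minv n h) (minv n g)"
    using 1 2 by (auto intro!: GL_I minv_eq)
qed

lemma minv_idm: "minv n (idm n) = idm n"
  by (rule minv_eq) (simp_all add: idm_mmult)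

definition conjg :: "nat \<Rightarrow> 'k::comm_ring_1 gl \<Rightarrow> 'k gl \<Rightarrow> 'k gl" where
  "conjg n g x = mmult n (mmult n g x) (minv n g)"

lemma conj_mmult: "g \<in> GL n \<Longrightarrow> h \<in> GL n \<Longrightarrow> conjg n (mmult n g h) x = conjg n g (conjg n h x)"
  by (simp add: conjg_def GL_mmult mmult_assoc)

lemma is_mat_conj [simp]: "is_mat n (conjg n g x)"
  by (simp add: conjg_def)

lemma act_eq_conj: "g \<in> GL n \<Longrightarrow> act n g f x = f (conjg n (minv n g) x)"
  by (simp add: act_def conjg_def GL_minv)

text \<open>Arguments of polynomial functions may carry arbitrary entries outside the index range,
  whereas \<open>conjg\<close> returns zeros there. Conjugation by the identity is therefore
  truncation, which polynomial functions do not notice.\<close>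

definition trunc :: "nat \<Rightarrow> 'k::zero gl \<Rightarrow> 'k gl" where
  "trunc n x = (\<lambda>i j. if i \<in> {1..n} \<and> j \<in> {1..n} then x i j else 0)"

lemma is_mat_trunc [simp]: "is_mat n (trunc n x)"
  by (auto simp: is_mat_def trunc_def)

lemma trunc_trunc [simp]: "trunc n (trunc n x) = trunc n x"
  by (auto simp: trunc_def fun_eq_iff)

lemma polyfun_trunc: "f \<in> polyfun n \<Longrightarrow> f (trunc n x) = f x"
  by (rule polyfun_cong) (auto simp: trunc_def)

lemma mmult_trunc [simp]: "mmult n (trunc n x) y = mmult n x y" "mmult n x (trunc n y) = mmult n x y"
  by (auto simp: mmult_def trunc_def fun_eq_iff intro!: sum.cong)

lemma mmult_idm_trunc: "mmult n x (idm n) = trunc n x"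
  using mmult_idm[OF is_mat_trunc, of n x] by simp

lemma idm_mmult_trunc: "mmult n (idm n) x = trunc n x"
  using idm_mmult[OF is_mat_trunc, of n x] by simp

lemma mmult_conj: "g \<in> GL n \<Longrightarrow> mmult n (conjg n g x) g = mmult n g x"
  using GL_minv[of g n] by (simp add: conjg_def mmult_assoc mmult_idm_trunc)

lemma conj_trunc [simp]: "conjg n g (trunc n x) = conjg n g x"
  by (simp add: conjg_def)

lemma conj_idm: "conjg n (idm n) x = trunc n x"
  by (simp add: conjg_def minv_idm mmult_idm_trunc idm_mmult_trunc mmult_idm)

lemma conj_minv_conj:
  assumes "g \<in> GL n"
  shows "conjg n (minv n g) (conjg n g x) = trunc n x" "conjg n g (conjg n (minv n g) x) = trunc n x"
  using GL_minv[OF assms] conj_mmult[of g n "minv n g" x] conj_mmult[of "minv n g" n g x] assms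
  by (simp_all add: conj_idm)

lemma polyfun_conj:
  assumes "f \<in> polyfun n"
  shows "(\<lambda>x. f (conjg n g x)) \<in> polyfun n"
  by (rule polyfun_compose[OF assms])
     (auto simp: conjg_def mmult_def intro!: polyfun_sum polyfun.mult polyfun.const polyfun.coord)

declare One_nat_def [simp del]

lemma sum_1_n: "(\<Sum>l=1..n. f l) = (\<Sum>l<n. f (Suc l))"
  by (simp add: One_nat_def sum.atLeast1_atMost_eq)

section \<open>The coefficients of the characteristic polynomial and their gradients\<close>

text \<open>The increasing enumeration of \<open>S\<close> transports the Leibniz sum from positions
  to elements of \<open>S\<close>, and transport along a bijection keeps the sign of a permutation.
  All principal minors become sums over permutations of one index range.\<close>

lemma det_submat:
  assumes "finite S"
  shows "det (submat x S) = (\<Sum>p | p permutes S. signof p * (\<Prod>i\<in>S. x i (p i)))"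
proof -
  define l where "l = sorted_list_of_set S"
  define k where "k = card S"
  have len: "length l = k" "set l = S" "distinct l" using assms by (auto simp: l_def k_def)
  have bij: "bij_betw ((!) l) {0..<k} S"
    using bij_betw_nth[of l "{..<k}" S] len by (simp add: lessThan_atLeast0)
  let ?g = "\<lambda>q x. if x \<in> S then l ! (q (inv_into {0..<k} ((!) l) x)) else x"
  have bp: "bij_betw ?g {q. q permutes {0..<k}} {q. q permutes S}"
    using bij_betw_permutations[OF bij] .
  have gm: "?g q = map_permutation {0..<k} ((!) l) q" for q
    using bij by (auto simp: map_permutation_def bij_betw_def restrict_id_def fun_eq_iff)
  have "det (submat x S) = (\<Sum>q | q permutes {0..<k}. signof q * (\<Prod>i = 0..<k. x (l ! i) (l ! q i)))"
    unfolding submat_def Let_def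
    by (subst det_def'[of _ k])
       (auto simp: l_def k_def intro!: sum.cong prod.cong arg_cong2[where f = "(*)"] dest: permutes_in_image)
  also have "\<dots> = (\<Sum>q | q permutes {0..<k}. signof (?g q) * (\<Prod>i\<in>S. x i (?g q i)))"
  proof (intro sum.cong refl)
    fix q assume "q \<in> {q. q permutes {0..<k}}"
    then have q: "q permutes {0..<k}" by simp
    have "sign (?g q) = sign q"
      unfolding gm by (rule sign_map_permutation) (use q bij in \<open>auto simp: bij_betw_def\<close>)
    moreover have "(\<Prod>i\<in>S. x i (?g q i)) = (\<Prod>i = 0..<k. x (l ! i) (?g q (l ! i)))"
      by (rule prod.reindex_bij_betw[OF bij, symmetric])
    moreover have "\<dots> = (\<Prod>i = 0..<k. x (l ! i) (l ! q i))"
      using bij len by (intro prod.cong refl) (auto simp: bij_betw_inv_into_left[OF bij])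
    ultimately show "signof q * (\<Prod>i = 0..<k. x (l ! i) (l ! q i)) = signof (?g q) * (\<Prod>i\<in>S. x i (?g q i))"
      by simp
  qed
  also have "\<dots> = (\<Sum>p | p permutes S. signof p * (\<Prod>i\<in>S. x i (p i)))"
    by (rule sum.reindex_bij_betw[OF bp])
  finally show ?thesis .
qed

text \<open>The determinant of \<open>1 + \<sigma> x\<close> is the generating function of the \<open>s\<^sub>j\<close>, and its adjugate that of
  their gradients.\<close>
definition qmat :: "nat \<Rightarrow> 'k::comm_ring_1 gl \<Rightarrow> 'k poly mat" where
  "qmat n x = mat n n (\<lambda>(i, j). [:if i = j then 1 else 0, x (Suc i) (Suc j):])"

lemma qmat_carrier [simp]: "qmat n x \<in> carrier_mat n n"
  by (simp add: qmat_def)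

lemma qmat_submat: "qmat n x = submat (\<lambda>i j. [:if i = j then 1 else 0, x i j:]) {1..n}"
proof -
  have "sorted_list_of_set {1..n} = [1..<Suc n]"
    by (metis atLeastLessThanSuc_atLeastAtMost sorted_list_of_set_range)
  then show ?thesis
    unfolding qmat_def submat_def Let_def
    by (intro eq_matI) (auto simp: nth_upt One_nat_def simp del: upt_Suc)
qed

text \<open>Expand each Leibniz product by the subset \<open>X\<close> of rows that contribute their
  linear term. The constant terms on the complement multiply to 1 if the permutation fixes the
  complement, that is, permutes \<open>X\<close>, and to 0 otherwise; exchanging the sums leaves the
  principal minors, each in degree \<open>card X\<close>.\<close>

lemma coeff_det_qmat:
  fixes x :: "'k::idom gl"
  shows "coeff (det (qmat n x)) j = s_inv n j x"
proof -
  let ?A = "{1..n}"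
  have split: "(\<Prod>i\<in>?A. [:if i = p i then 1 else 0, x i (p i):]) =
      (\<Sum>X\<in>Pow ?A. if p permutes X then monom (\<Prod>i\<in>X. x i (p i)) (card X) else 0)"
    if p: "p permutes ?A" for p
  proof -
    have "(\<Prod>i\<in>?A. [:if i = p i then 1 else 0, x i (p i):]) =
       (\<Prod>i\<in>?A. monom (x i (p i)) 1 + [:if i = p i then 1 else 0:])"
      by (intro prod.cong refl) (simp add: monom_altdef)
    also have "\<dots> = (\<Sum>X\<in>Pow ?A. (\<Prod>i\<in>X. monom (x i (p i)) 1) * (\<Prod>i\<in>?A - X. [:if i = p i then 1 else 0:]))"
      by (rule prod_add) simp
    also have "\<dots> = (\<Sum>X\<in>Pow ?A. if p permutes X then monom (\<Prod>i\<in>X. x i (p i)) (card X) else 0)"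
    proof (intro sum.cong refl)
      fix X assume X: "X \<in> Pow ?A"
      then have fX: "finite X" by (auto intro: finite_subset)
      have m: "(\<Prod>i\<in>X. monom (x i (p i)) 1) = monom (\<Prod>i\<in>X. x i (p i)) (card X)"
        using fX by induction (auto simp: mult_monom One_nat_def)
      have px: "p permutes X \<longleftrightarrow> (\<forall>i\<in>?A - X. p i = i)"
        using p permutes_superset[of p ?A X] by (auto dest: permutes_not_in)
      have "(\<Prod>i\<in>?A - X. [:if i = p i then 1 else 0:]) = (if p permutes X then 1 else (0::'k poly))"
      proof (cases "p permutes X")
        case True
        then have "(\<Prod>i\<in>?A - X. [:if i = p i then 1 else 0:]) = (\<Prod>i\<in>?A - X. (1::'k poly))"
          using px by (intro prod.cong) (auto simp: one_pCons)
        then show ?thesis using True by simp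
      next
        case False
        then obtain i where "i \<in> ?A - X" "p i \<noteq> i" using px by blast
        then show ?thesis using False by (auto intro!: prod_zero bexI[of _ i])
      qed
      then show "(\<Prod>i\<in>X. monom (x i (p i)) 1) * (\<Prod>i\<in>?A - X. [:if i = p i then 1 else 0:]) =
        (if p permutes X then monom (\<Prod>i\<in>X. x i (p i)) (card X) else 0)"
        using m by simp
    qed
    finally show ?thesis .
  qed
  have fin: "finite {p. p permutes ?A}" by (simp add: finite_permutations)
  have "det (qmat n x) = (\<Sum>p | p permutes ?A. signof p * (\<Prod>i\<in>?A. [:if i = p i then 1 else 0, x i (p i):]))"
    unfolding qmat_submat by (rule det_submat) simp
  also have "\<dots> = (\<Sum>p | p permutes ?A. \<Sum>X\<in>Pow ?A.
      if p permutes X then signof p * monom (\<Prod>i\<in>X. x i (p i)) (card X) else 0)"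
    by (intro sum.cong refl) (auto simp: split sum_distrib_left intro!: sum.cong)
  also have "\<dots> = (\<Sum>X\<in>Pow ?A. \<Sum>p | p permutes ?A.
      if p permutes X then signof p * monom (\<Prod>i\<in>X. x i (p i)) (card X) else 0)"
    by (rule sum.swap)
  also have "\<dots> = (\<Sum>X\<in>Pow ?A. monom (det (submat x X)) (card X))"
  proof (intro sum.cong refl)
    fix X assume X: "X \<in> Pow ?A"
    then have fX: "finite X" by (auto intro: finite_subset)
    have sg: "signof p * monom c k = monom (signof p * c) k" for p :: "nat \<Rightarrow> nat" and c :: 'k and k
      by (simp add: sign_def minus_monom)
    have "(\<Sum>p | p permutes ?A. if p permutes X then signof p * monom (\<Prod>i\<in>X. x i (p i)) (card X) else 0)
      = (\<Sum>p\<in>{p \<in> {p. p permutes ?A}. p permutes X}. signof p * monom (\<Prod>i\<in>X. x i (p i)) (card X))"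
      by (rule sum.inter_filter[OF fin, symmetric])
    also have "{p \<in> {p. p permutes ?A}. p permutes X} = {p. p permutes X}"
      using X by (auto intro: permutes_subset)
    also have "(\<Sum>p | p permutes X. signof p * monom (\<Prod>i\<in>X. x i (p i)) (card X)) =
       monom (det (submat x X)) (card X)"
      unfolding det_submat[OF fX] sg by (simp add: monom_sum)
    finally show "(\<Sum>p | p permutes ?A. if p permutes X then signof p * monom (\<Prod>i\<in>X. x i (p i)) (card X) else 0)
      = monom (det (submat x X)) (card X)" .
  qed
  finally have "coeff (det (qmat n x)) j = (\<Sum>X\<in>Pow ?A. if card X = j then det (submat x X) else 0)"
    by (simp add: coeff_sum)
  also have "\<dots> = (\<Sum>X\<in>{X \<in> Pow ?A. card X = j}. det (submat x X))"
    by (rule sum.inter_filter[symmetric]) simp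
  also have "{X \<in> Pow ?A. card X = j} = {S. S \<subseteq> ?A \<and> card S = j}" by auto
  finally show ?thesis by (simp add: s_inv_def)
qed

lemma s_inv_0: "s_inv n 0 x = 1"
proof -
  have "{S. S \<subseteq> {1..n} \<and> card S = 0} = {{}}" by (auto dest: finite_subset)
  then show ?thesis by (simp add: s_inv_def submat_def)
qed

lemma s_inv_gt:
  assumes "n < j"
  shows "s_inv n j x = 0"
proof -
  have "card S \<noteq> j" if "S \<subseteq> {1..n}" for S
    using card_mono[OF _ that] assms by simp
  then have "{S. S \<subseteq> {1..n} \<and> card S = j} = {}" by blast
  then show ?thesis by (simp only: s_inv_def sum.empty)
qed

lemma polyfun_s_inv: "s_inv n j \<in> polyfun n"
  unfolding s_inv_def
proof (intro polyfun_sum)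
  fix S assume "S \<in> {S. S \<subseteq> {1..n} \<and> card S = j}"
  then have S: "S \<subseteq> {1..n}" "finite S" by (auto intro: finite_subset)
  then have l: "a < card S \<Longrightarrow> sorted_list_of_set S ! a \<in> {1..n}" for a
    by (metis nth_mem set_sorted_list_of_set length_sorted_list_of_set subsetD)
  show "(\<lambda>x. det (submat x S)) \<in> polyfun n"
    unfolding submat_def Let_def by (intro polyfun_det polyfun.coord l)
qed

section \<open>Partial derivatives of the \<open>s_inv\<close> and their recursion\<close>

lemma pdiff_eqI:
  fixes f :: "'k::alg_closed_field gl \<Rightarrow> 'k"
  assumes "\<And>\<tau>. f (\<lambda>a b. x a b + \<tau> * elem i j a b) = poly p \<tau>"
  shows "pdiff i j f x = coeff p 1"
  unfolding pdiff_def
proof (rule the_equality)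
  fix c assume "\<exists>q. (\<forall>\<tau>. poly q \<tau> = f (\<lambda>a b. x a b + \<tau> * elem i j a b)) \<and> coeff q 1 = c"
  then obtain q where q: "\<And>\<tau>. poly q \<tau> = poly p \<tau>" "coeff q 1 = c" using assms by auto
  then have "q = p" by (intro poly_eqI_field)
  then show "c = coeff p 1" using q by simp
qed (use assms in auto)

text \<open>Laplace expansion along the first row: changing the entry \<open>(1, i)\<close> leaves
  the cofactors of that row alone, so the dependence on \<open>\<tau>\<close> is affine. The entry
  carries a factor of the variable in \<open>qmat\<close>, whence the degree
  \<open>j - 1\<close>.\<close>

lemma s_inv_perturb:
  fixes x :: "'k::idom gl"
  assumes i: "i \<in> {1..n}" and j: "1 \<le> j"
  shows "s_inv n j (\<lambda>a b. x a b + \<tau> * elem 1 i a b) =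
     s_inv n j x + \<tau> * coeff (cofactor (qmat n x) 0 (i - 1)) (j - 1)"
proof -
  have n: "0 < n" using i by simp
  let ?y = "\<lambda>a b. x a b + \<tau> * elem 1 i a b"
  have cof: "cofactor (qmat n ?y) 0 l = cofactor (qmat n x) 0 l" for l
    unfolding cofactor_def
    by (intro arg_cong2[where f = "(*)"] arg_cong[where f = det] refl eq_matI)
       (auto simp: mat_delete_def qmat_def elem_def)
  have ent: "qmat n ?y $$ (0, l) = qmat n x $$ (0, l) + (if l = i - 1 then monom \<tau> 1 else 0)" if "l < n" for l
    using that i n by (auto simp: qmat_def elem_def monom_altdef)
  have "det (qmat n ?y) = (\<Sum>l<n. qmat n ?y $$ (0, l) * cofactor (qmat n ?y) 0 l)"
    by (rule laplace_expansion_row[OF _ n]) simp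
  also have "\<dots> = (\<Sum>l<n. qmat n x $$ (0, l) * cofactor (qmat n x) 0 l +
       (if l = i - 1 then monom \<tau> 1 * cofactor (qmat n x) 0 l else 0))"
    by (intro sum.cong refl) (auto simp: cof ent algebra_simps)
  also have "\<dots> = det (qmat n x) + monom \<tau> 1 * cofactor (qmat n x) 0 (i - 1)"
    using i by (simp add: sum.distrib laplace_expansion_row[OF _ n, of "qmat n x"]) auto
  finally have "coeff (det (qmat n ?y)) j = coeff (det (qmat n x) + monom \<tau> 1 * cofactor (qmat n x) 0 (i - 1)) j"
    by simp
  then show ?thesis using j by (simp add: coeff_det_qmat coeff_monom_mult)
qed

text \<open>Column \<open>j\<close> is the first column of the gradient of \<open>s\<^sub>j\<close> with respect to the trace form.\<close>
definition gradmat :: "nat \<Rightarrow> 'k::alg_closed_field gl \<Rightarrow> 'k gl" where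
  "gradmat n x = (\<lambda>i j. pdiff 1 i (s_inv n j) x)"

lemma gradmat_eq_cofactor:
  assumes "i \<in> {1..n}" "1 \<le> j"
  shows "gradmat n x i j = coeff (cofactor (qmat n x) 0 (i - 1)) (j - 1)"
proof -
  let ?c = "coeff (cofactor (qmat n x) 0 (i - 1)) (j - 1)"
  have "pdiff 1 i (s_inv n j) x = coeff [:s_inv n j x, ?c:] 1"
    by (rule pdiff_eqI) (simp add: s_inv_perturb[OF assms])
  then show ?thesis by (simp add: gradmat_def One_nat_def)
qed

text \<open>Compare the coefficients of degree \<open>j\<close> in the first column of
  \<open>Q * adj Q = det Q\<close> for \<open>Q = qmat n x\<close>. The terms with entries of
  \<open>x\<close> are shifted by one degree and contribute nothing at \<open>j = 0\<close>.\<close>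

lemma gradmat_recursion:
  assumes i: "i \<in> {1..n}"
  shows "gradmat n x i (Suc j) + (if j = 0 then 0 else \<Sum>l=1..n. x i l * gradmat n x l j) =
     (if i = 1 then s_inv n j x else 0)"
proof -
  have n: "0 < n" using i by simp
  let ?c = "\<lambda>l. cofactor (qmat n x) 0 l"
  have "(qmat n x * adj_mat (qmat n x)) $$ (i - 1, 0) = (det (qmat n x) \<cdot>\<^sub>m 1\<^sub>m n) $$ (i - 1, 0)"
    using adj_mat(2)[of "qmat n x" n] by simp
  moreover have "(qmat n x * adj_mat (qmat n x)) $$ (i - 1, 0) = (\<Sum>l<n. qmat n x $$ (i - 1, l) * ?c l)"
    using i n by (auto simp: times_mat_def scalar_prod_def adj_mat_def qmat_def lessThan_atLeast0 intro!: sum.cong)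
  moreover have "\<dots> = (\<Sum>l<n. (if l = i - 1 then ?c l else 0) + monom (x i (Suc l)) 1 * ?c l)"
    using i by (intro sum.cong refl) (auto simp: qmat_def monom_altdef algebra_simps one_pCons)
  moreover have "\<dots> = ?c (i - 1) + (\<Sum>l=1..n. monom (x i l) 1 * ?c (l - 1))"
    using i by (simp add: sum.distrib sum_1_n) auto
  ultimately have "?c (i - 1) + (\<Sum>l=1..n. monom (x i l) 1 * ?c (l - 1)) =
     (if i = 1 then det (qmat n x) else 0)"
    using i n by auto
  then have "coeff (?c (i - 1) + (\<Sum>l=1..n. monom (x i l) 1 * ?c (l - 1))) j =
     (if i = 1 then s_inv n j x else 0)"
    by (simp add: coeff_det_qmat)
  moreover have "(\<Sum>l=1..n. coeff (monom (x i l) 1 * ?c (l - 1)) j) =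
     (if j = 0 then 0 else \<Sum>l=1..n. x i l * gradmat n x l j)"
    by (auto simp: coeff_monom_mult gradmat_eq_cofactor intro!: sum.cong)
  ultimately show ?thesis using i by (simp add: gradmat_eq_cofactor coeff_sum)
qed

lemma gradmat_1: "i \<in> {1..n} \<Longrightarrow> gradmat n x i 1 = (if i = 1 then 1 else 0)"
  using gradmat_recursion[of i n x 0] by (simp add: s_inv_0 One_nat_def)

lemma gradmat_Suc: "i \<in> {1..n} \<Longrightarrow> 1 \<le> j \<Longrightarrow>
   gradmat n x i (Suc j) = (if i = 1 then s_inv n j x else 0) - (\<Sum>l=1..n. x i l * gradmat n x l j)"
  using gradmat_recursion[of i n x j] by (simp add: algebra_simps)

text \<open>There are no minors of size \<open>n + 1\<close>. Together with the recursion at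
  \<open>j = n\<close> this is the first column of the Cayley-Hamilton identity.\<close>

lemma gradmat_Suc_n: "i \<in> {1..n} \<Longrightarrow> gradmat n x i (Suc n) = 0"
  unfolding gradmat_def by (subst pdiff_eqI[where p = 0]) (auto simp: s_inv_gt)

text \<open>The recursion builds the entries from \<open>s_inv\<close> and the coordinates, without
  any reference to derivatives.\<close>

lemma polyfun_gradmat:
  assumes "i \<in> {1..n}" "1 \<le> j"
  shows "(\<lambda>x. gradmat n x i j) \<in> polyfun n"
  using assms(2,1)
proof (induction j arbitrary: i rule: dec_induct)
  case base
  then show ?case by (simp only: gradmat_1[OF base] polyfun.const)
next
  case (step j)
  have "(\<lambda>x. if i = 1 then s_inv n j x else 0) \<in> polyfun n"
    by (cases "i = 1") (simp_all add: polyfun_s_inv polyfun.const)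
  then show ?case unfolding gradmat_Suc[OF step.prems step.hyps(1)]
    by (intro polyfun_diff polyfun_sum polyfun.mult polyfun.coord) (use step in auto)
qed

text \<open>Over the polynomial ring, with \<open>g\<close> as a matrix of constants,
  \<open>g * qmat n x = qmat n (conjg n g x) * g\<close>; take determinants and cancel
  \<open>det g\<close>.\<close>

lemma s_inv_conj:
  fixes x :: "'k::alg_closed_field gl"
  assumes g: "g \<in> GL n"
  shows "s_inv n j (conjg n g x) = s_inv n j x"
proof -
  let ?e = "\<lambda>g. mat n n (\<lambda>(i, j). [:g (Suc i) (Suc j):]) :: 'k poly mat"
  have em: "?e a * ?e b = ?e (mmult n a b)" for a b :: "'k gl"
    by (intro eq_matI) (auto simp: times_mat_def scalar_prod_def mmult_def sum_1_n lessThan_atLeast0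
        simp flip: sum_to_poly intro!: sum.cong)
  have "?e g * ?e (minv n g) = 1\<^sub>m n"
    unfolding em using GL_minv[OF g] by (intro eq_matI) (auto simp: idm_def one_pCons)
  then have "det (?e g) * det (?e (minv n g)) = 1"
    by (metis det_mult det_one mat_carrier)
  then have nz: "det (?e g) \<noteq> 0" by auto
  have mg: "mmult n g x a b = mmult n (conjg n g x) g a b" for a b
    using mmult_conj[OF g, of x] by simp
  have "?e g * qmat n x = qmat n (conjg n g x) * ?e g"
  proof (intro eq_matI)
    fix i j assume ij: "i < dim_row (qmat n (conjg n g x) * ?e g)" "j < dim_col (qmat n (conjg n g x) * ?e g)"
    then have ij: "i < n" "j < n" by (auto simp: qmat_def)
    have *: "[:c:] * [:d, e:] = [:c * d, c * e:]" "[:d, e:] * [:c:] = [:d * c, e * c:]" for c d e :: 'k by simp_all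
    have sp: "(\<Sum>l\<in>A. [:F l, G l:]) = [:\<Sum>l\<in>A. F l, \<Sum>l\<in>A. G l:]" for A and F G :: "nat \<Rightarrow> 'k"
      by (induction A rule: infinite_finite_induct) auto
    have "(?e g * qmat n x) $$ (i, j) = (\<Sum>l<n. [:g (Suc i) (Suc l):] * [:if l = j then 1 else 0, x (Suc l) (Suc j):])"
      using ij by (auto simp: times_mat_def scalar_prod_def qmat_def lessThan_atLeast0 intro!: sum.cong)
    also have "\<dots> = [:g (Suc i) (Suc j), mmult n g x (Suc i) (Suc j):]"
      using ij by (simp only: * sp) (simp add: mmult_def sum_1_n if_distrib cong: if_cong)
    also have "\<dots> = (\<Sum>l<n. [:if i = l then 1 else 0, conjg n g x (Suc i) (Suc l):] * [:g (Suc l) (Suc j):])"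
      using ij by (simp only: * sp mg) (simp add: mmult_def sum_1_n if_distrib if_distribR cong: if_cong)
    also have "\<dots> = (qmat n (conjg n g x) * ?e g) $$ (i, j)"
      using ij by (auto simp: times_mat_def scalar_prod_def qmat_def lessThan_atLeast0 intro!: sum.cong)
    finally show "(?e g * qmat n x) $$ (i, j) = (qmat n (conjg n g x) * ?e g) $$ (i, j)" .
  qed (auto simp: qmat_def)
  then have "det (?e g) * det (qmat n x) = det (qmat n (conjg n g x)) * det (?e g)"
    by (metis det_mult qmat_carrier mat_carrier)
  then have "det (qmat n x) = det (qmat n (conjg n g x))" using nz by simp
  then show ?thesis by (metis coeff_det_qmat)
qed

text \<open>The gradient of an invariant is equivariant; the scalar is the inverse of the
  eigenvalue of \<open>g\<close> on the first basis vector.\<close>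
lemma gradmat_conj:
  fixes x :: "'k::alg_closed_field gl"
  assumes g: "g \<in> GL n" and g1: "\<And>i. i \<in> {1..n} \<Longrightarrow> i \<noteq> 1 \<Longrightarrow> g i 1 = 0"
    and i: "i \<in> {1..n}" and j: "1 \<le> j" "j \<le> n"
  shows "g 1 1 * gradmat n (conjg n g x) i j = mmult n g (gradmat n x) i j"
proof -
  define z where "z = conjg n g x"
  have zg: "mmult n z g = mmult n g x" unfolding z_def by (rule mmult_conj[OF g])
  have "g 1 1 * gradmat n z i j = mmult n g (gradmat n x) i j"
    using j i
  proof (induction j arbitrary: i rule: dec_induct)
    case base
    have "mmult n g (gradmat n x) i 1 = (\<Sum>l=1..n. g i l * (if l = 1 then 1 else 0))"
      using base by (subst mmult_in) (auto simp: gradmat_1 intro!: sum.cong)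
    also have "\<dots> = g i 1" using base by (simp add: if_distrib cong: if_cong)
    finally show ?case using base g1[of i] gradmat_1[of i n z] by auto
  next
    case (step j)
    let ?y = "\<lambda>i. if i = 1 then s_inv n j x else 0"
    have "mmult n g (gradmat n x) i (Suc j) = (\<Sum>l=1..n. g i l * (?y l - mmult n x (gradmat n x) l j))"
      using step by (subst mmult_in) (auto simp: gradmat_Suc mmult_def intro!: sum.cong)
    also have "\<dots> = (\<Sum>l=1..n. g i l * ?y l) - mmult n g (mmult n x (gradmat n x)) i j"
      using step by (simp add: mmult_in[of i n j g] right_diff_distrib sum_subtractf)
    also have "(\<Sum>l=1..n. g i l * ?y l) = g i 1 * s_inv n j x"
      using step by (simp add: if_distrib cong: if_cong)
    also have "mmult n g (mmult n x (gradmat n x)) i j = mmult n z (mmult n g (gradmat n x)) i j"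
      by (simp flip: mmult_assoc add: zg)
    also have "\<dots> = (\<Sum>l=1..n. z i l * (g 1 1 * gradmat n z l j))"
      using step by (subst mmult_in) (auto intro!: sum.cong)
    \<comment> \<open>Here the first basis vector must be an eigenvector: the first column of
      \<open>g\<close> is zero below \<open>g 1 1\<close>.\<close>
    also have "g i 1 * s_inv n j x = g 1 1 * (if i = 1 then s_inv n j z else 0)"
      using step.prems g1[of i] by (auto simp: z_def s_inv_conj[OF g])
    finally show ?case unfolding gradmat_Suc[OF step.prems(2) step.hyps(1)]
      by (simp add: right_diff_distrib sum_distrib_left mult_ac)
  qed
  then show ?thesis by (simp add: z_def)
qed

section \<open>Elementary, diagonal and permutation matrices\<close>

definition elm :: "nat \<Rightarrow> nat \<Rightarrow> nat \<Rightarrow> 'k::comm_ring_1 \<Rightarrow> 'k gl" where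
  "elm n a b \<tau> = (\<lambda>i j. idm n i j + \<tau> * elem a b i j)"

definition dgm :: "nat \<Rightarrow> (nat \<Rightarrow> 'k::comm_ring_1) \<Rightarrow> 'k gl" where
  "dgm n v = (\<lambda>i j. if i \<in> {1..n} \<and> i = j then v i else 0)"

definition dg1 :: "nat \<Rightarrow> nat \<Rightarrow> 'k::comm_ring_1 \<Rightarrow> 'k gl" where
  "dg1 n a \<tau> = dgm n (\<lambda>i. if i = a then \<tau> else 1)"

text \<open>Column \<open>j\<close> has its 1 in row \<open>\<pi> j\<close>, so basis vectors are
  permuted by \<open>\<pi>\<close> itself and \<open>pm\<close> is multiplicative.\<close>

definition pm :: "nat \<Rightarrow> (nat \<Rightarrow> nat) \<Rightarrow> 'k::comm_ring_1 gl" where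
  "pm n \<pi> = (\<lambda>i j. if i \<in> {1..n} \<and> j \<in> {1..n} \<and> i = \<pi> j then 1 else 0)"

lemma elm_mmult:
  assumes "a \<in> {1..n}" "b \<in> {1..n}"
  shows "mmult n (elm n a b \<tau>) g =
    (\<lambda>i j. if i \<in> {1..n} \<and> j \<in> {1..n} then g i j + (if i = a then \<tau> * g b j else 0) else 0)"
proof (intro ext)
  fix i j
  have "(\<Sum>l=1..n. elm n a b \<tau> i l * g l j) = g i j + (if i = a then \<tau> * g b j else 0)" if "i \<in> {1..n}"
  proof -
    have "(\<Sum>l=1..n. elm n a b \<tau> i l * g l j) =
       (\<Sum>l=1..n. (if l = i then g l j else 0) + (if l = b then (if i = a then \<tau> * g l j else 0) else 0))"
      using that by (intro sum.cong) (auto simp: elm_def idm_def elem_def algebra_simps)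
    also have "\<dots> = g i j + (if i = a then \<tau> * g b j else 0)"
      using that assms by (simp add: sum.distrib)
    finally show ?thesis .
  qed
  then show "mmult n (elm n a b \<tau>) g i j =
     (if i \<in> {1..n} \<and> j \<in> {1..n} then g i j + (if i = a then \<tau> * g b j else 0) else 0)"
    by (simp add: mmult_def)
qed

lemma dgm_mmult:
  "mmult n (dgm n v) g = (\<lambda>i j. if i \<in> {1..n} \<and> j \<in> {1..n} then v i * g i j else 0)"
  by (auto simp: fun_eq_iff mmult_def dgm_def if_distrib[of "\<lambda>x. x * _"] cong: if_cong)

lemma mmult_dgm:
  "mmult n g (dgm n v) = (\<lambda>i j. if i \<in> {1..n} \<and> j \<in> {1..n} then g i j * v j else 0)"
  by (auto simp: fun_eq_iff mmult_def dgm_def if_distrib[of "\<lambda>x. _ * x"] cong: if_cong)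

lemma is_mat_elm [simp]: "a \<in> {1..n} \<Longrightarrow> b \<in> {1..n} \<Longrightarrow> is_mat n (elm n a b \<tau>)"
  by (auto simp: elm_def is_mat_def idm_def elem_def)

lemma is_mat_dgm [simp]: "is_mat n (dgm n v)"
  by (auto simp: is_mat_def dgm_def)

lemma is_mat_pm [simp]: "is_mat n (pm n \<pi>)"
  by (auto simp: is_mat_def pm_def)

lemma pm_mmult:
  assumes "\<pi> permutes {1..n}"
  shows "mmult n (pm n \<pi>) g = (\<lambda>i j. if i \<in> {1..n} \<and> j \<in> {1..n} then g (inv_into UNIV \<pi> i) j else 0)"
proof (intro ext)
  fix i j
  have "(\<Sum>l=1..n. pm n \<pi> i l * g l j) = g (inv_into UNIV \<pi> i) j" if "i \<in> {1..n}"
  proof -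
    have "(\<Sum>l=1..n. pm n \<pi> i l * g l j) = (\<Sum>l=1..n. if l = inv_into UNIV \<pi> i then g l j else 0)"
      using that permutes_inverses[OF assms] by (intro sum.cong) (auto simp: pm_def)
    also have "\<dots> = g (inv_into UNIV \<pi> i) j"
      using that permutes_in_image[OF permutes_inv[OF assms]] by simp
    finally show ?thesis .
  qed
  then show "mmult n (pm n \<pi>) g i j = (if i \<in> {1..n} \<and> j \<in> {1..n} then g (inv_into UNIV \<pi> i) j else 0)"
    by (simp add: mmult_def)
qed

lemma pm_compose:
  assumes "\<pi> permutes {1..n}" "\<rho> permutes {1..n}"
  shows "mmult n (pm n \<pi>) (pm n \<rho>) = pm n (\<pi> \<circ> \<rho>)"
  using permutes_inverses[OF assms(1)] permutes_in_image[OF permutes_inv[OF assms(1)]]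
    permutes_in_image[OF assms(1)] permutes_in_image[OF assms(2)]
  unfolding pm_mmult[OF assms(1)] by (auto simp: pm_def fun_eq_iff permutes_inv_eq[OF assms(1)])

lemma pm_id: "pm n id = idm n"
  by (auto simp: pm_def idm_def fun_eq_iff)

lemma pm_GL:
  assumes "\<pi> permutes {1..n}"
  shows "pm n \<pi> \<in> GL n"
  by (rule GL_I[of _ _ "pm n (inv_into UNIV \<pi>)"])
     (use assms in \<open>simp_all add: pm_compose permutes_inv permutes_inv_o pm_id\<close>)

lemma elm_elm:
  assumes "a \<in> {1..n}" "b \<in> {1..n}" "a \<noteq> b"
  shows "mmult n (elm n a b \<tau>) (elm n a b (- \<tau>)) = idm n"
  using assms by (auto simp: elm_mmult fun_eq_iff) (auto simp: elm_def idm_def elem_def)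

lemma elm_GL:
  assumes "a \<in> {1..n}" "b \<in> {1..n}" "a \<noteq> b"
  shows "elm n a b \<tau> \<in> GL n" "minv n (elm n a b \<tau>) = elm n a b (- \<tau>)"
  using assms elm_elm[OF assms, of \<tau>] elm_elm[OF assms, of "- \<tau>"]
  by (auto intro!: GL_I minv_eq)

lemma dgm_dgm: "mmult n (dgm n v) (dgm n w) = dgm n (\<lambda>i. v i * w i)"
  by (auto simp: dgm_mmult) (auto simp: dgm_def fun_eq_iff)

lemma dgm_GL:
  fixes v :: "nat \<Rightarrow> 'k::field"
  assumes "\<And>i. i \<in> {1..n} \<Longrightarrow> v i \<noteq> 0"
  shows "dgm n v \<in> GL n" "minv n (dgm n v) = dgm n (\<lambda>i. inverse (v i))"
proof -
  have "mmult n (dgm n v) (dgm n (\<lambda>i. inverse (v i))) = idm n"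
     "mmult n (dgm n (\<lambda>i. inverse (v i))) (dgm n v) = idm n"
    using assms by (auto simp: dgm_dgm) (auto simp: dgm_def idm_def fun_eq_iff)
  then show "dgm n v \<in> GL n" "minv n (dgm n v) = dgm n (\<lambda>i. inverse (v i))"
    by (auto intro!: GL_I minv_eq)
qed

lemma dg1_GL:
  fixes \<tau> :: "'k::field"
  assumes "\<tau> \<noteq> 0"
  shows "dg1 n a \<tau> \<in> GL n" "minv n (dg1 n a \<tau>) = dg1 n a (inverse \<tau>)"
proof -
  have e: "(\<lambda>i. inverse (if i = a then \<tau> else 1)) = (\<lambda>i. if i = a then inverse \<tau> else 1)" by auto
  show "dg1 n a \<tau> \<in> GL n" "minv n (dg1 n a \<tau>) = dg1 n a (inverse \<tau>)"
    using dgm_GL[of n "\<lambda>i. if i = a then \<tau> else 1"] assms unfolding dg1_def e by auto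
qed

section \<open>Transpositions and Gauss elimination by elementary matrices\<close>

lemma elm_cancel:
  assumes "a \<in> {1..n}" "b \<in> {1..n}" "a \<noteq> b" "is_mat n g"
  shows "mmult n (elm n a b (- \<tau>)) (mmult n (elm n a b \<tau>) g) = g"
  using elm_elm[OF assms(1-3), of "- \<tau>"] assms(4) by (simp flip: mmult_assoc add: idm_mmult)

text \<open>In \<open>SL\<^sub>2\<close> three alternating elementary matrices give the Weyl element
  with rows \<open>(0, -1)\<close> and \<open>(1, 0)\<close>; the dilation of row \<open>a\<close>
  by -1 corrects the sign.\<close>

lemma pm_transpose_mmult:
  fixes g :: "'k::comm_ring_1 gl"
  assumes ab: "1 \<le> a" "a < b" "b \<le> n"
  shows "mmult n (pm n (Transposition.transpose a b)) g = mmult n (dg1 n a (-1))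
     (mmult n (elm n a b (-1)) (mmult n (elm n b a 1) (mmult n (elm n a b (-1)) g)))"
proof (intro ext)
  fix i j
  have r: "a \<in> {1..n}" "b \<in> {1..n}" "a \<noteq> b" "b \<noteq> a" using ab by auto
  have tr: "Transposition.transpose a b permutes {1..n}" using r by (simp add: permutes_swap_id)
  show "mmult n (pm n (Transposition.transpose a b)) g i j = mmult n (dg1 n a (-1))
     (mmult n (elm n a b (-1)) (mmult n (elm n b a 1) (mmult n (elm n a b (-1)) g))) i j"
    using r tr by (simp add: pm_mmult elm_mmult dg1_def dgm_mmult)
qed

text \<open>An induction principle for the stabilizer of the first basis vector. Elementary matrices
  with source row \<open>b\<close> at least 2 and dilations of rows from 2 on fix this vector, and
  column-by-column elimination shows that they generate its stabilizer.\<close>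

lemma GL_elimination:
  fixes g :: "'k::field gl"
  assumes g: "g \<in> GL n" and g1: "\<And>i. i \<in> {1..n} \<Longrightarrow> g i 1 = (if i = 1 then 1 else 0)"
    and n: "1 \<le> n"
    and Z1: "Z (idm n)"
    and Ze: "\<And>g a b \<tau>. g \<in> GL n \<Longrightarrow> Z g \<Longrightarrow> a \<in> {1..n} \<Longrightarrow> b \<in> {2..n} \<Longrightarrow> a \<noteq> b \<Longrightarrow>
               Z (mmult n (elm n a b \<tau>) g)"
    and Zd: "\<And>g a \<tau>. g \<in> GL n \<Longrightarrow> Z g \<Longrightarrow> a \<in> {2..n} \<Longrightarrow> \<tau> \<noteq> 0 \<Longrightarrow> Z (mmult n (dg1 n a \<tau>) g)"
  shows "Z g"
proof -
  define std where "std c g \<longleftrightarrow> (\<forall>i\<in>{1..n}. \<forall>j\<in>{1..n}. j \<le> c \<longrightarrow> g i j = (if i = j then 1 else (0::'k)))"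
    for c g
  \<comment> \<open>The inverse of an elementary matrix is elementary, so \<open>Z\<close> may also
    be pulled back along a row operation.\<close>
  have Ze': "Z g" if "g \<in> GL n" "Z (mmult n (elm n a b \<tau>) g)" "a \<in> {1..n}" "b \<in> {2..n}" "a \<noteq> b" for g a b \<tau>
  proof -
    have b: "b \<in> {1..n}" using that by auto
    have "Z (mmult n (elm n a b (- \<tau>)) (mmult n (elm n a b \<tau>) g))"
      by (rule Ze) (use that b in \<open>auto intro!: GL_mmult(1) elm_GL(1)\<close>)
    then show ?thesis using that b by (simp add: elm_cancel GL_minv)
  qed
  \<comment> \<open>Downward induction on the number of columns that already agree with the identity
    matrix.\<close>
  have "\<forall>g\<in>GL n. std 1 g \<longrightarrow> Z g"
    using n
  proof (induction rule: inc_induct)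
    case base
    have "g = idm n" if "g \<in> GL n" "std n g" for g
    proof (intro ext)
      fix i j show "g i j = idm n i j"
        using that GL_minv(1)[OF that(1)]
        by (cases "i \<in> {1..n} \<and> j \<in> {1..n}") (simp_all add: std_def idm_def is_mat_def, auto)
    qed
    then show ?case using Z1 by blast
  next
    case (step c)
    define k where "k = Suc c"
    have k: "k \<in> {2..n}" "k \<in> {1..n}" and c: "1 \<le> c" "c < k" using step by (auto simp: k_def)
    \<comment> \<open>With pivot 1 in column \<open>k\<close>, clear the remaining nonzero entries
      of the column one at a time, above and below the pivot.\<close>
    have A: "Z g" if "g \<in> GL n" "std c g" "g k k = 1" for g
      using that
    proof (induction "card {i \<in> {1..n} - {k}. g i k \<noteq> 0}" arbitrary: g rule: less_induct)
      case less
      show ?case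
      proof (cases "\<exists>i\<in>{1..n} - {k}. g i k \<noteq> 0")
        case False
        have "g i j = (if i = j then 1 else 0)"
          if "i \<in> {1..n}" "j \<in> {1..n}" "j \<le> Suc c" for i j
        proof (cases "j = k")
          case True
          then show ?thesis using False less.prems(3) that by auto
        next
          case False
          then show ?thesis using less.prems(2) that by (auto simp: std_def k_def)
        qed
        then have "std (Suc c) g" by (auto simp: std_def)
        then show ?thesis using step.IH less.prems by blast
      next
        case True
        then obtain i where i: "i \<in> {1..n}" "i \<noteq> k" "g i k \<noteq> 0" by blast
        let ?g = "mmult n (elm n i k (- g i k)) g"
        have e: "?g r s = g r s + (if r = i then - g i k * g k s else 0)" if "r \<in> {1..n}" "s \<in> {1..n}" for r s
          using that i k by (simp add: elm_mmult)
        have "?g i k = 0" using e[OF i(1) k(2)] less.prems(3) by simp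
        moreover have "g r k \<noteq> 0" if "r \<in> {1..n}" "?g r k \<noteq> 0" for r
          using e[OF that(1) k(2)] that(2) i(3) by (cases "r = i") simp_all
        ultimately have "{r \<in> {1..n} - {k}. ?g r k \<noteq> 0} \<subset> {r \<in> {1..n} - {k}. g r k \<noteq> 0}"
          using i by blast
        then have "card {r \<in> {1..n} - {k}. ?g r k \<noteq> 0} < card {r \<in> {1..n} - {k}. g r k \<noteq> 0}"
          by (intro psubset_card_mono) auto
        then have "Z ?g"
        proof (rule less.hyps)
          show "?g \<in> GL n" using less.prems i k by (auto intro!: GL_mmult(1) elm_GL(1))
          show "std c ?g" using less.prems(2) k c by (auto simp: std_def e)
          show "?g k k = 1" using e[OF k(2) k(2)] i less.prems by simp
        qed
        then show ?thesis using less.prems i k by (intro Ze'[of g i k]) auto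
      qed
    qed
    have B: "Z g" if "g \<in> GL n" "std c g" "g k k \<noteq> 0" for g
    proof -
      let ?g = "mmult n (dg1 n k (inverse (g k k))) g"
      have e: "?g r s = (if r = k then inverse (g k k) else 1) * g r s" if "r \<in> {1..n}" "s \<in> {1..n}" for r s
        using that by (simp add: dg1_def dgm_mmult)
      have GL: "?g \<in> GL n" using that by (auto intro!: GL_mmult(1) dg1_GL(1))
      have "Z ?g"
      proof (rule A[OF GL])
        show "std c ?g" using that(2) k c by (auto simp: std_def e)
        show "?g k k = 1" using e[OF k(2) k(2)] that by simp
      qed
      then have "Z (mmult n (dg1 n k (g k k)) ?g)"
        by (rule Zd[OF GL]) (use that k in auto)
      moreover have "mmult n (dg1 n k (g k k)) (dg1 n k (inverse (g k k))) = idm n"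
        using dg1_GL[OF that(3), of n k] GL_minv(3) by metis
      ultimately show ?thesis
        using GL_minv(1)[OF that(1)] by (simp flip: mmult_assoc add: idm_mmult)
    qed
    show ?case
    proof (intro ballI impI)
      fix g :: "'k gl" assume g: "g \<in> GL n" "std c g"
      show "Z g"
      proof (cases "g k k = 0")
        case True
        define h where "h = minv n g"
        have hg: "mmult n h g = idm n" using GL_minv(4)[OF g(1)] by (simp add: h_def)
        \<comment> \<open>Row \<open>k\<close> of the inverse vanishes in the finished columns. If
          column \<open>k\<close> of \<open>g\<close> also vanished from row \<open>k\<close> on,
          the entry \<open>(k, k)\<close> of \<open>h g\<close> would be 0, so some lower row
          supplies a pivot.\<close>
        have hk: "h k j = 0" if "j \<in> {1..n}" "j \<le> c" for j
        proof -
          have "idm n k j = (\<Sum>l=1..n. h k l * g l j)" using that k mmult_in[of k n j h g] hg by simp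
          also have "\<dots> = (\<Sum>l=1..n. if l = j then h k l else 0)"
            using g(2) that by (intro sum.cong) (auto simp: std_def)
          also have "\<dots> = h k j" using that by simp
          finally show ?thesis using that c by (auto simp: idm_def)
        qed
        have "\<exists>r\<in>{k..n}. g r k \<noteq> 0"
        proof (rule ccontr)
          assume no: "\<not> ?thesis"
          have "idm n k k = (\<Sum>l=1..n. h k l * g l k)" using k mmult_in[of k n k h g] hg by simp
          also have "\<dots> = 0"
          proof (intro sum.neutral ballI)
            fix l assume l: "l \<in> {1..n}"
            show "h k l * g l k = 0"
              using l no hk[of l] by (cases "l \<le> c") (auto simp: k_def)
          qed
          finally show False using k by (simp add: idm_def)
        qed
        then obtain r where r: "r \<in> {k..n}" "g r k \<noteq> 0" by auto
        then have rk: "r \<in> {2..n}" "r \<in> {1..n}" "k \<noteq> r" using True k by auto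
        let ?g = "mmult n (elm n k r 1) g"
        have e: "?g i s = g i s + (if i = k then g r s else 0)" if "i \<in> {1..n}" "s \<in> {1..n}" for i s
          using that rk k by (simp add: elm_mmult)
        have "Z ?g"
        proof (rule B)
          show "?g \<in> GL n" using g rk k by (auto intro!: GL_mmult(1) elm_GL(1))
          show "std c ?g" using g(2) r rk k c by (auto simp: std_def e)
          show "?g k k \<noteq> 0" using e[OF k(2) k(2)] True r by simp
        qed
        then show ?thesis using g rk k by (intro Ze'[of g k r]) auto
      qed (use B g in auto)
    qed
  qed
  moreover have "std 1 g" using g1 n by (auto simp: std_def)
  ultimately show ?thesis using g by blast
qed

section \<open>Functions of the last rows\<close>

text \<open>Here \<open>n - m\<close> is the number of relevant rows; such functions are the sections of the
  line bundle of a fundamental weight on the stabilizer of the first basis vector.\<close>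
definition row_semi :: "nat \<Rightarrow> nat \<Rightarrow> ('k::field gl \<Rightarrow> 'k) \<Rightarrow> bool" where
  "row_semi n m \<Phi> \<longleftrightarrow> (\<forall>g\<in>GL n.
     (\<forall>a b \<tau>. 1 \<le> a \<and> a < b \<and> b \<le> n \<longrightarrow> \<Phi> (mmult n (elm n a b \<tau>) g) = \<Phi> g) \<and>
     (\<forall>a \<tau>. 2 \<le> a \<and> a \<le> n \<and> \<tau> \<noteq> 0 \<longrightarrow>
        \<Phi> (mmult n (dg1 n a \<tau>) g) = (if m < a then \<tau> else 1) * \<Phi> g) \<and>
     (\<forall>a b \<tau>. 2 \<le> a \<and> a < b \<and> b \<le> n \<longrightarrow> \<Phi> (mmult n (elm n b a \<tau>) g) =
        \<Phi> g + (if a \<le> m \<and> m < b then \<tau> * \<Phi> (mmult n (pm n (Transposition.transpose a b)) g) else 0)))"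

lemma row_semiD:
  assumes "row_semi n m \<Phi>" "g \<in> GL n"
  shows "1 \<le> a \<Longrightarrow> a < b \<Longrightarrow> b \<le> n \<Longrightarrow> \<Phi> (mmult n (elm n a b \<tau>) g) = \<Phi> g"
    "2 \<le> a \<Longrightarrow> a \<le> n \<Longrightarrow> \<tau> \<noteq> 0 \<Longrightarrow> \<Phi> (mmult n (dg1 n a \<tau>) g) = (if m < a then \<tau> else 1) * \<Phi> g"
    "2 \<le> a \<Longrightarrow> a < b \<Longrightarrow> b \<le> n \<Longrightarrow> \<Phi> (mmult n (elm n b a \<tau>) g) =
        \<Phi> g + (if a \<le> m \<and> m < b then \<tau> * \<Phi> (mmult n (pm n (Transposition.transpose a b)) g) else 0)"
  using assms unfolding row_semi_def by blast+

lemma row_semi_diff: "row_semi n m \<Phi> \<Longrightarrow> row_semi n m \<Psi> \<Longrightarrow> row_semi n m (\<lambda>g. \<Phi> g - \<Psi> g)"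
  unfolding row_semi_def by (auto simp: algebra_simps)

lemma row_semi_add: "row_semi n m \<Phi> \<Longrightarrow> row_semi n m \<Psi> \<Longrightarrow> row_semi n m (\<lambda>g. \<Phi> g + \<Psi> g)"
  unfolding row_semi_def by (auto simp: algebra_simps)

lemma row_semi_cmult: "row_semi n m \<Phi> \<Longrightarrow> row_semi n m (\<lambda>g. c * \<Phi> g)"
  unfolding row_semi_def by (auto simp: algebra_simps)

lemma row_semi_0: "row_semi n m (\<lambda>g. 0)"
  unfolding row_semi_def by auto

lemma row_semi_sum: "(\<And>i. i \<in> A \<Longrightarrow> row_semi n m (F i)) \<Longrightarrow> row_semi n m (\<lambda>g. \<Sum>i\<in>A. F i g)"
  by (induction A rule: infinite_finite_induct) (auto intro: row_semi_0 row_semi_add)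

text \<open>Both indices lie on the same side of \<open>m\<close>, so the elementary factors of the
  transposition act trivially and only the dilation by -1 can contribute.\<close>

lemma row_semi_swap:
  assumes \<Phi>: "row_semi n m \<Phi>" and g: "g \<in> GL n" and ab: "2 \<le> a" "a < b" "b \<le> n" "b \<le> m \<or> m < a"
  shows "\<Phi> (mmult n (pm n (Transposition.transpose a b)) g) = (if m < a then -1 else 1) * \<Phi> g"
proof -
  have r: "a \<in> {1..n}" "b \<in> {1..n}" "a \<noteq> b" using ab by auto
  have a1: "1 \<le> a" using ab by linarith
  let ?g1 = "mmult n (elm n a b (-1)) g"
  let ?g2 = "mmult n (elm n b a 1) ?g1"
  let ?g3 = "mmult n (elm n a b (-1)) ?g2"
  have G: "?g1 \<in> GL n" "?g2 \<in> GL n" "?g3 \<in> GL n" using g r by (auto intro!: GL_mmult(1) elm_GL(1))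
  have e1: "mmult n (pm n (Transposition.transpose a b)) g = mmult n (dg1 n a (-1)) ?g3"
    by (rule pm_transpose_mmult[OF a1 ab(2,3)])
  have e2: "\<Phi> (mmult n (dg1 n a (-1)) ?g3) = (if m < a then -1 else 1) * \<Phi> ?g3"
    by (rule row_semiD(2)[OF \<Phi> G(3)]) (use ab in auto)
  have e3: "\<Phi> ?g3 = \<Phi> ?g2" using row_semiD(1)[OF \<Phi> G(2) a1 ab(2,3), of "-1"] .
  have e4: "\<Phi> ?g2 = \<Phi> ?g1" using ab by (auto simp: row_semiD(3)[OF \<Phi> G(1)])
  have e5: "\<Phi> ?g1 = \<Phi> g" using row_semiD(1)[OF \<Phi> g a1 ab(2,3), of "-1"] .
  show ?thesis unfolding e1 e2 e3 e4 e5 ..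
qed

text \<open>Each transposition inside a block changes the value by a sign at most, hence preserves
  vanishing.\<close>

lemma row_semi_perm_block:
  assumes \<Phi>: "row_semi n m \<Phi>" and g: "g \<in> GL n" and S: "S = {2..m} \<or> S = {m+1..n}" "1 \<le> m" "m \<le> n"
    and p: "p permutes S"
  shows "\<Phi> (mmult n (pm n p) g) = 0 \<longleftrightarrow> \<Phi> g = 0"
proof -
  have sub: "S \<subseteq> {2..n}" using S by auto
  have sub1: "S \<subseteq> {1..n}" using sub by auto
  have fin: "finite S" using S by auto
  have main: "\<Phi> (mmult n (pm n (Transposition.transpose a b)) h) = 0 \<longleftrightarrow> \<Phi> h = 0"
    if "a \<in> S" "b \<in> S" "a < b" "h \<in> GL n" for a b h
    using row_semi_swap[OF \<Phi> that(4), of a b] that S sub by auto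
  show ?thesis using p fin
  proof (induction rule: permutes_induct)
    case id
    then show ?case using GL_minv(1)[OF g] by (simp add: pm_id[unfolded id_def] idm_mmult)
  next
    case (swap a b p)
    have P: "p permutes {1..n}" "transpose a b permutes {1..n}"
      using subsetD[OF sub1] permutes_subset[OF swap.hyps(4) sub1] swap.hyps
      by (auto intro!: permutes_swap_id)
    have G: "mmult n (pm n p) g \<in> GL n" using P g by (auto intro!: GL_mmult(1) pm_GL)
    have "mmult n (pm n (Transposition.transpose a b \<circ> p)) g = mmult n (pm n (Transposition.transpose a b)) (mmult n (pm n p) g)"
      using P by (simp flip: mmult_assoc pm_compose)
    moreover have "\<Phi> (mmult n (pm n (Transposition.transpose a b)) (mmult n (pm n p) g)) = 0 \<longleftrightarrow> \<Phi> (mmult n (pm n p) g) = 0"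
      using main[of a b, OF _ _ _ G] main[of b a, OF _ _ _ G] swap by (cases "a < b") (auto simp: transpose_commute[of a b])
    ultimately show ?case using swap.IH by (simp only:)
  qed
qed

text \<open>Eliminate with the vanishing at all \<open>\<pi> g\<close> as the induced property.
  Moving \<open>\<pi>\<close> past a generator only renames the indices of the generator, and the
  transposition produced by a lower elementary matrix is absorbed by the quantifier over
  \<open>\<pi>\<close>.\<close>

lemma row_semi_zero:
  assumes \<Phi>: "row_semi n m \<Phi>" and g: "g \<in> GL n" "\<And>i. i \<in> {1..n} \<Longrightarrow> g i 1 = (if i = 1 then 1 else 0)"
    and n: "1 \<le> n" and 0: "\<And>\<pi>. \<pi> permutes {2..n} \<Longrightarrow> \<Phi> (pm n \<pi>) = 0"
  shows "\<Phi> g = 0"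
proof -
  have P: "\<pi> permutes {1..n}" if "\<pi> permutes {2..n}" for \<pi> :: "nat \<Rightarrow> nat"
    using that by (rule permutes_subset) auto
  have "\<forall>\<pi>. \<pi> permutes {2..n} \<longrightarrow> \<Phi> (mmult n (pm n \<pi>) g) = 0"
  proof (rule GL_elimination[OF g n, where Z = "\<lambda>g. \<forall>\<pi>. \<pi> permutes {2..n} \<longrightarrow> \<Phi> (mmult n (pm n \<pi>) g) = 0"])
    show "\<forall>\<pi>. \<pi> permutes {2..n} \<longrightarrow> \<Phi> (mmult n (pm n \<pi>) (idm n)) = 0"
      using 0 by (simp add: mmult_idm)
  next
    fix g a b \<tau>
    assume g: "g \<in> GL n" and Z: "\<forall>\<pi>. \<pi> permutes {2..n} \<longrightarrow> \<Phi> (mmult n (pm n \<pi>) g) = 0"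
      and a: "a \<in> {1..n}" and b: "b \<in> {2..n}" and ab: "a \<noteq> b"
    show "\<forall>\<pi>. \<pi> permutes {2..n} \<longrightarrow> \<Phi> (mmult n (pm n \<pi>) (mmult n (elm n a b \<tau>) g)) = 0"
    proof (intro allI impI)
      fix \<pi> :: "nat \<Rightarrow> nat" assume pi: "\<pi> permutes {2..n}"
      let ?h = "mmult n (pm n \<pi>) g"
      have pab: "\<pi> a \<in> {1..n}" "\<pi> b \<in> {2..n}" "\<pi> b \<in> {1..n}" "\<pi> a \<noteq> \<pi> b"
        using permutes_in_image[OF P[OF pi]] permutes_in_image[OF pi] a b ab permutes_inj[OF pi]
        by (auto simp: inj_eq)
      have h: "?h \<in> GL n" using g pm_GL[OF P[OF pi]] by (rule GL_mmult(1)[rotated])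
      have "mmult n (pm n \<pi>) (mmult n (elm n a b \<tau>) g) = mmult n (elm n (\<pi> a) (\<pi> b) \<tau>) ?h"
      proof (intro ext)
        fix i j
        have "inv_into UNIV \<pi> i \<in> {1..n} \<longleftrightarrow> i \<in> {1..n}" "inv_into UNIV \<pi> i = a \<longleftrightarrow> i = \<pi> a" "inv_into UNIV \<pi> (\<pi> b) = b"
          using permutes_in_image[OF permutes_inv[OF P[OF pi]]] permutes_inverses[OF pi] by auto
        then show "mmult n (pm n \<pi>) (mmult n (elm n a b \<tau>) g) i j = mmult n (elm n (\<pi> a) (\<pi> b) \<tau>) ?h i j"
          using a b pab by (simp add: pm_mmult[OF P[OF pi]] elm_mmult)
      qed
      moreover have "\<Phi> (mmult n (elm n (\<pi> a) (\<pi> b) \<tau>) ?h) = 0"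
      proof (cases "\<pi> a < \<pi> b")
        case True
        then show ?thesis using pab Z pi by (simp add: row_semiD(1)[OF \<Phi> h])
      next
        case False
        let ?t = "transpose (\<pi> b) (\<pi> a)"
        have t: "?t permutes {2..n}" using False pab by (intro permutes_swap_id) auto
        have "mmult n (pm n ?t) ?h = mmult n (pm n (?t \<circ> \<pi>)) g"
          using P[OF t] P[OF pi] by (simp flip: mmult_assoc add: pm_compose)
        then have "\<Phi> (mmult n (pm n ?t) ?h) = 0"
          using Z permutes_compose[OF pi t] by simp
        then show ?thesis using False pab Z pi by (simp add: row_semiD(3)[OF \<Phi> h])
      qed
      ultimately show "\<Phi> (mmult n (pm n \<pi>) (mmult n (elm n a b \<tau>) g)) = 0" by simp
    qed
  next
    fix g a and \<tau> :: 'a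
    assume g: "g \<in> GL n" and Z: "\<forall>\<pi>. \<pi> permutes {2..n} \<longrightarrow> \<Phi> (mmult n (pm n \<pi>) g) = 0"
      and a: "a \<in> {2..n}" and \<tau>: "\<tau> \<noteq> 0"
    show "\<forall>\<pi>. \<pi> permutes {2..n} \<longrightarrow> \<Phi> (mmult n (pm n \<pi>) (mmult n (dg1 n a \<tau>) g)) = 0"
    proof (intro allI impI)
      fix \<pi> :: "nat \<Rightarrow> nat" assume pi: "\<pi> permutes {2..n}"
      let ?h = "mmult n (pm n \<pi>) g"
      have pa: "\<pi> a \<in> {2..n}" using permutes_in_image[OF pi] a by auto
      have h: "?h \<in> GL n" using g pm_GL[OF P[OF pi]] by (rule GL_mmult(1)[rotated])
      have "mmult n (pm n \<pi>) (mmult n (dg1 n a \<tau>) g) = mmult n (dg1 n (\<pi> a) \<tau>) ?h"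
      proof (intro ext)
        fix i j
        have "inv_into UNIV \<pi> i \<in> {1..n} \<longleftrightarrow> i \<in> {1..n}" "inv_into UNIV \<pi> i = a \<longleftrightarrow> i = \<pi> a"
          using permutes_in_image[OF permutes_inv[OF P[OF pi]]] permutes_inverses[OF pi] by auto
        then show "mmult n (pm n \<pi>) (mmult n (dg1 n a \<tau>) g) i j = mmult n (dg1 n (\<pi> a) \<tau>) ?h i j"
          by (simp add: pm_mmult[OF P[OF pi]] dg1_def dgm_mmult)
      qed
      then show "\<Phi> (mmult n (pm n \<pi>) (mmult n (dg1 n a \<tau>) g)) = 0"
        using pa \<tau> Z pi by (simp add: row_semiD(2)[OF \<Phi> h])
    qed
  qed
  from this[rule_format, OF permutes_id] show ?thesis
    using GL_minv(1)[OF g(1)] by (simp add: pm_id idm_mmult)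
qed

section \<open>Minors of the last rows\<close>

definition mnr :: "nat \<Rightarrow> nat \<Rightarrow> nat set \<Rightarrow> 'k::comm_ring_1 gl \<Rightarrow> 'k" where
  "mnr m t J g = det (mat t t (\<lambda>(a, b). g (m + 1 + a) (sorted_list_of_set J ! b)))"

text \<open>Linearity in row \<open>k\<close>: the three matrices share the cofactors of this row,
  so compare the Laplace expansions.\<close>

lemma det_row_linear:
  fixes A B C :: "'a::comm_ring_1 mat"
  assumes A: "A \<in> carrier_mat n n" and B: "B \<in> carrier_mat n n" and C: "C \<in> carrier_mat n n"
    and k: "k < n"
    and off: "\<And>i j. i < n \<Longrightarrow> j < n \<Longrightarrow> i \<noteq> k \<Longrightarrow> A $$ (i, j) = B $$ (i, j) \<and> A $$ (i, j) = C $$ (i, j)"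
    and at: "\<And>j. j < n \<Longrightarrow> A $$ (k, j) = B $$ (k, j) + c * C $$ (k, j)"
  shows "det A = det B + c * det C"
proof -
  have "mat_delete A k j = mat_delete B k j" for j
    using A B off[THEN conjunct1] by (auto simp: mat_delete_def intro!: eq_matI)
  moreover have "mat_delete A k j = mat_delete C k j" for j
    using A C off[THEN conjunct2] by (auto simp: mat_delete_def intro!: eq_matI)
  ultimately have cof: "cofactor A k j = cofactor B k j" "cofactor A k j = cofactor C k j" for j
    by (simp_all add: cofactor_def)
  have "det A = (\<Sum>j<n. B $$ (k, j) * cofactor B k j + c * (C $$ (k, j) * cofactor C k j))"
    unfolding laplace_expansion_row[OF A k]
    by (intro sum.cong refl) (simp add: at cof[symmetric] algebra_simps)
  also have "\<dots> = det B + c * det C"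
    by (simp add: sum.distrib laplace_expansion_row[OF B k] laplace_expansion_row[OF C k] sum_distrib_left)
  finally show ?thesis .
qed

lemma index_sets_nth:
  assumes "J \<in> index_sets n t" "b < t"
  shows "sorted_list_of_set J ! b \<in> J" "sorted_list_of_set J ! b \<in> {1..n}"
proof -
  have J: "finite J" "card J = t" "J \<subseteq> {2..n}" using assms by (auto simp: index_sets_def intro: finite_subset)
  then show "sorted_list_of_set J ! b \<in> J"
    using assms(2) by (metis nth_mem set_sorted_list_of_set length_sorted_list_of_set)
  then show "sorted_list_of_set J ! b \<in> {1..n}" using J by auto
qed

lemma finite_index_sets [simp]: "finite (index_sets n t)"
  by (simp add: index_sets_def)

text \<open>Operations on rows above the last \<open>t\<close> are invisible, and those among the
  last \<open>t\<close> rows are row operations of the minor. Adding an upper row to a lower one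
  splits by linearity, the second summand being the minor after exchanging the two rows.\<close>

lemma row_semi_mnr:
  assumes J: "J \<in> index_sets n t" and n: "n = m + t" "1 \<le> m"
  shows "row_semi n m (mnr m t J :: 'k::field gl \<Rightarrow> 'k)"
proof -
  define l where "l = sorted_list_of_set J"
  have l: "l ! b \<in> {1..n}" if "b < t" for b using index_sets_nth[OF J that] by (simp add: l_def)
  define A where "A g = mat t t (\<lambda>(a, b). g (m + 1 + a) (l ! b))" for g :: "'k gl"
  have mA: "mnr m t J g = det (A g)" for g :: "'k gl" by (simp add: mnr_def A_def l_def)
  have Ac: "A g \<in> carrier_mat t t" for g by (simp add: A_def)
  have elm_top: "A (mmult n (elm n a b \<tau>) g) = A g" if "a \<in> {1..n}" "b \<in> {1..n}" "a \<le> m" for a b \<tau> g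
    using that l n by (auto simp: A_def elm_mmult intro!: eq_matI)
  have elm_bot: "det (A (mmult n (elm n a b \<tau>) g)) = det (A g)"
    if "a \<in> {1..n}" "b \<in> {1..n}" "m < a" "m < b" "a \<noteq> b" for a b \<tau> g
  proof -
    have "A (mmult n (elm n a b \<tau>) g) = addrow \<tau> (a - m - 1) (b - m - 1) (A g)"
      using that l n by (auto simp: A_def elm_mmult intro!: eq_matI)
    then show ?thesis using that n by (simp add: det_addrow[OF _ _ Ac])
  qed
  show ?thesis
    unfolding row_semi_def mA
  proof (intro ballI conjI allI impI; (elim conjE)?)
    fix g :: "'k gl" and a b \<tau> assume ab: "1 \<le> a" "a < b" "b \<le> n"
    then show "det (A (mmult n (elm n a b \<tau>) g)) = det (A g)"
      using elm_top[of a b \<tau> g] elm_bot[of a b \<tau> g] by (cases "a \<le> m") auto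
  next
    fix g :: "'k gl" and a and \<tau> :: 'k assume a: "2 \<le> a" "a \<le> n"
    show "det (A (mmult n (dg1 n a \<tau>) g)) = (if m < a then \<tau> else 1) * det (A g)"
    proof (cases "m < a")
      case True
      have "A (mmult n (dg1 n a \<tau>) g) = multrow (a - m - 1) \<tau> (A g)"
        using True a l n by (auto simp: A_def dg1_def dgm_mmult intro!: eq_matI)
      then show ?thesis using True a n by (simp add: det_multrow[OF _ Ac])
    next
      case False
      then have "A (mmult n (dg1 n a \<tau>) g) = A g"
        using a l n by (auto simp: A_def dg1_def dgm_mmult intro!: eq_matI)
      then show ?thesis using False by simp
    qed
  next
    fix g :: "'k gl" and a b and \<tau> :: 'k assume ab: "2 \<le> a" "a < b" "b \<le> n"
    consider "b \<le> m" | "m < a" | "a \<le> m" "m < b" by linarith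
    then show "det (A (mmult n (elm n b a \<tau>) g)) =
        det (A g) + (if a \<le> m \<and> m < b then \<tau> * det (A (mmult n (pm n (Transposition.transpose a b)) g)) else 0)"
    proof cases
      case 1
      then show ?thesis using ab elm_top[of b a \<tau> g] by auto
    next
      case 2
      then show ?thesis using ab elm_bot[of b a \<tau> g] by auto
    next
      case 3
      have tr: "Transposition.transpose a b permutes {1..n}" using ab by (simp add: permutes_swap_id)
      have "det (A (mmult n (elm n b a \<tau>) g)) =
        det (A g) + \<tau> * det (A (mmult n (pm n (Transposition.transpose a b)) g))"
      proof (rule det_row_linear[OF Ac Ac Ac])
        show "b - m - 1 < t" using 3 ab n by auto
        show "A (mmult n (elm n b a \<tau>) g) $$ (i, j) = A g $$ (i, j) \<and>
          A (mmult n (elm n b a \<tau>) g) $$ (i, j) = A (mmult n (pm n (Transposition.transpose a b)) g) $$ (i, j)"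
          if "i < t" "j < t" "i \<noteq> b - m - 1" for i j
          using that 3 ab n l[of j] tr by (auto simp: A_def elm_mmult pm_mmult transpose_def)
        show "A (mmult n (elm n b a \<tau>) g) $$ (b - m - 1, j) =
          A g $$ (b - m - 1, j) + \<tau> * A (mmult n (pm n (Transposition.transpose a b)) g) $$ (b - m - 1, j)"
          if "j < t" for j
          using that 3 ab n l[of j] tr by (auto simp: A_def elm_mmult pm_mmult transpose_def)
      qed
      then show ?thesis using 3 by simp
    qed
  qed
qed

section \<open>Permutations attached to index sets, and duality with the minors\<close>

lemma ex_perm_index_set:
  assumes J: "J \<in> index_sets n t" and n: "n = m + t" "1 \<le> m"
  shows "\<exists>\<sigma>. \<sigma> permutes {2..n} \<and> (\<forall>a<t. \<sigma> (sorted_list_of_set J ! a) = m + 1 + a)"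
proof -
  define l where "l = sorted_list_of_set J"
  have fJ: "finite J" "card J = t" "J \<subseteq> {2..n}" using J by (auto simp: index_sets_def intro: finite_subset)
  have "bij_betw ((!) l) {..<t} J" by (rule bij_betw_nth) (use fJ in \<open>auto simp: l_def\<close>)
  note inv = bij_betw_inv_into[OF this] bij_betw_inv_into_left[OF this]
  have "bij_betw (\<lambda>a. m + 1 + a) {..<t} {m+1..n}"
    by (rule bij_betw_byWitness[where f' = "\<lambda>x. x - m - 1"]) (use n in auto)
  from bij_betw_trans[OF inv(1) this]
  obtain f where f: "bij_betw f J {m+1..n}" and fl: "\<And>a. a < t \<Longrightarrow> f (l ! a) = m + 1 + a"
    using inv(2) by (auto simp: o_def)
  have "card ({2..n} - J) = card {2..m}" using fJ n by (simp add: card_Diff_subset)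
  then obtain h where h: "bij_betw h ({2..n} - J) {2..m}"
    by (metis finite_atLeastAtMost finite_Diff finite_same_card_bij)
  define p where "p x = (if x \<in> J then f x else if x \<in> {2..n} then h x else x)" for x
  have "bij_betw p (J \<union> ({2..n} - J)) ({m+1..n} \<union> {2..m})"
  proof (rule bij_betw_combine)
    show "bij_betw p J {m+1..n}" using f by (rule bij_betw_cong[THEN iffD1, rotated]) (simp add: p_def)
    show "bij_betw p ({2..n} - J) {2..m}" using h by (rule bij_betw_cong[THEN iffD1, rotated]) (simp add: p_def)
  qed auto
  moreover have "J \<union> ({2..n} - J) = {2..n}" "{m+1..n} \<union> {2..m} = {2..n}" using fJ n by auto
  ultimately have "bij_betw p {2..n} {2..n}" by simp
  then have "p permutes {2..n}" by (rule bij_imp_permutes) (use fJ in \<open>auto simp: p_def\<close>)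
  moreover have "p (l ! a) = m + 1 + a" if "a < t" for a
    using fl[OF that] index_sets_nth(1)[OF J that] by (simp add: p_def l_def)
  ultimately show ?thesis unfolding l_def by blast
qed

text \<open>One permutation for each index set, moving \<open>J\<close> in increasing order onto the
  last \<open>t\<close> rows; how the complement of \<open>J\<close> is matched with the other rows
  is left to the choice operator.\<close>

definition sperm :: "nat \<Rightarrow> nat \<Rightarrow> nat \<Rightarrow> nat set \<Rightarrow> nat \<Rightarrow> nat" where
  "sperm n m t J = (SOME \<sigma>. \<sigma> permutes {2..n} \<and> (\<forall>a<t. \<sigma> (sorted_list_of_set J ! a) = m + 1 + a))"

lemma sperm:
  assumes J: "J \<in> index_sets n t" and n: "n = m + t" "1 \<le> m"
  shows "sperm n m t J permutes {2..n}" "sperm n m t J permutes {1..n}"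
    "\<And>a. a < t \<Longrightarrow> sperm n m t J (sorted_list_of_set J ! a) = m + 1 + a"
    "sperm n m t J ` J = {m+1..n}" "sperm n m t J 1 = 1"
proof -
  let ?s = "sperm n m t J" and ?l = "sorted_list_of_set J"
  have s: "?s permutes {2..n} \<and> (\<forall>a<t. ?s (?l ! a) = m + 1 + a)"
    unfolding sperm_def by (rule someI_ex[OF ex_perm_index_set[OF assms]])
  then show 1: "?s permutes {2..n}" "\<And>a. a < t \<Longrightarrow> ?s (?l ! a) = m + 1 + a" by auto
  show "?s permutes {1..n}" using 1(1) by (rule permutes_subset) auto
  show "?s 1 = 1" using 1(1) by (rule permutes_not_in) auto
  have fJ: "finite J" "card J = t" using J by (auto simp: index_sets_def intro: finite_subset)
  have Jl: "J = (!) ?l ` {..<t}"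
    using bij_betw_nth[of ?l "{..<t}" J] fJ by (auto simp: bij_betw_def)
  have "?s ` J = (\<lambda>a. ?s (?l ! a)) ` {..<t}" using arg_cong[OF Jl, of "(`) ?s"] by (simp add: image_image)
  also have "\<dots> = (\<lambda>a. m + 1 + a) ` {..<t}" using 1(2) by (intro image_cong) auto
  also have "\<dots> = (\<lambda>a. a + (m + 1)) ` {0..<t}" by (simp add: add.commute lessThan_atLeast0)
  also have "\<dots> = {m+1..n}" unfolding image_add_atLeastLessThan' using n by auto
  finally show "?s ` J = {m+1..n}" .
qed

text \<open>For \<open>I = J\<close> the submatrix is the identity; otherwise an element of
  \<open>I\<close> outside \<open>J\<close> is sent to an upper row and yields a zero
  column.\<close>

lemma mnr_sperm:
  assumes I: "I \<in> index_sets n t" and J: "J \<in> index_sets n t" and n: "n = m + t" "1 \<le> m"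
  shows "mnr m t I (pm n (sperm n m t J)) = (if I = J then 1 else 0)"
proof -
  let ?s = "sperm n m t J" and ?l = "sorted_list_of_set I"
  note s = sperm[OF J n]
  let ?A = "mat t t (\<lambda>(a, b). pm n ?s (m + 1 + a) (?l ! b) :: 'a)"
  have ent: "?A $$ (a, b) = (if m + 1 + a = ?s (?l ! b) then 1 else 0)" if "a < t" "b < t" for a b
    using that n index_sets_nth[OF I that(2)] by (simp add: pm_def)
  show ?thesis
  proof (cases "I = J")
    case True
    have "?A $$ (a, b) = (if a = b then 1 else 0)" if "a < t" "b < t" for a b
      unfolding ent[OF that] using s(3)[OF that(2)] True by simp
    then have "?A = 1\<^sub>m t" by (intro eq_matI) (simp_all del: index_mat(1) add: index_one_mat(1))
    then show ?thesis using True by (simp add: mnr_def)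
  next
    case False
    have c: "finite I" "finite J" "card I = t" "card J = t"
      using I J by (auto simp: index_sets_def intro: finite_subset)
    then have "\<not> I \<subseteq> J" using False by (metis card_subset_eq)
    then obtain x where x: "x \<in> I" "x \<notin> J" by auto
    then obtain b where b: "b < t" "?l ! b = x"
      using c by (metis in_set_conv_nth length_sorted_list_of_set set_sorted_list_of_set)
    have "?s x \<notin> {m+1..n}"
      using x s(4) permutes_inj[OF s(1)] by (metis inj_image_mem_iff)
    then have z: "?A $$ (a, b) = 0" if "a < t" for a using that b n by (subst ent) auto
    have "det ?A = (\<Sum>a<t. ?A $$ (a, b) * cofactor ?A a b)"
      by (rule laplace_expansion_column[OF _ b(1)]) simp
    also have "\<dots> = 0" by (intro sum.neutral ballI) (simp only: lessThan_iff z mult_zero_left)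
    finally show ?thesis using False by (simp add: mnr_def)
  qed
qed

text \<open>Let \<open>J\<close> be the preimage of the last rows under \<open>\<pi>\<close>. Then
  \<open>\<pi>\<close> differs from the representative of \<open>J\<close> by a left factor that
  preserves both blocks of rows; this factor splits into one permutation of each block, and neither
  affects vanishing.\<close>

lemma row_semi_perm_zero:
  assumes \<Phi>: "row_semi n m \<Phi>" and n: "n = m + t" "1 \<le> m"
    and 0: "\<And>J. J \<in> index_sets n t \<Longrightarrow> \<Phi> (pm n (sperm n m t J)) = 0"
    and pi: "\<pi> permutes {2..n}"
  shows "\<Phi> (pm n \<pi>) = 0"
proof -
  define J where "J = {x \<in> {2..n}. m < \<pi> x}"
  have imJ: "\<pi> ` J = {m+1..n}"
  proof -
    have "x \<in> \<pi> ` J" if "x \<in> {m+1..n}" for x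
    proof -
      have x2: "x \<in> {2..n}" using that n by auto
      then obtain y where "\<pi> y = x" "y \<in> {2..n}" using permutes_image[OF pi] by (metis imageE)
      then show ?thesis using that by (auto simp: J_def)
    qed
    moreover have "\<pi> x \<in> {2..n}" if "x \<in> {2..n}" for x
      using permutes_in_image[OF pi] that by blast
    then have "\<pi> ` J \<subseteq> {m+1..n}" by (fastforce simp: J_def)
    ultimately show ?thesis by blast
  qed
  have "card J = card (\<pi> ` J)" using permutes_inj[OF pi] by (metis card_image inj_on_subset subset_UNIV)
  then have J: "J \<in> index_sets n t" using imJ n by (auto simp: index_sets_def J_def)
  define \<sigma> where "\<sigma> = sperm n m t J"
  note s = sperm[OF J n, folded \<sigma>_def]
  define \<rho> where "\<rho> = \<pi> \<circ> inv_into UNIV \<sigma>"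
  have rho: "\<rho> permutes {2..n}" unfolding \<rho>_def by (intro permutes_compose permutes_inv s pi)
  have bot: "\<rho> x \<in> {m+1..n} \<longleftrightarrow> x \<in> {m+1..n}" for x
  proof -
    have "inv_into UNIV \<sigma> x \<in> J \<longleftrightarrow> x \<in> {m+1..n}"
      using s(4) permutes_inverses[OF s(1)] permutes_inj[OF s(1)] by (metis inj_image_mem_iff)
    moreover have "\<pi> y \<in> {m+1..n} \<longleftrightarrow> y \<in> J" for y
      using imJ permutes_inj[OF pi] by (metis inj_image_mem_iff)
    ultimately show ?thesis by (simp add: \<rho>_def)
  qed
  define \<rho>1 where "\<rho>1 x = (if m < x then \<rho> x else x)" for x
  define \<rho>2 where "\<rho>2 x = (if m < x then x else \<rho> x)" for x
  have out: "\<rho> x = x" if "x \<notin> {2..n}" for x using permutes_not_in[OF rho that] .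
  have p1: "\<rho>1 permutes {m+1..n}"
  proof (rule bij_imp_permutes)
    have "inj_on \<rho>1 {m+1..n}" using permutes_inj[OF rho] by (intro inj_onI) (auto simp: \<rho>1_def dest: injD)
    moreover have "\<rho>1 ` {m+1..n} \<subseteq> {m+1..n}" using bot by (force simp: \<rho>1_def)
    ultimately show "bij_betw \<rho>1 {m+1..n} {m+1..n}" by (simp add: bij_betw_def endo_inj_surj)
  qed (use out n in \<open>auto simp: \<rho>1_def\<close>)
  have p2: "\<rho>2 permutes {2..m}"
  proof (rule bij_imp_permutes)
    have "inj_on \<rho>2 {2..m}" using permutes_inj[OF rho] by (intro inj_onI) (auto simp: \<rho>2_def dest: injD)
    moreover have "\<rho>2 ` {2..m} \<subseteq> {2..m}"
    proof
      fix y assume "y \<in> \<rho>2 ` {2..m}"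
      then obtain x where x: "x \<in> {2..m}" "y = \<rho> x" by (auto simp: \<rho>2_def)
      then have "y \<in> {2..n}" "y \<notin> {m+1..n}" using permutes_in_image[OF rho, of x] bot[of x] n by auto
      then show "y \<in> {2..m}" by auto
    qed
    ultimately show "bij_betw \<rho>2 {2..m} {2..m}" by (simp add: bij_betw_def endo_inj_surj)
  qed (use out n in \<open>auto simp: \<rho>2_def\<close>)
  have comp: "\<pi> = \<rho>1 \<circ> (\<rho>2 \<circ> \<sigma>)"
  proof
    fix x
    have "\<rho> (\<sigma> x) = \<pi> x" using permutes_inverses[OF s(1)] by (simp add: \<rho>_def)
    moreover have "\<rho>1 (\<rho>2 y) = \<rho> y" for y
    proof (cases "m < y")
      case False
      then have "\<not> m < \<rho> y" using bot[of y] out[of y] permutes_in_image[OF rho, of y] by (cases "y \<in> {2..n}") auto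
      then show ?thesis using False by (simp add: \<rho>1_def \<rho>2_def)
    qed (simp add: \<rho>1_def \<rho>2_def)
    ultimately show "\<pi> x = (\<rho>1 \<circ> (\<rho>2 \<circ> \<sigma>)) x" by simp
  qed
  have P: "\<rho>1 permutes {1..n}" "\<rho>2 permutes {1..n}"
    using p1 p2 n by (auto intro: permutes_subset)
  have "\<Phi> (pm n \<pi>) = \<Phi> (mmult n (pm n \<rho>1) (mmult n (pm n \<rho>2) (pm n \<sigma>)))"
    unfolding comp using P s(2) by (simp add: pm_compose permutes_compose)
  moreover have "\<Phi> (mmult n (pm n \<rho>1) (mmult n (pm n \<rho>2) (pm n \<sigma>))) = 0 \<longleftrightarrow> \<Phi> (mmult n (pm n \<rho>2) (pm n \<sigma>)) = 0"
    by (rule row_semi_perm_block[OF \<Phi> _ _ _ _ p1]) (use P s n in \<open>auto intro: GL_mmult pm_GL\<close>)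
  moreover have "\<Phi> (mmult n (pm n \<rho>2) (pm n \<sigma>)) = 0 \<longleftrightarrow> \<Phi> (pm n \<sigma>) = 0"
    by (rule row_semi_perm_block[OF \<Phi> _ _ _ _ p2]) (use s n in \<open>auto intro: pm_GL\<close>)
  ultimately show ?thesis using 0[OF J] by (simp add: \<sigma>_def)
qed

text \<open>By duality the difference of both sides vanishes at the representatives, hence at all
  permutation matrices fixing 1, hence on the whole stabilizer.\<close>

lemma row_semi_expand:
  assumes \<Phi>: "row_semi n m \<Phi>" and n: "n = m + t" "1 \<le> m"
    and g: "g \<in> GL n" "\<And>i. i \<in> {1..n} \<Longrightarrow> g i 1 = (if i = 1 then 1 else 0)"
  shows "\<Phi> g = (\<Sum>J\<in>index_sets n t. \<Phi> (pm n (sperm n m t J)) * mnr m t J g)"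
proof -
  let ?S = "\<lambda>g. \<Sum>J\<in>index_sets n t. \<Phi> (pm n (sperm n m t J)) * mnr m t J g"
  have rs: "row_semi n m (\<lambda>g. \<Phi> g - ?S g)"
    by (intro row_semi_diff row_semi_sum row_semi_cmult \<Phi> row_semi_mnr n)
  have "\<Phi> (pm n (sperm n m t J)) - ?S (pm n (sperm n m t J)) = 0" if "J \<in> index_sets n t" for J
    using that by (simp add: mnr_sperm[OF _ that n] if_distrib cong: if_cong)
  from row_semi_perm_zero[OF rs n this]
  have "\<Phi> g - ?S g = 0" by (intro row_semi_zero[OF rs g]) (use n in auto)
  then show ?thesis by simp
qed

section \<open>Semi-invariants\<close>

text \<open>Semi-invariance under the one-parameter subgroups generating the Borel group.\<close>
definition semi :: "nat \<Rightarrow> (nat \<Rightarrow> int) \<Rightarrow> ('k::field gl \<Rightarrow> 'k) \<Rightarrow> bool" where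
  "semi n lam f \<longleftrightarrow> f \<in> polyfun n \<and>
     (\<forall>a b \<tau> x. 1 \<le> a \<and> a < b \<and> b \<le> n \<longrightarrow> f (conjg n (elm n a b \<tau>) x) = f x) \<and>
     (\<forall>a \<tau> x. a \<in> {1..n} \<and> \<tau> \<noteq> 0 \<longrightarrow> f (conjg n (dg1 n a \<tau>) x) = power_int \<tau> (- lam a) * f x)"

lemma semiD:
  assumes "semi n lam f"
  shows "f \<in> polyfun n"
    "1 \<le> a \<Longrightarrow> a < b \<Longrightarrow> b \<le> n \<Longrightarrow> f (conjg n (elm n a b \<tau>) x) = f x"
    "1 \<le> a \<Longrightarrow> a \<le> n \<Longrightarrow> \<tau> \<noteq> 0 \<Longrightarrow> f (conjg n (dg1 n a \<tau>) x) = power_int \<tau> (- lam a) * f x"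
  using assms unfolding semi_def by auto

section \<open>Semi-invariants along lower elementary matrices\<close>

lemma poly1_conj_elm:
  assumes f: "f \<in> polyfun n" and c: "poly1 c" and ab: "a \<in> {1..n}" "b \<in> {1..n}" "a \<noteq> b"
  shows "poly1 (\<lambda>\<tau>. f (conjg n (elm n a b (c \<tau>)) x))"
proof (rule poly1_curve[OF f])
  fix i j assume ij: "i \<in> {1..n}" "j \<in> {1..n}"
  show "poly1 (\<lambda>\<tau>. conjg n (elm n a b (c \<tau>)) x i j)"
    unfolding conjg_def elm_GL(2)[OF ab] mmult_in[OF ij]
  proof (intro poly1_sum poly1_mult)
    fix l assume l: "l \<in> {1..n}"
    show "poly1 (\<lambda>\<tau>. mmult n (elm n a b (c \<tau>)) x i l)"
      unfolding mmult_in[OF ij(1) l] elm_def by (intro poly1_sum poly1_mult poly1_add poly1_const c)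
    show "poly1 (\<lambda>\<tau>. elm n a b (- c \<tau>) l j)"
      unfolding elm_def by (intro poly1_mult poly1_add poly1_const poly1_uminus c)
  qed
qed

lemma elm_0: "elm n a b 0 = idm n"
  by (simp add: elm_def)

text \<open>A decomposition of a lower elementary matrix of \<open>SL\<^sub>2\<close> adapted to the big cell.\<close>
lemma lower_elm_decomp:
  fixes \<tau> :: "'k::field"
  assumes ab: "1 \<le> a" "a < b" "b \<le> n" and \<tau>: "\<tau> \<noteq> 0"
  shows "elm n b a \<tau> = mmult n (elm n a b (inverse \<tau>)) (mmult n (dg1 n a (inverse \<tau>)) (mmult n (dg1 n b \<tau>)
     (mmult n (elm n a b (-1)) (mmult n (elm n b a 1) (elm n a b (inverse \<tau> - 1))))))"
proof (intro ext)
  fix i j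
  have r: "a \<in> {1..n}" "b \<in> {1..n}" "a \<noteq> b" "b \<noteq> a" using ab by auto
  have e: "elm n c d \<sigma> i j = mmult n (elm n c d \<sigma>) (idm n) i j" if "c \<in> {1..n}" "d \<in> {1..n}" for c d and \<sigma> :: 'k and i j
    using that by (simp add: mmult_idm)
  have d: "mmult n (dg1 n c \<sigma>) X i j = (if i \<in> {1..n} \<and> j \<in> {1..n} then (if i = c then \<sigma> else 1) * X i j else 0)"
    for c and \<sigma> :: 'k and X i j by (simp add: dg1_def dgm_mmult)
  have e': "mmult n (elm n c d \<sigma>) X i j = (if i \<in> {1..n} \<and> j \<in> {1..n} then X i j + (if i = c then \<sigma> * X d j else 0) else 0)"
    if "c \<in> {1..n}" "d \<in> {1..n}" for c d and \<sigma> :: 'k and X i j using that by (simp add: elm_mmult)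
  have e1: "elm n c d \<sigma> i j = (if i \<in> {1..n} \<and> j \<in> {1..n} then idm n i j + (if i = c then \<sigma> * idm n d j else 0) else 0)"
    if "c \<in> {1..n}" "d \<in> {1..n}" for c d and \<sigma> :: 'k and i j using that by (simp only: e e')
  show "elm n b a \<tau> i j = mmult n (elm n a b (inverse \<tau>)) (mmult n (dg1 n a (inverse \<tau>)) (mmult n (dg1 n b \<tau>)
     (mmult n (elm n a b (-1)) (mmult n (elm n b a 1) (elm n a b (inverse \<tau> - 1)))))) i j"
    unfolding e1[OF r(2,1)] e'[OF r(1,2)] e'[OF r(2,1)] d e1[OF r(1,2)]
    using r \<tau> by (cases "i = a"; cases "i = b") (auto simp: field_simps)
qed

text \<open>\<open>P\<close> and \<open>Q\<close> are the two charts of a section of degree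
  \<open>lam a - lam b\<close> on the projective line. The upper and diagonal factors on the left of
  the decomposition are absorbed by semi-invariance, and the rightmost factor depends polynomially
  on \<open>inverse \<tau>\<close>.\<close>

lemma semi_lower_reciprocal:
  fixes f :: "'k::alg_closed_field gl \<Rightarrow> 'k"
  assumes f: "semi n lam f" and ab: "1 \<le> a" "a < b" "b \<le> n"
  obtains P Q where "\<And>\<tau>. poly P \<tau> = f (conjg n (elm n b a \<tau>) x)"
    "\<And>\<sigma>. poly Q \<sigma> = f (conjg n (elm n b a 1) (conjg n (elm n a b (\<sigma> - 1)) x))"
    "\<And>\<tau>. \<tau> \<noteq> 0 \<Longrightarrow> poly P \<tau> = power_int \<tau> (lam a - lam b) * poly Q (inverse \<tau>)"
proof -
  have r: "a \<in> {1..n}" "b \<in> {1..n}" "a \<noteq> b" "b \<noteq> a" using ab by auto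
  obtain P where P: "\<And>\<tau>. poly P \<tau> = f (conjg n (elm n b a \<tau>) x)"
    using poly1_conj_elm[OF semiD(1)[OF f] poly1_id r(2,1,4), of x] unfolding poly1_def by blast
  have "poly1 (\<lambda>\<sigma>::'k. \<sigma> - 1)" by (intro poly1_intros)
  from poly1_conj_elm[OF polyfun_conj[OF semiD(1)[OF f]] this r(1-3), of "elm n b a 1" x]
  obtain Q where Q: "\<And>\<sigma>. poly Q \<sigma> = f (conjg n (elm n b a 1) (conjg n (elm n a b (\<sigma> - 1)) x))"
    unfolding poly1_def by blast
  have "poly P \<tau> = power_int \<tau> (lam a - lam b) * poly Q (inverse \<tau>)" if \<tau>: "\<tau> \<noteq> 0" for \<tau>
  proof -
    have GU: "elm n a b \<sigma> \<in> GL n" "elm n b a \<sigma> \<in> GL n" for \<sigma> :: 'k using r by (auto intro: elm_GL)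
    have GD: "dg1 n c \<tau> \<in> GL n" "dg1 n c (inverse \<tau>) \<in> GL n" for c using \<tau> by (auto intro: dg1_GL)
    let ?y = "conjg n (elm n b a 1) (conjg n (elm n a b (inverse \<tau> - 1)) x)"
    have "conjg n (elm n b a \<tau>) x = conjg n (elm n a b (inverse \<tau>)) (conjg n (dg1 n a (inverse \<tau>))
      (conjg n (dg1 n b \<tau>) (conjg n (elm n a b (-1)) ?y)))"
      by (subst lower_elm_decomp[OF ab \<tau>]) (simp add: conj_mmult GL_mmult GU GD)
    then have "f (conjg n (elm n b a \<tau>) x) = power_int (inverse \<tau>) (- lam a) * (power_int \<tau> (- lam b) * f ?y)"
      using ab \<tau> by (simp add: semiD(2)[OF f ab] semiD(3)[OF f])
    also have "\<dots> = power_int \<tau> (lam a - lam b) * f ?y"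
      using \<tau> by (simp add: power_int_diff power_int_minus power_int_inverse field_simps)
    finally show ?thesis by (simp only: P Q)
  qed
  with P Q show ?thesis by (rule that)
qed

text \<open>A line bundle of negative degree on the projective line has only the zero
  section.\<close>

lemma semi_dominant:
  fixes f :: "'k::alg_closed_field gl \<Rightarrow> 'k"
  assumes f: "semi n lam f" and ab: "1 \<le> a" "a < b" "b \<le> n" and nz: "f \<noteq> (\<lambda>x. 0)"
  shows "lam b \<le> lam a"
proof (rule ccontr)
  assume neg: "\<not> ?thesis"
  have "f x = 0" for x
  proof -
    obtain P Q where P: "\<And>\<tau>. poly P \<tau> = f (conjg n (elm n b a \<tau>) x)"
      and PQ: "\<And>\<tau>. \<tau> \<noteq> 0 \<Longrightarrow> poly P \<tau> = power_int \<tau> (lam a - lam b) * poly Q (inverse \<tau>)"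
      using semi_lower_reciprocal[OF f ab, of x] by metis
    have "P = 0" by (rule poly_reciprocal(1)[OF PQ]) (use neg in auto)
    then show ?thesis
      using P[of 0] polyfun_trunc[OF semiD(1)[OF f], of x] by (simp add: elm_0 conj_idm)
  qed
  then show False using nz by auto
qed

text \<open>Sections of degree 0 on the projective line are constant.\<close>

lemma semi_lower_invariant:
  fixes f :: "'k::alg_closed_field gl \<Rightarrow> 'k"
  assumes f: "semi n lam f" and ab: "1 \<le> a" "a < b" "b \<le> n" and lam: "lam a = lam b"
  shows "f (conjg n (elm n b a \<tau>) x) = f x"
proof -
  obtain P Q where P: "\<And>\<tau>. poly P \<tau> = f (conjg n (elm n b a \<tau>) x)"
    and PQ: "\<And>\<tau>. \<tau> \<noteq> 0 \<Longrightarrow> poly P \<tau> = power_int \<tau> (lam a - lam b) * poly Q (inverse \<tau>)"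
    using semi_lower_reciprocal[OF f ab, of x] by metis
  have "P = [:poly Q 0:]" by (rule poly_reciprocal(2)[OF PQ]) (use lam in auto)
  then have "poly P \<tau> = poly P 0" by simp
  then show ?thesis
    using P polyfun_trunc[OF semiD(1)[OF f], of x] by (simp add: elm_0 conj_idm)
qed

text \<open>Sections of degree 1 are affine in the chart, and the slope is the value at the point at
  infinity, reached by the transposition.\<close>

lemma semi_lower_linear:
  fixes f :: "'k::alg_closed_field gl \<Rightarrow> 'k"
  assumes f: "semi n lam f" and ab: "1 \<le> a" "a < b" "b \<le> n" and lam: "lam a = 0" "lam b = -1"
  shows "f (conjg n (elm n b a \<tau>) x) = f x + \<tau> * f (conjg n (pm n (Transposition.transpose a b)) x)"
proof -
  have r: "a \<in> {1..n}" "b \<in> {1..n}" "a \<noteq> b" "b \<noteq> a" using ab by auto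
  obtain P Q where P: "\<And>\<tau>. poly P \<tau> = f (conjg n (elm n b a \<tau>) x)"
    and Q: "\<And>\<sigma>. poly Q \<sigma> = f (conjg n (elm n b a 1) (conjg n (elm n a b (\<sigma> - 1)) x))"
    and PQ: "\<And>\<tau>. \<tau> \<noteq> 0 \<Longrightarrow> poly P \<tau> = power_int \<tau> (lam a - lam b) * poly Q (inverse \<tau>)"
    using semi_lower_reciprocal[OF f ab, of x] by metis
  have e: "P = [:poly P 0, poly Q 0:]" by (rule poly_reciprocal(3)[OF PQ]) (use lam in auto)
  have "poly P \<tau> = poly P 0 + \<tau> * poly Q 0" by (subst e) simp
  moreover have "poly P 0 = f x"
    using P polyfun_trunc[OF semiD(1)[OF f], of x] by (simp add: elm_0 conj_idm)
  moreover have "f (conjg n (pm n (Transposition.transpose a b)) x) = poly Q 0"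
  proof -
    have GU: "elm n a b \<sigma> \<in> GL n" "elm n b a \<sigma> \<in> GL n" "dg1 n a (-1::'k) \<in> GL n" for \<sigma> :: 'k
      using r by (auto intro: elm_GL dg1_GL)
    \<comment> \<open>The sign correction acts trivially because \<open>lam a = 0\<close>; what
      remains is the conjugate that defines \<open>Q\<close> at 0.\<close>
    have "pm n (Transposition.transpose a b) = mmult n (dg1 n a (-1))
       (mmult n (elm n a b (-1)) (mmult n (elm n b a 1) (elm n a b (-1::'k))))"
      using pm_transpose_mmult[OF ab, of "idm n"] r by (simp add: mmult_idm)
    then show ?thesis
      using ab lam by (simp add: conj_mmult GL_mmult GU semiD(3)[OF f] semiD(2)[OF f ab] Q)
  qed
  ultimately show ?thesis by (simp only: P)
qed

text \<open>From index 2 on the weight is 0 up to \<open>n - t\<close> and -1 afterwards, so each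
  pair of indices falls under degree 0 or degree 1. The drop after index 1 may be larger, which is
  why lower elementary matrices with source row 1 do not occur in \<open>row_semi\<close>.\<close>

lemma semi_row_semi:
  fixes f :: "'k::alg_closed_field gl \<Rightarrow> 'k"
  assumes f: "semi n (lam_t n t) f" and t: "t < n"
  shows "row_semi n (n - t) (\<lambda>g. f (conjg n g y))"
  unfolding row_semi_def
proof (intro ballI conjI allI impI; (elim conjE)?)
  fix g :: "'k gl" and a b and \<tau> :: 'k assume g: "g \<in> GL n" and ab: "1 \<le> a" "a < b" "b \<le> n"
  then have "elm n a b \<tau> \<in> GL n" by (auto intro: elm_GL)
  then show "f (conjg n (mmult n (elm n a b \<tau>) g) y) = f (conjg n g y)"
    using g by (simp add: conj_mmult semiD(2)[OF f ab])
next
  fix g :: "'k gl" and a and \<tau> :: 'k assume g: "g \<in> GL n" and a: "2 \<le> a" "a \<le> n" "\<tau> \<noteq> 0"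
  have a1: "1 \<le> a" using a by simp
  show "f (conjg n (mmult n (dg1 n a \<tau>) g) y) = (if n - t < a then \<tau> else 1) * f (conjg n g y)"
    using g a by (auto simp: conj_mmult dg1_GL semiD(3)[OF f a1] lam_t_def)
next
  fix g :: "'k gl" and a b and \<tau> :: 'k assume g: "g \<in> GL n" and ab: "2 \<le> a" "a < b" "b \<le> n"
  have ab1: "1 \<le> a" "a < b" "b \<le> n" using ab by auto
  have r: "a \<in> {1..n}" "b \<in> {1..n}" "b \<noteq> a" using ab by auto
  have G: "elm n b a \<tau> \<in> GL n" using r by (auto intro: elm_GL)
  have T: "(pm n (Transposition.transpose a b) :: 'k gl) \<in> GL n"
    using r by (auto intro!: pm_GL permutes_swap_id)
  show "f (conjg n (mmult n (elm n b a \<tau>) g) y) = f (conjg n g y) +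
      (if a \<le> n - t \<and> n - t < b then \<tau> * f (conjg n (mmult n (pm n (Transposition.transpose a b)) g) y) else 0)"
  proof (cases "a \<le> n - t \<and> n - t < b")
    case True
    then have "lam_t n t a = 0" "lam_t n t b = -1" using ab by (auto simp: lam_t_def)
    from semi_lower_linear[OF f ab1 this] show ?thesis
      using True g G T by (simp add: conj_mmult)
  next
    case False
    then have "lam_t n t a = lam_t n t b" using ab by (auto simp: lam_t_def)
    from semi_lower_invariant[OF f ab1 this] show ?thesis
      using False g G by (auto simp: conj_mmult)
  qed
qed

section \<open>The section given by companion matrices\<close>

lemma index_mult_mat_sum:
  assumes "A \<in> carrier_mat n n" "B \<in> carrier_mat n n" "i < n" "j < n"
  shows "(A * B) $$ (i, j) = (\<Sum>l<n. A $$ (i, l) * B $$ (l, j))"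
  using assms by (auto simp: scalar_prod_def lessThan_atLeast0 intro!: sum.cong)

lemma GL_det:
  fixes g :: "'k::field gl"
  assumes "is_mat n g" "det (mat n n (\<lambda>(i, j). g (Suc i) (Suc j))) \<noteq> 0"
  shows "g \<in> GL n"
proof -
  let ?A = "mat n n (\<lambda>(i, j). g (Suc i) (Suc j))"
  have "?A \<in> Units (ring_mat TYPE('k) n undefined)"
    by (rule det_non_zero_imp_unit) (use assms in auto)
  then obtain B where B: "B \<in> carrier_mat n n" "?A * B = 1\<^sub>m n" "B * ?A = 1\<^sub>m n"
    by (auto simp: Units_def ring_mat_def)
  define h where "h i j = (if i \<in> {1..n} \<and> j \<in> {1..n} then B $$ (i - 1, j - 1) else 0)" for i j
  have m: "is_mat n h" by (auto simp: h_def is_mat_def)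
  have 1: "mmult n g h i j = idm n i j" for i j
  proof (cases "i \<in> {1..n} \<and> j \<in> {1..n}")
    case True
    then have ij: "i - 1 < n" "j - 1 < n" "Suc (i - 1) = i" "Suc (j - 1) = j" by auto
    have "mmult n g h i j = (\<Sum>l<n. g i (Suc l) * h (Suc l) j)"
      using True by (simp add: mmult_def sum_1_n)
    also have "\<dots> = (\<Sum>l<n. ?A $$ (i - 1, l) * B $$ (l, j - 1))"
      using ij True by (intro sum.cong refl) (simp add: h_def)
    also have "\<dots> = (?A * B) $$ (i - 1, j - 1)"
      by (rule index_mult_mat_sum[symmetric]) (use ij B in auto)
    also have "\<dots> = idm n i j" using B ij True by (auto simp: idm_def)
    finally show ?thesis .
  qed (auto simp: mmult_def idm_def)
  have 2: "mmult n h g i j = idm n i j" for i j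
  proof (cases "i \<in> {1..n} \<and> j \<in> {1..n}")
    case True
    then have ij: "i - 1 < n" "j - 1 < n" "Suc (i - 1) = i" "Suc (j - 1) = j" by auto
    have "mmult n h g i j = (\<Sum>l<n. h i (Suc l) * g (Suc l) j)"
      using True by (simp add: mmult_def sum_1_n)
    also have "\<dots> = (\<Sum>l<n. B $$ (i - 1, l) * ?A $$ (l, j - 1))"
      using ij True by (intro sum.cong refl) (simp add: h_def)
    also have "\<dots> = (B * ?A) $$ (i - 1, j - 1)"
      by (rule index_mult_mat_sum[symmetric]) (use ij B in auto)
    also have "\<dots> = idm n i j" using B ij True by (auto simp: idm_def)
    finally show ?thesis .
  qed (auto simp: mmult_def idm_def)
  show ?thesis using assms(1) m 1 2 by (intro GL_I[of n g h] ext) auto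
qed

text \<open>Column \<open>j\<close> encodes the recursion: \<open>x\<close> maps column
  \<open>j\<close> of the gradient matrix to \<open>s j\<close> times the first basis vector minus
  column \<open>j + 1\<close>.\<close>

definition companion :: "nat \<Rightarrow> (nat \<Rightarrow> 'k::comm_ring_1) \<Rightarrow> 'k gl" where
  "companion n s = (\<lambda>i j. if i \<in> {1..n} \<and> j \<in> {1..n} then (if i = 1 then s j else if i = Suc j then -1 else 0) else 0)"

text \<open>Nonvanishing means that the first basis vector is cyclic for \<open>x\<close>: by the
  recursion, the columns span the same space as its images under the powers of
  \<open>x\<close>.\<close>

definition gdet :: "nat \<Rightarrow> 'k::alg_closed_field gl \<Rightarrow> 'k" where
  "gdet n x = det (mat n n (\<lambda>(i, j). gradmat n x (Suc i) (Suc j)))"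

lemma polyfun_gdet: "gdet n \<in> polyfun n"
  unfolding gdet_def by (intro polyfun_det polyfun_gradmat) (auto simp: One_nat_def)

lemma gradmat_GL:
  assumes "gdet n x \<noteq> 0"
  shows "trunc n (gradmat n x) \<in> GL n"
proof (rule GL_det)
  have "mat n n (\<lambda>(i, j). trunc n (gradmat n x) (Suc i) (Suc j)) = mat n n (\<lambda>(i, j). gradmat n x (Suc i) (Suc j))"
    by (intro eq_matI) (auto simp: trunc_def One_nat_def)
  then show "det (mat n n (\<lambda>(i, j). trunc n (gradmat n x) (Suc i) (Suc j))) \<noteq> 0"
    using assms by (simp add: gdet_def)
qed simp

lemma conj_companion:
  assumes "gdet n x \<noteq> 0"
  shows "conjg n (trunc n (gradmat n x)) (companion n (\<lambda>j. s_inv n j x)) = trunc n x"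
proof -
  let ?m = "trunc n (gradmat n x)" and ?Y = "companion n (\<lambda>j. s_inv n j x)"
  note G = GL_minv[OF gradmat_GL[OF assms]]
  have "mmult n x ?m = mmult n ?m ?Y"
  proof (intro ext)
    fix i j
    show "mmult n x ?m i j = mmult n ?m ?Y i j"
    proof (cases "i \<in> {1..n} \<and> j \<in> {1..n}")
      case True
      then have ij: "i \<in> {1..n}" "j \<in> {1..n}" "1 \<le> j" by auto
      have "mmult n ?m ?Y i j = (\<Sum>l=1..n. (if l = 1 then gradmat n x i 1 * s_inv n j x else 0)
           + (if l = Suc j then - gradmat n x i (Suc j) else 0))"
        unfolding mmult_in[OF ij(1,2)] using ij
        by (intro sum.cong refl) (auto simp: trunc_def companion_def)
      \<comment> \<open>For \<open>j = n\<close> the second term is absent from the sum, in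
        accordance with the vanishing of column \<open>n + 1\<close>.\<close>
      also have "\<dots> = gradmat n x i 1 * s_inv n j x - gradmat n x i (Suc j)"
        using ij gradmat_Suc_n[OF ij(1), of x] by (auto simp: sum.distrib dest: le_antisym)
      also have "\<dots> = (\<Sum>l=1..n. x i l * gradmat n x l j)"
        using ij by (simp add: gradmat_Suc gradmat_1)
      also have "\<dots> = mmult n x ?m i j"
        unfolding mmult_trunc using ij by (simp add: mmult_def)
      finally show ?thesis by simp
    qed (auto simp: mmult_def)
  qed
  then have "conjg n ?m ?Y = mmult n (mmult n x ?m) (minv n ?m)" by (simp add: conjg_def)
  also have "\<dots> = mmult n x (mmult n ?m (minv n ?m))" by (simp only: mmult_assoc)
  also have "\<dots> = trunc n x" using G by (simp add: mmult_idm_trunc)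
  finally show ?thesis .
qed

text \<open>The witness is the nilpotent matrix with -1 below the diagonal. All its
  \<open>s_inv\<close> of positive index vanish, so the recursion makes the gradient matrix the
  identity.\<close>

lemma gdet_nonzero: "\<exists>z :: 'k::alg_closed_field gl. gdet n z \<noteq> 0"
proof -
  define z :: "'k gl" where "z = companion n (\<lambda>j. 0)"
  have "det (qmat n z) = 1"
  proof -
    have "det (qmat n z) = prod_list (diag_mat (qmat n z))"
      by (rule det_lower_triangular[of n]) (auto simp: qmat_def z_def companion_def)
    also have "\<dots> = 1" unfolding prod_list_diag_prod
      by (intro prod.neutral) (auto simp: qmat_def z_def companion_def one_pCons)
    finally show ?thesis .
  qed
  then have s: "s_inv n j z = 0" if "1 \<le> j" for j
    using that coeff_det_qmat[of n z j] by (simp add: coeff_1)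
  have "gradmat n z i j = (if i = j then 1 else 0)" if "1 \<le> j" "j \<le> n" "i \<in> {1..n}" for i j
    using that
  proof (induction j arbitrary: i rule: dec_induct)
    case base
    then show ?case by (simp add: gradmat_1)
  next
    case (step j)
    have "gradmat n z i (Suc j) = - (\<Sum>l=1..n. z i l * gradmat n z l j)"
      using step s[of j] by (simp add: gradmat_Suc)
    also have "(\<Sum>l=1..n. z i l * gradmat n z l j) = (\<Sum>l=1..n. if l = j then z i l else 0)"
      using step by (intro sum.cong) auto
    also have "\<dots> = z i j" using step by simp
    finally show ?case using step by (auto simp: z_def companion_def)
  qed
  then have "mat n n (\<lambda>(i, j). gradmat n z (Suc i) (Suc j)) = 1\<^sub>m n"
    by (intro eq_matI) (auto simp: One_nat_def)
  then show ?thesis by (intro exI[of _ z]) (simp add: gdet_def)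
qed

section \<open>The module basis\<close>

lemma u_tI_eq_mnr: "u_tI n t I x = mnr (n - t) t I (gradmat n x)"
  by (simp add: u_tI_def mnr_def gradmat_def Let_def)

lemma polyfun_u_tI:
  assumes I: "I \<in> index_sets n t" and t: "t < n"
  shows "(u_tI n t I :: 'k::alg_closed_field gl \<Rightarrow> 'k) \<in> polyfun n"
proof -
  have "(\<lambda>x :: 'k gl. mnr (n - t) t I (gradmat n x)) \<in> polyfun n"
    unfolding mnr_def
    by (intro polyfun_det polyfun_gradmat) (use index_sets_nth[OF I] t in auto)
  then show ?thesis by (simp add: u_tI_eq_mnr[abs_def])
qed

text \<open>The companion matrix sees \<open>x\<close> only through the conjugation-invariant
  \<open>s_inv\<close>. All coefficients of the expansions below arise in this way.\<close>

lemma invariants_companion: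
  fixes f :: "'k::alg_closed_field gl \<Rightarrow> 'k"
  assumes f: "f \<in> polyfun n"
  shows "(\<lambda>x. f (conjg n h (companion n (\<lambda>j. s_inv n j x)))) \<in> invariants n"
proof -
  have "(\<lambda>x. f (conjg n h (companion n (\<lambda>j. s_inv n j x)))) \<in> polyfun n"
  proof (rule polyfun_compose[OF polyfun_conj[OF f]])
    fix i j assume "i \<in> {1..n}" "j \<in> {1..n}"
    then show "(\<lambda>x. companion n (\<lambda>j. s_inv n j x) i j) \<in> polyfun n"
      by (cases "i = 1"; cases "i = Suc j") (simp_all add: companion_def polyfun_s_inv polyfun.const)
  qed
  then show ?thesis
    by (auto simp: invariants_def act_eq_conj s_inv_conj GL_minv(5))
qed

text \<open>Where \<open>gdet\<close> is nonzero, the gradient matrix is invertible with the first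
  basis vector as first column, so the row expansion applies to it; density extends the identity to
  all matrices.\<close>

lemma semi_expand:
  fixes f :: "'k::alg_closed_field gl \<Rightarrow> 'k"
  assumes f: "semi n (lam_t n t) f" and t: "t < n"
  shows "f = (\<lambda>x. \<Sum>J\<in>index_sets n t.
     f (conjg n (pm n (sperm n (n - t) t J)) (companion n (\<lambda>j. s_inv n j x))) * u_tI n t J x)" (is "f = ?R")
proof -
  obtain z :: "'k gl" where z: "gdet n z \<noteq> 0" using gdet_nonzero by blast
  show ?thesis
  proof (rule polyfun_dense[OF semiD(1)[OF f] _ polyfun_gdet z])
    show "?R \<in> polyfun n"
      using invariants_companion[OF semiD(1)[OF f]] polyfun_u_tI[OF _ t]
      by (intro polyfun_sum polyfun.mult) (auto simp: invariants_def)
    fix x :: "'k gl" assume x: "gdet n x \<noteq> 0"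
    let ?m = "trunc n (gradmat n x)" and ?Y = "companion n (\<lambda>j. s_inv n j x)"
    have m1: "?m i 1 = (if i = 1 then 1 else 0)" if "i \<in> {1..n}" for i
      using that gradmat_1[OF that, of x] by (auto simp: trunc_def)
    have u: "mnr (n - t) t J ?m = u_tI n t J x" if "J \<in> index_sets n t" for J
      unfolding u_tI_eq_mnr mnr_def
      by (intro arg_cong[where f = det] eq_matI) (use index_sets_nth[OF that] t in \<open>auto simp: trunc_def\<close>)
    have "f x = f (conjg n ?m ?Y)"
      using polyfun_trunc[OF semiD(1)[OF f], of x] by (simp add: conj_companion[OF x])
    also have "\<dots> = (\<Sum>J\<in>index_sets n t. f (conjg n (pm n (sperm n (n - t) t J)) ?Y) * mnr (n - t) t J ?m)"
      by (rule row_semi_expand[OF semi_row_semi[OF f t] _ _ gradmat_GL[OF x] m1]) (use t in auto)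
    also have "\<dots> = ?R x" by (intro sum.cong refl) (simp add: u)
    finally show "f x = ?R x" .
  qed
qed

text \<open>Conjugating a generic \<open>x\<close> by the permutation matrix of \<open>J\<close>
  times the inverse gradient matrix turns the gradient matrix into that permutation matrix. There
  only the minor of \<open>J\<close> survives, while the invariant coefficients keep their
  values.\<close>

lemma u_tI_independent:
  fixes c :: "nat set \<Rightarrow> 'k::alg_closed_field gl \<Rightarrow> 'k"
  assumes c: "\<And>I. I \<in> index_sets n t \<Longrightarrow> c I \<in> invariants n" and t: "t < n"
    and 0: "(\<lambda>x. \<Sum>I\<in>index_sets n t. c I x * u_tI n t I x) = (\<lambda>x. 0)"
    and J: "J \<in> index_sets n t"
  shows "c J = (\<lambda>x. 0)"
proof -
  have nt: "n = (n - t) + t" "1 \<le> n - t" using t by auto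
  obtain z :: "'k gl" where z: "gdet n z \<noteq> 0" using gdet_nonzero by blast
  have cJ: "c J \<in> polyfun n" using c[OF J] by (simp add: invariants_def)
  show ?thesis
  proof (rule polyfun_dense[OF cJ polyfun.const polyfun_gdet z])
    fix x :: "'k gl" assume x: "gdet n x \<noteq> 0"
    let ?m = "trunc n (gradmat n x)" and ?p = "pm n (sperm n (n - t) t J) :: 'k gl"
    note s = sperm[OF J nt]
    note G = GL_minv[OF gradmat_GL[OF x]]
    let ?h = "minv n ?m"
    let ?g = "mmult n ?p ?h"
    have gG: "?g \<in> GL n" using G s(2) by (intro GL_mmult pm_GL) auto
    have m1: "?m i 1 = (if i = 1 then 1 else 0)" if "i \<in> {1..n}" for i
      using that gradmat_1[OF that, of x] by (auto simp: trunc_def)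
    have h1: "?h i 1 = (if i = 1 then 1 else 0)" if "i \<in> {1..n}" for i
    proof -
      have n1: "1 \<in> {1..n}" using that by auto
      have "idm n i 1 = mmult n ?h ?m i 1" using G by simp
      also have "\<dots> = (\<Sum>l=1..n. ?h i l * (if l = 1 then 1 else 0))"
        unfolding mmult_in[OF that n1] by (intro sum.cong refl) (simp only: m1)
      also have "\<dots> = ?h i 1" using n1 by (simp add: if_distrib cong: if_cong)
      finally show ?thesis using that by (simp add: idm_def)
    qed
    have g1: "?g i 1 = (if i = 1 then 1 else 0)" if "i \<in> {1..n}" for i
    proof -
      have n1: "1 \<in> {1..n}" using that by auto
      have "?g i 1 = (\<Sum>l=1..n. ?p i l * (if l = 1 then 1 else 0))"
        unfolding mmult_in[OF that n1] by (intro sum.cong refl) (simp only: h1)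
      also have "\<dots> = ?p i 1" using n1 by (simp add: if_distrib cong: if_cong)
      finally show ?thesis using that n1 s(5) by (simp add: pm_def)
    qed
    have gm: "gradmat n (conjg n ?g x) i j = ?p i j" if "i \<in> {1..n}" "j \<in> {1..n}" for i j
    proof -
      have "?g 1 1 * gradmat n (conjg n ?g x) i j = mmult n ?g (gradmat n x) i j"
        by (rule gradmat_conj[OF gG]) (use that g1 in auto)
      then have "gradmat n (conjg n ?g x) i j = mmult n ?g ?m i j"
        using that g1[of 1] by (simp only: mmult_trunc) auto
      also have "mmult n ?g ?m = ?p" using G by (simp add: mmult_assoc mmult_idm del: mmult_trunc)
      finally show ?thesis .
    qed
    have u: "u_tI n t I (conjg n ?g x) = (if I = J then 1 else 0)" if "I \<in> index_sets n t" for I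
    proof -
      have "u_tI n t I (conjg n ?g x) = mnr (n - t) t I ?p"
        unfolding u_tI_eq_mnr mnr_def
        by (intro arg_cong[where f = det] cong_mat refl, unfold prod.case, rule gm)
          (use index_sets_nth[OF that] t in auto)
      then show ?thesis using mnr_sperm[OF that J nt] by simp
    qed
    have "0 = (\<Sum>I\<in>index_sets n t. c I (conjg n ?g x) * u_tI n t I (conjg n ?g x))"
      using fun_cong[OF 0, of "conjg n ?g x"] by simp
    also have "\<dots> = (\<Sum>I\<in>index_sets n t. if I = J then c I (conjg n ?g x) else 0)"
      by (intro sum.cong refl) (simp add: u)
    also have "\<dots> = c J (conjg n ?g x)" using J by simp
    also have "\<dots> = act n (minv n ?g) (c J) x"
      using GL_minv[OF gG] by (simp add: act_eq_conj)
    also have "\<dots> = c J x" using c[OF J] GL_minv(5)[OF gG] by (simp add: invariants_def)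
    finally show "c J x = 0" by simp
  qed
qed

text \<open>\<open>act\<close> conjugates by the inverse; hence the parameters
  \<open>- \<tau>\<close> and \<open>inverse \<tau>\<close>, and the exponent \<open>- lam a\<close>
  in \<open>semi\<close>.\<close>

lemma Uinv_weight_semi:
  fixes f :: "'k::alg_closed_field gl \<Rightarrow> 'k"
  assumes f: "f \<in> Uinv_weight n lam"
  shows "semi n lam f"
  unfolding semi_def
proof (intro conjI allI impI; (elim conjE)?)
  show "f \<in> polyfun n" using f by (simp add: Uinv_weight_def)
next
  fix a b and \<tau> :: 'k and x assume ab: "1 \<le> a" "a < b" "b \<le> n"
  then have r: "a \<in> {1..n}" "b \<in> {1..n}" "a \<noteq> b" by auto
  have "elm n a b (- \<tau>) \<in> Unip n"
    using elm_GL[OF r, of "- \<tau>"] ab by (auto simp: Unip_def Borel_def elm_def idm_def elem_def)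
  then have "act n (elm n a b (- \<tau>)) f = f" using f by (simp add: Uinv_weight_def)
  from fun_cong[OF this, of x] show "f (conjg n (elm n a b \<tau>) x) = f x"
    by (simp add: act_eq_conj elm_GL[OF r])
next
  fix a and \<tau> :: 'k and x assume a: "a \<in> {1..n}" and \<tau>: "\<tau> \<noteq> 0"
  have i: "inverse \<tau> \<noteq> 0" using \<tau> by simp
  have "dg1 n a (inverse \<tau>) \<in> Torus n"
    using dg1_GL[OF i, of n a] by (auto simp: Torus_def dg1_def dgm_def)
  then have "act n (dg1 n a (inverse \<tau>)) f = (\<lambda>x. character n lam (dg1 n a (inverse \<tau>)) * f x)"
    using f by (simp add: Uinv_weight_def)
  from fun_cong[OF this, of x]
  have "f (conjg n (dg1 n a \<tau>) x) = character n lam (dg1 n a (inverse \<tau>)) * f x"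
    using dg1_GL[OF i, of n a] by (simp add: act_eq_conj)
  moreover have "character n lam (dg1 n a (inverse \<tau>)) = (\<Prod>i=1..n. if i = a then power_int (inverse \<tau>) (lam a) else 1)"
    unfolding character_def by (intro prod.cong) (auto simp: dg1_def dgm_def)
  moreover have "\<dots> = power_int \<tau> (- lam a)"
    using a by (simp add: power_int_minus power_int_inverse)
  ultimately show "f (conjg n (dg1 n a \<tau>) x) = power_int \<tau> (- lam a) * f x" by simp
qed

section \<open>Behaviour of the minors under the Borel group\<close>

lemma Borel_diag_nonzero:
  fixes b :: "'k::field gl"
  assumes b: "b \<in> Borel n" and i: "i \<in> {1..n}"
  shows "b i i \<noteq> 0"
proof -
  let ?e = "\<lambda>g. mat n n (\<lambda>(i, j). g (Suc i) (Suc j)) :: 'k mat"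
  have bG: "b \<in> GL n" using b by (simp add: Borel_def)
  have "?e b * ?e (minv n b) = 1\<^sub>m n"
  proof (intro eq_matI)
    fix i j assume ij: "i < dim_row (1\<^sub>m n :: 'k mat)" "j < dim_col (1\<^sub>m n :: 'k mat)"
    then have r: "Suc i \<in> {1..n}" "Suc j \<in> {1..n}" by auto
    have "(?e b * ?e (minv n b)) $$ (i, j) = (\<Sum>l<n. ?e b $$ (i, l) * ?e (minv n b) $$ (l, j))"
      by (rule index_mult_mat_sum) (use ij in auto)
    also have "\<dots> = mmult n b (minv n b) (Suc i) (Suc j)"
      unfolding mmult_in[OF r] sum_1_n using ij by (intro sum.cong) auto
    also have "\<dots> = 1\<^sub>m n $$ (i, j)" using GL_minv(3)[OF bG] ij by (auto simp: idm_def One_nat_def)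
    finally show "(?e b * ?e (minv n b)) $$ (i, j) = 1\<^sub>m n $$ (i, j)" .
  qed auto
  then have "det (?e b) * det (?e (minv n b)) = 1" by (metis det_mult det_one mat_carrier)
  then have "det (?e b) \<noteq> 0" by auto
  moreover have "det (?e b) = prod_list (diag_mat (?e b))"
    by (rule det_upper_triangular[of _ n]) (use b in \<open>auto simp: Borel_def upper_triangular_def\<close>)
  ultimately have "0 \<notin> set (diag_mat (?e b))" by (simp add: prod_list_zero_iff)
  moreover have "b i i = diag_mat (?e b) ! (i - 1)" "i - 1 < length (diag_mat (?e b))"
    using i by (auto simp: diag_mat_def One_nat_def)
  ultimately show ?thesis by (metis nth_mem)
qed

text \<open>The last rows of an upper triangular matrix vanish in the first \<open>m\<close>
  columns, so the last rows of \<open>b g\<close> are the lower right block of \<open>b\<close>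
  times the last rows of \<open>g\<close>; this block is triangular.\<close>

lemma mnr_Borel:
  fixes g :: "'k::field gl"
  assumes b: "b \<in> Borel n" and J: "J \<in> index_sets n t" and n: "n = m + t"
  shows "mnr m t J (mmult n b g) = (\<Prod>i=m+1..n. b i i) * mnr m t J g"
proof -
  define l where "l = sorted_list_of_set J"
  have l: "l ! c \<in> {1..n}" if "c < t" for c using index_sets_nth[OF J that] by (simp add: l_def)
  let ?A = "mat t t (\<lambda>(a, c). g (m + 1 + a) (l ! c))"
  let ?B = "mat t t (\<lambda>(a, c). b (m + 1 + a) (m + 1 + c))"
  let ?C = "mat t t (\<lambda>(a, c). mmult n b g (m + 1 + a) (l ! c))"
  have "?C = ?B * ?A"
  proof (intro eq_matI)
    fix a c assume "a < dim_row (?B * ?A)" "c < dim_col (?B * ?A)"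
    then have ac: "a < t" "c < t" by auto
    then have r: "m + 1 + a \<in> {1..n}" using n by auto
    have "mmult n b g (m + 1 + a) (l ! c) = (\<Sum>k=1..n. b (m + 1 + a) k * g k (l ! c))"
      by (rule mmult_in[OF r l[OF ac(2)]])
    also have "\<dots> = (\<Sum>k\<in>{m+1..n}. b (m + 1 + a) k * g k (l ! c))"
      using b by (intro sum.mono_neutral_right) (auto simp: Borel_def)
    also have "\<dots> = (\<Sum>k<t. b (m + 1 + a) (m + 1 + k) * g (m + 1 + k) (l ! c))"
      by (rule sum.reindex_bij_witness[of _ "\<lambda>k. m + 1 + k" "\<lambda>k. k - m - 1"]) (use n in auto)
    also have "\<dots> = (\<Sum>k<t. ?B $$ (a, k) * ?A $$ (k, c))" using ac by (intro sum.cong) auto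
    also have "\<dots> = (?B * ?A) $$ (a, c)" by (rule index_mult_mat_sum[symmetric]) (use ac in auto)
    finally show "?C $$ (a, c) = (?B * ?A) $$ (a, c)" using ac by simp
  qed auto
  then have "det ?C = det ?B * det ?A" by (metis det_mult mat_carrier)
  moreover have "det ?B = (\<Prod>i=m+1..n. b i i)"
  proof -
    have "det ?B = prod_list (diag_mat ?B)"
      by (rule det_upper_triangular[of _ t]) (use b in \<open>auto simp: Borel_def upper_triangular_def\<close>)
    also have "\<dots> = (\<Prod>a=0..<t. b (m + 1 + a) (m + 1 + a))" by (simp add: prod_list_diag_prod)
    also have "\<dots> = (\<Prod>i=m+1..n. b i i)"
      by (rule prod.reindex_bij_witness[of _ "\<lambda>k. k - m - 1" "\<lambda>k. m + 1 + k"]) (use n in auto)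
    finally show ?thesis .
  qed
  ultimately show ?thesis by (simp add: mnr_def l_def)
qed

lemma mnr_cong:
  assumes "J \<in> index_sets n t" "n = m + t"
    and "\<And>i j. i \<in> {1..n} \<Longrightarrow> j \<in> {1..n} \<Longrightarrow> g i j = h i j"
  shows "mnr m t J g = mnr m t J h"
  unfolding mnr_def
  by (intro arg_cong[where f = det] cong_mat refl, unfold prod.case, rule assms(3))
     (use index_sets_nth[OF assms(1)] assms(2) in auto)

lemma mnr_cmult: "mnr m t J (\<lambda>i j. c * g i j) = c ^ t * mnr m t J g"
proof -
  have "mat t t (\<lambda>(a, b). c * g (m + 1 + a) (sorted_list_of_set J ! b)) =
     c \<cdot>\<^sub>m mat t t (\<lambda>(a, b). g (m + 1 + a) (sorted_list_of_set J ! b))"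
    by (intro eq_matI) auto
  then show ?thesis by (simp add: mnr_def)
qed

lemma character_lam_t:
  fixes b :: "'k::field gl"
  assumes t: "t < n"
  shows "character n (lam_t n t) b = b 1 1 ^ t * inverse (\<Prod>i=n-t+1..n. b i i)"
proof -
  have "character n (lam_t n t) b = (\<Prod>i=1..n. (if i = 1 then b 1 1 ^ t else 1) * (if n - t + 1 \<le> i then inverse (b i i) else 1))"
    unfolding character_def using t
    by (intro prod.cong refl) (auto simp: lam_t_def power_int_minus)
  also have "\<dots> = b 1 1 ^ t * (\<Prod>i=1..n. if n - t + 1 \<le> i then inverse (b i i) else 1)"
    using t by (simp add: prod.distrib)
  also have "(\<Prod>i=1..n. if n - t + 1 \<le> i then inverse (b i i) else 1) = (\<Prod>i\<in>{i\<in>{1..n}. n - t + 1 \<le> i}. inverse (b i i))"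
    by (rule prod.inter_filter[symmetric]) simp
  also have "{i\<in>{1..n}. n - t + 1 \<le> i} = {n-t+1..n}" by auto
  finally show ?thesis by (simp add: prod_inversef[unfolded o_def])
qed

text \<open>Equivariance of the gradient matrix scales each of the \<open>t\<close> columns by
  \<open>b 1 1\<close>, and left multiplication by \<open>b\<close> scales the minor by the last
  \<open>t\<close> diagonal entries; the quotient is the character.\<close>

lemma u_tI_B_semi_invariant:
  assumes I: "I \<in> index_sets n t" and t: "t < n"
  shows "B_semi_invariant n (lam_t n t) (u_tI n t I :: 'k::alg_closed_field gl \<Rightarrow> 'k)"
  unfolding B_semi_invariant_def
proof (intro ballI ext)
  fix b :: "'k gl" and x assume b: "b \<in> Borel n"
  have bG: "b \<in> GL n" using b by (simp add: Borel_def)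
  have nt: "n = (n - t) + t" using t by simp
  define y where "y = conjg n (minv n b) x"
  have z: "conjg n b y = trunc n x" using conj_minv_conj[OF bG] by (simp add: y_def)
  have g: "b 1 1 * gradmat n (trunc n x) i j = mmult n b (gradmat n y) i j"
    if "i \<in> {1..n}" "j \<in> {1..n}" for i j
    using gradmat_conj[OF bG _ that(1), of j y] b that by (auto simp: z Borel_def)
  have "b 1 1 ^ t * mnr (n - t) t I (gradmat n (trunc n x)) = mnr (n - t) t I (\<lambda>i j. b 1 1 * gradmat n (trunc n x) i j)"
    by (rule mnr_cmult[symmetric])
  also have "\<dots> = mnr (n - t) t I (mmult n b (gradmat n y))"
    by (rule mnr_cong[OF I nt]) (rule g)
  also have "\<dots> = (\<Prod>i=n-t+1..n. b i i) * mnr (n - t) t I (gradmat n y)"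
    by (rule mnr_Borel[OF b I nt])
  finally have "b 1 1 ^ t * u_tI n t I x = (\<Prod>i=n-t+1..n. b i i) * u_tI n t I y"
    using polyfun_trunc[OF polyfun_u_tI[OF I t], of x] by (simp add: u_tI_eq_mnr)
  moreover have "(\<Prod>i=n-t+1..n. b i i) \<noteq> 0"
    using Borel_diag_nonzero[OF b] by (auto simp: prod_zero_iff)
  ultimately have "u_tI n t I y = character n (lam_t n t) b * u_tI n t I x"
    by (simp add: character_lam_t[OF t] field_simps)
  then show "act n b (u_tI n t I) x = character n (lam_t n t) b * u_tI n t I x"
    by (simp add: act_eq_conj[OF bG] y_def)
qed

lemma B_semi_invariant_Uinv_weight:
  assumes f: "f \<in> polyfun n" and B: "B_semi_invariant n lam f"
  shows "f \<in> Uinv_weight n lam"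
proof -
  have "act n u f = f" if "u \<in> Unip n" for u
  proof -
    have "character n lam u = 1" using that by (auto simp: character_def Unip_def intro!: prod.neutral)
    then show ?thesis using B that by (auto simp: B_semi_invariant_def Unip_def)
  qed
  moreover have "Torus n \<subseteq> Borel n" by (auto simp: Torus_def Borel_def)
  ultimately show ?thesis using f B by (auto simp: Uinv_weight_def B_semi_invariant_def)
qed

lemma B_semi_invariant_sum:
  assumes "\<And>I. I \<in> A \<Longrightarrow> B_semi_invariant n lam (u I)"
  shows "B_semi_invariant n lam (\<lambda>x. \<Sum>I\<in>A. c I * u I x)"
proof -
  have "act n b (\<lambda>x. \<Sum>I\<in>A. c I * u I x) x = character n lam b * (\<Sum>I\<in>A. c I * u I x)" if b: "b \<in> Borel n" for b x
  proof -
    have "act n b (u I) x = character n lam b * u I x" if "I \<in> A" for I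
      using assms[OF that] b by (simp add: B_semi_invariant_def)
    then show ?thesis by (simp add: act_def sum_distrib_left mult_ac)
  qed
  then show ?thesis by (auto simp: B_semi_invariant_def)
qed

lemma u_tI_basis:
  assumes t: "t < n"
  shows "is_module_basis (invariants n) (Uinv_weight n (lam_t n t)) (index_sets n t)
    (u_tI n t :: nat set \<Rightarrow> 'k::alg_closed_field gl \<Rightarrow> 'k)"
  unfolding is_module_basis_def
proof (intro conjI ballI allI impI)
  fix I assume "I \<in> index_sets n t"
  then show "(u_tI n t I :: 'k gl \<Rightarrow> 'k) \<in> Uinv_weight n (lam_t n t)"
    by (intro B_semi_invariant_Uinv_weight polyfun_u_tI u_tI_B_semi_invariant t)
next
  fix f :: "'k gl \<Rightarrow> 'k" assume f: "f \<in> Uinv_weight n (lam_t n t)"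
  note s = Uinv_weight_semi[OF f]
  let ?c = "\<lambda>J x. f (conjg n (pm n (sperm n (n - t) t J)) (companion n (\<lambda>j. s_inv n j x)))"
  show "\<exists>c. (\<forall>I\<in>index_sets n t. c I \<in> invariants n) \<and> f = (\<lambda>x. \<Sum>I\<in>index_sets n t. c I x * u_tI n t I x)"
    using semi_expand[OF s t] invariants_companion[OF semiD(1)[OF s]] by (intro exI[of _ ?c]) auto
next
  fix c :: "nat set \<Rightarrow> 'k gl \<Rightarrow> 'k" and I
  assume "(\<forall>I\<in>index_sets n t. c I \<in> invariants n) \<and> (\<lambda>x. \<Sum>I\<in>index_sets n t. c I x * u_tI n t I x) = (\<lambda>x. 0)"
    and "I \<in> index_sets n t"
  then show "c I = (\<lambda>x. 0)" using u_tI_independent[of n t c I] t by blast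
qed

section \<open>Factors of semi-invariants\<close>

lemma conj_dg1:
  assumes "\<tau> \<noteq> 0" "i \<in> {1..n}" "j \<in> {1..n}"
  shows "conjg n (dg1 n a \<tau>) x i j = (if i = a then \<tau> else 1) * x i j * (if j = a then inverse \<tau> else (1::'k::field))"
  unfolding conjg_def dg1_GL(2)[OF assms(1)] unfolding dg1_def mmult_dgm using assms by (simp add: dgm_mmult)

text \<open>Along a one-parameter torus \<open>f\<close> is a Laurent polynomial in
  \<open>\<tau>\<close>; the power \<open>\<tau> ^ N\<close> clears the poles, and the coefficients
  depend polynomially on \<open>x\<close>.\<close>

lemma polyfun_weight_expansion:
  fixes f :: "'k::field gl \<Rightarrow> 'k"
  assumes "f \<in> polyfun n"
  shows "\<exists>N p. (\<forall>e. (\<lambda>x. coeff (p x) e) \<in> polyfun n) \<and>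
     (\<forall>x \<tau>. \<tau> \<noteq> 0 \<longrightarrow> poly (p x) \<tau> = \<tau> ^ N * f (conjg n (dg1 n a \<tau>) x))"
  using assms
proof (induction rule: polyfun.induct)
  case (const c)
  show ?case
    by (rule exI[of _ 0], rule exI[of _ "\<lambda>x. [:c:]"]) (auto simp: polyfun.const)
next
  case (coord i j)
  have c: "(\<lambda>x. if e = k then x i j else 0) \<in> polyfun n" for k e :: nat
    using polyfun.coord[OF coord] by (cases "e = k") (simp_all add: polyfun.const)
  \<comment> \<open>A coordinate is scaled by \<open>\<tau>\<close>, 1 or
    \<open>inverse \<tau>\<close>; after the shift by \<open>N = 1\<close> the exponents are 2, 1
    and 0.\<close>
  show ?case
    by (rule exI[of _ 1], rule exI[of _ "\<lambda>x. monom (x i j) (if i = a then (if j = a then 1 else 2) else if j = a then 0 else 1)"])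
       (use coord c in \<open>auto simp: conj_dg1 poly_monom power2_eq_square\<close>)
next
  case (add f g)
  then obtain N p M q where p: "\<And>e. (\<lambda>x. coeff (p x) e) \<in> polyfun n"
      "\<And>x \<tau>. \<tau> \<noteq> 0 \<Longrightarrow> poly (p x) \<tau> = \<tau> ^ N * f (conjg n (dg1 n a \<tau>) x)"
    and q: "\<And>e. (\<lambda>x. coeff (q x) e) \<in> polyfun n"
      "\<And>x \<tau>. \<tau> \<noteq> 0 \<Longrightarrow> poly (q x) \<tau> = \<tau> ^ M * g (conjg n (dg1 n a \<tau>) x)" by blast
  have c: "(\<lambda>x. coeff (r x * monom 1 K) e) \<in> polyfun n" if "\<And>e. (\<lambda>x. coeff (r x) e) \<in> polyfun n" for K e and r :: "'k gl \<Rightarrow> 'k poly"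
    using that[of "e - K"] by (cases "e < K") (simp_all add: mult.commute[of _ "monom 1 K"] coeff_monom_mult polyfun.const)
  show ?case
    by (rule exI[of _ "N + M"], rule exI[of _ "\<lambda>x. p x * monom 1 M + q x * monom 1 N"])
       (auto simp: poly_monom p(2) q(2) power_add algebra_simps intro!: polyfun.add c p(1) q(1))
next
  case (mult f g)
  then obtain N p M q where p: "\<And>e. (\<lambda>x. coeff (p x) e) \<in> polyfun n"
      "\<And>x \<tau>. \<tau> \<noteq> 0 \<Longrightarrow> poly (p x) \<tau> = \<tau> ^ N * f (conjg n (dg1 n a \<tau>) x)"
    and q: "\<And>e. (\<lambda>x. coeff (q x) e) \<in> polyfun n"
      "\<And>x \<tau>. \<tau> \<noteq> 0 \<Longrightarrow> poly (q x) \<tau> = \<tau> ^ M * g (conjg n (dg1 n a \<tau>) x)" by blast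
  show ?case
    by (rule exI[of _ "N + M"], rule exI[of _ "\<lambda>x. p x * q x"])
       (auto simp: coeff_mult p(2) q(2) power_add mult_ac intro!: polyfun_sum polyfun.mult p(1) q(1))
qed

text \<open>At a point with \<open>f x \<noteq> 0\<close> the expansions of \<open>g\<close> and
  \<open>h\<close> multiply to a monomial up to a shift, so that of \<open>g\<close> is a monomial.
  Its exponent is the same everywhere since there are no zero divisors.\<close>

lemma factor_torus_weight:
  fixes f g h :: "'k::alg_closed_field gl \<Rightarrow> 'k"
  assumes f: "semi n lam f" "f \<noteq> (\<lambda>x. 0)" and g: "g \<in> polyfun n" and h: "h \<in> polyfun n"
    and fgh: "\<And>x. f x = g x * h x" and a: "a \<in> {1..n}"
  shows "\<exists>w. \<forall>x \<tau>. \<tau> \<noteq> 0 \<longrightarrow> g (conjg n (dg1 n a \<tau>) x) = power_int \<tau> (- w) * g x"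
proof -
  have fp: "f \<in> polyfun n" by (rule semiD[OF f(1)])
  obtain N p where p: "\<And>e. (\<lambda>x. coeff (p x) e) \<in> polyfun n"
      "\<And>x \<tau>. \<tau> \<noteq> 0 \<Longrightarrow> poly (p x) \<tau> = \<tau> ^ N * g (conjg n (dg1 n a \<tau>) x)"
    using polyfun_weight_expansion[OF g, of a] by blast
  obtain M q where q: "\<And>x \<tau>. \<tau> \<noteq> 0 \<Longrightarrow> poly (q x) \<tau> = \<tau> ^ M * h (conjg n (dg1 n a \<tau>) x)"
    using polyfun_weight_expansion[OF h, of a] by blast
  have mono: "\<exists>c e. c \<noteq> 0 \<and> p x = monom c e" if fx: "f x \<noteq> 0" for x
  proof (rule monom_factor)
    \<comment> \<open>The weight may have either sign; a difference of two natural numbers keeps the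
      identity among polynomials.\<close>
    define m where "m = nat (lam a)"
    define m' where "m' = nat (- lam a)"
    have lam: "- lam a = int m' - int m" by (simp add: m_def m'_def)
    show "p x * (q x * monom 1 m) = monom (f x) (N + M + m')"
    proof (rule poly_eqI_nonzero)
      fix \<tau> :: 'k assume \<tau>: "\<tau> \<noteq> 0"
      have "poly (p x * (q x * monom 1 m)) \<tau> = \<tau> ^ N * \<tau> ^ M * (\<tau> ^ m * f (conjg n (dg1 n a \<tau>) x))"
        using \<tau> by (simp add: p(2) q poly_monom fgh)
      also have "f (conjg n (dg1 n a \<tau>) x) = power_int \<tau> (int m' - int m) * f x"
        unfolding lam[symmetric] using a \<tau> by (intro semiD(3)[OF f(1)]) auto
      also have "\<tau> ^ m * (power_int \<tau> (int m' - int m) * f x) = \<tau> ^ m' * f x"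
        using \<tau> by (simp add: power_int_diff)
      finally show "poly (p x * (q x * monom 1 m)) \<tau> = poly (monom (f x) (N + M + m')) \<tau>"
        by (simp add: poly_monom power_add)
    qed
  qed (rule fx)
  obtain x0 where x0: "f x0 \<noteq> 0" using f(2) by auto
  then obtain c0 e where ce: "c0 \<noteq> 0" "p x0 = monom c0 e" using mono by blast
  \<comment> \<open>At a point with \<open>f x \<noteq> 0\<close> only one exponent occurs, so the
    product of this coefficient, the one at \<open>e\<close>, and \<open>f\<close> vanishes
    identically; the last two factors are nonzero at \<open>x0\<close>.\<close>
  have z: "coeff (p x) e' = 0" if "e' \<noteq> e" for e' x
  proof -
    have "coeff (p x) e' * (coeff (p x) e * f x) = 0" for x
      using mono[of x] that by (cases "f x = 0") auto
    from polyfun_mult_eq_0[OF p(1) polyfun.mult[OF p(1) fp] this]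
    have "(\<lambda>x. coeff (p x) e') = (\<lambda>x. 0) \<or> (\<lambda>x. coeff (p x) e * f x) = (\<lambda>x. 0)" .
    moreover have "coeff (p x0) e * f x0 \<noteq> 0" using ce x0 by simp
    ultimately show ?thesis by (metis (mono_tags))
  qed
  have pm: "p x = monom (coeff (p x) e) e" for x
    using z[of _ x] by (intro poly_eqI) auto
  have "g (conjg n (dg1 n a \<tau>) x) = power_int \<tau> (- (int N - int e)) * g x" if \<tau>: "\<tau> \<noteq> 0" for \<tau> x
  proof -
    have 1: "dg1 n a (1::'k) = idm n" by (auto simp: dg1_def dgm_def idm_def fun_eq_iff)
    have "poly (p x) 1 = g x"
      using p(2)[of 1 x] polyfun_trunc[OF g, of x] by (simp add: 1 conj_idm)
    then have "coeff (p x) e = g x" by (subst (asm) pm) (simp add: poly_monom)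
    then have "\<tau> ^ N * g (conjg n (dg1 n a \<tau>) x) = g x * \<tau> ^ e"
      using p(2)[OF \<tau>, of x] pm[of x] by (simp add: poly_monom)
    then show ?thesis using \<tau> by (simp add: power_int_diff field_simps)
  qed
  then show ?thesis by blast
qed

text \<open>Along an additive one-parameter group the product of both factors is the constant
  \<open>f x\<close>. Where it is nonzero, both factors have degree 0; density does the
  rest.\<close>

lemma factor_unipotent:
  fixes f g h :: "'k::alg_closed_field gl \<Rightarrow> 'k"
  assumes f: "semi n lam f" "f \<noteq> (\<lambda>x. 0)" and g: "g \<in> polyfun n" and h: "h \<in> polyfun n"
    and fgh: "\<And>x. f x = g x * h x" and ab: "1 \<le> a" "a < b" "b \<le> n"
  shows "g (conjg n (elm n a b \<tau>) x) = g x"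
proof -
  have fp: "f \<in> polyfun n" by (rule semiD[OF f(1)])
  obtain x0 where x0: "f x0 \<noteq> 0" using f(2) by auto
  have r: "a \<in> {1..n}" "b \<in> {1..n}" "a \<noteq> b" using ab by auto
  have "(\<lambda>x. g (conjg n (elm n a b \<tau>) x)) = g"
  proof (rule polyfun_dense[OF polyfun_conj[OF g] g fp x0])
    fix x assume fx: "f x \<noteq> 0"
    obtain P where P: "\<And>\<tau>. poly P \<tau> = g (conjg n (elm n a b \<tau>) x)"
      using poly1_conj_elm[OF g poly1_id r, of x] unfolding poly1_def by blast
    obtain Q where Q: "\<And>\<tau>. poly Q \<tau> = h (conjg n (elm n a b \<tau>) x)"
      using poly1_conj_elm[OF h poly1_id r, of x] unfolding poly1_def by blast
    have "P * Q = [:f x:]"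
      by (rule poly_eqI_field) (simp add: P Q semiD(2)[OF f(1) ab] flip: fgh)
    then have "degree P + degree Q = 0" "P \<noteq> 0" "Q \<noteq> 0"
      using fx by (metis degree_mult_eq degree_pCons_0 mult_eq_0_iff pCons_eq_0_iff, auto)
    then obtain c where "P = [:c:]" by (metis add_is_0 degree_eq_zeroE)
    then have "poly P \<tau> = poly P 0" by simp
    then show "g (conjg n (elm n a b \<tau>) x) = g x"
      using P polyfun_trunc[OF g, of x] by (simp add: elm_0 conj_idm)
  qed
  then show ?thesis by (rule fun_cong)
qed

lemma factor_semi:
  fixes f g h :: "'k::alg_closed_field gl \<Rightarrow> 'k"
  assumes f: "semi n lam f" "f \<noteq> (\<lambda>x. 0)" and g: "g \<in> polyfun n" and h: "h \<in> polyfun n"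
    and fgh: "\<And>x. f x = g x * h x"
  shows "\<exists>\<alpha>. semi n \<alpha> g"
proof -
  have "\<forall>a\<in>{1..n}. \<exists>w. \<forall>x \<tau>. \<tau> \<noteq> 0 \<longrightarrow> g (conjg n (dg1 n a \<tau>) x) = power_int \<tau> (- w) * g x"
    using factor_torus_weight[OF f g h fgh] by blast
  then obtain \<alpha> where "\<And>a x \<tau>. a \<in> {1..n} \<Longrightarrow> \<tau> \<noteq> 0 \<Longrightarrow>
      g (conjg n (dg1 n a \<tau>) x) = power_int \<tau> (- \<alpha> a) * g x"
    by metis
  then have "semi n \<alpha> g"
    unfolding semi_def using g factor_unipotent[OF f g h fgh] by auto
  then show ?thesis by blast
qed

section \<open>Additivity and coordinate sum of weights\<close>

lemma semi_weight_unique: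
  fixes f :: "'k::alg_closed_field gl \<Rightarrow> 'k"
  assumes "semi n lam f" "f \<noteq> (\<lambda>x. 0)" "semi n \<alpha> g" "semi n \<beta> h" "\<And>x. f x = g x * h x" and a: "a \<in> {1..n}"
  shows "\<alpha> a + \<beta> a = lam a"
proof -
  obtain x0 where x0: "f x0 \<noteq> 0" using assms(2) by auto
  have "power_int \<tau> (- lam a) = power_int \<tau> (- \<alpha> a - \<beta> a)" if \<tau>: "\<tau> \<noteq> 0" for \<tau> :: 'k
  proof -
    have a': "1 \<le> a" "a \<le> n" using a by auto
    have "power_int \<tau> (- lam a) * f x0 = f (conjg n (dg1 n a \<tau>) x0)"
      using semiD(3)[OF assms(1) a' \<tau>] by simp
    also have "\<dots> = power_int \<tau> (- \<alpha> a) * g x0 * (power_int \<tau> (- \<beta> a) * h x0)"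
      unfolding assms(5) using semiD(3)[OF assms(3) a' \<tau>] semiD(3)[OF assms(4) a' \<tau>] by simp
    also have "\<dots> = power_int \<tau> (- \<alpha> a - \<beta> a) * f x0"
      using \<tau> by (simp add: assms(5) power_int_diff power_int_minus field_simps)
    finally show ?thesis using x0 by simp
  qed
  from power_int_inj[OF this] show ?thesis by simp
qed

text \<open>Scalar matrices act trivially by conjugation.\<close>

lemma semi_weight_sum:
  fixes f :: "'k::alg_closed_field gl \<Rightarrow> 'k"
  assumes f: "semi n lam f" "f \<noteq> (\<lambda>x. 0)"
  shows "(\<Sum>a=1..n. lam a) = 0"
proof -
  obtain x0 where x0: "f x0 \<noteq> 0" using f(2) by auto
  have "power_int \<tau> (- (\<Sum>a=1..n. lam a)) = power_int \<tau> 0" if \<tau>: "\<tau> \<noteq> 0" for \<tau> :: 'k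
  proof -
    \<comment> \<open>\<open>semi\<close> speaks of single dilations only, so the scalar matrix is
      assembled one diagonal entry at a time.\<close>
    let ?d = "\<lambda>m. dgm n (\<lambda>i. if i \<le> m then \<tau> else 1)"
    have dG: "?d m \<in> GL n" for m using \<tau> by (intro dgm_GL) auto
    have "f (conjg n (?d m) x0) = power_int \<tau> (- (\<Sum>a=1..m. lam a)) * f x0" if "m \<le> n" for m
      using that
    proof (induction m)
      case 0
      have "?d 0 = idm n" by (auto simp: dgm_def idm_def fun_eq_iff)
      then show ?case using polyfun_trunc[OF semiD(1)[OF f(1)], of x0] by (simp add: conj_idm)
    next
      case (Suc m)
      have "?d (Suc m) = mmult n (dg1 n (Suc m) \<tau>) (?d m)"
        unfolding dg1_def dgm_dgm by (auto simp: dgm_def fun_eq_iff)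
      then have "f (conjg n (?d (Suc m)) x0) = f (conjg n (dg1 n (Suc m) \<tau>) (conjg n (?d m) x0))"
        using \<tau> dG by (simp add: conj_mmult dg1_GL)
      also have "\<dots> = power_int \<tau> (- lam (Suc m)) * f (conjg n (?d m) x0)"
        by (rule semiD(3)[OF f(1)]) (use Suc.prems \<tau> in \<open>auto simp: One_nat_def\<close>)
      also have "\<dots> = power_int \<tau> (- (\<Sum>a=1..Suc m. lam a)) * f x0"
        using Suc \<tau> by (simp add: power_int_diff power_int_minus power_int_add field_simps One_nat_def)
      finally show ?case .
    qed
    from this[of n] have "f (conjg n (?d n) x0) = power_int \<tau> (- (\<Sum>a=1..n. lam a)) * f x0" by simp
    moreover have "conjg n (?d n) x0 = trunc n x0"
      using \<tau> by (auto simp: conjg_def dgm_GL mmult_dgm dgm_mmult trunc_def fun_eq_iff)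
    ultimately show ?thesis using polyfun_trunc[OF semiD(1)[OF f(1)], of x0] x0 by simp
  qed
  from power_int_inj[OF this] show ?thesis by simp
qed

section \<open>Irreducibility\<close>

lemma lam_t_bot: "t < n \<Longrightarrow> i \<in> {n-t+1..n} \<Longrightarrow> lam_t n t i = -1"
  by (auto simp: lam_t_def)

lemma lam_t_mid: "i \<in> {2..n-t} \<Longrightarrow> lam_t n t i = 0"
  by (auto simp: lam_t_def)

text \<open>The sum condition gives \<open>\<alpha> 1 = - (n - 1) d\<close>. Dominance of
  \<open>\<alpha>\<close> yields \<open>d \<le> 0\<close>, and dominance of \<open>\<beta>\<close>
  at the indices 1 and 2 yields \<open>d > -1\<close> or, for \<open>t = n - 1\<close>,
  \<open>d \<ge> -1\<close>. At \<open>d = 0\<close> the weight \<open>\<alpha>\<close> vanishes, at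
  \<open>d = -1\<close> the weight \<open>\<beta>\<close>.\<close>

lemma weight_split_const:
  fixes \<alpha> \<beta> :: "nat \<Rightarrow> int"
  assumes n: "1 \<le> t" "t < n"
    and \<alpha>: "\<And>i j. 1 \<le> i \<Longrightarrow> i < j \<Longrightarrow> j \<le> n \<Longrightarrow> \<alpha> j \<le> \<alpha> i" and \<beta>: "\<And>i j. 1 \<le> i \<Longrightarrow> i < j \<Longrightarrow> j \<le> n \<Longrightarrow> \<beta> j \<le> \<beta> i"
    and sum: "(\<Sum>i=1..n. \<alpha> i) = 0"
    and ab: "\<And>i. i \<in> {1..n} \<Longrightarrow> \<alpha> i + \<beta> i = lam_t n t i"
    and d: "\<And>i. i \<in> {2..n} \<Longrightarrow> \<alpha> i = d"
  shows "(\<forall>i\<in>{1..n}. \<alpha> i = 0) \<or> (\<forall>i\<in>{1..n}. \<beta> i = 0)"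
proof -
  have s1: "{1..n} = insert 1 {2..n}" using n by auto
  have a1: "\<alpha> 1 = - (int n - 1) * d"
  proof -
    have "(\<Sum>i=1..n. \<alpha> i) = \<alpha> 1 + (\<Sum>i=2..n. \<alpha> i)" by (simp add: s1)
    also have "(\<Sum>i=2..n. \<alpha> i) = (\<Sum>i=2..n. d)" by (rule sum.cong) (auto simp: d)
    finally show ?thesis using sum n by (simp add: algebra_simps)
  qed
  have dn: "int n * d \<le> 0" using \<alpha>[of 1 n] n d[of n] a1 by (simp add: algebra_simps)
  have d0: "d \<le> 0" using dn n by (simp add: mult_le_0_iff)
  have b1: "\<beta> 1 = int t + (int n - 1) * d"
    using ab[of 1] a1 n by (simp add: lam_t_def algebra_simps)
  have b2: "\<beta> 2 \<le> \<beta> 1" using \<beta>[of 1 2] n by simp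
  show ?thesis
  proof (cases "2 \<le> n - t")
    case True
    then have "\<beta> 2 = - d" using ab[of 2] d[of 2] lam_t_mid[of 2 n t] n by simp
    then have "- int n < int n * d" using b2 b1 n by (simp add: algebra_simps)
    then have "int n * (-1) < int n * d" by simp
    then have "-1 < d" by (rule mult_less_cancel_left_pos[THEN iffD1, rotated]) (use n in simp)
    then have "d = 0" using d0 by simp
    then show ?thesis using a1 d by (simp add: s1)
  next
    case False
    then have t: "t = n - 1" using n by simp
    have "\<beta> 2 = - 1 - d" using ab[of 2] d[of 2] lam_t_bot[of t n 2] n t by simp
    then have "int n * (-1) \<le> int n * d" using b2 b1 n t by (simp add: algebra_simps of_nat_diff)
    then have "-1 \<le> d" by (rule mult_le_cancel_left_pos[THEN iffD1, rotated]) (use n in simp)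
    then consider "d = 0" | "d = -1" using d0 by linarith
    then show ?thesis
    proof cases
      case 1
      then show ?thesis using a1 d by (simp add: s1)
    next
      case 2
      have "\<beta> i = 0" if "i \<in> {2..n}" for i
        using ab[of i] d[OF that] lam_t_bot[of t n i] that n t 2 by simp
      moreover have "\<beta> 1 = 0" using b1 2 t n by (simp add: of_nat_diff)
      ultimately show ?thesis by (simp add: s1)
    qed
  qed
qed

text \<open>Two nonincreasing sequences with constant sum on a block are both constant there, in
  particular on the middle indices \<open>2..n-t\<close> and on the last \<open>t\<close>. Hence one
  of them is constant from index 2 on.\<close>

lemma weight_split:
  fixes \<alpha> \<beta> :: "nat \<Rightarrow> int"
  assumes n: "1 \<le> t" "t < n"
    and \<alpha>: "\<And>i j. 1 \<le> i \<Longrightarrow> i < j \<Longrightarrow> j \<le> n \<Longrightarrow> \<alpha> j \<le> \<alpha> i" and \<beta>: "\<And>i j. 1 \<le> i \<Longrightarrow> i < j \<Longrightarrow> j \<le> n \<Longrightarrow> \<beta> j \<le> \<beta> i"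
    and sum: "(\<Sum>i=1..n. \<alpha> i) = 0" "(\<Sum>i=1..n. \<beta> i) = 0"
    and ab: "\<And>i. i \<in> {1..n} \<Longrightarrow> \<alpha> i + \<beta> i = lam_t n t i"
  shows "(\<forall>i\<in>{1..n}. \<alpha> i = 0) \<or> (\<forall>i\<in>{1..n}. \<beta> i = 0)"
proof -
  define d where "d = \<alpha> n"
  have ba: "\<beta> i + \<alpha> i = lam_t n t i" if "i \<in> {1..n}" for i using ab[OF that] by simp
  note lbot = lam_t_bot[OF n(2)] and lmid = lam_t_mid
  have bot: "\<alpha> i = d \<and> \<beta> i = -1 - d" if "i \<in> {n-t+1..n}" for i
  proof (cases "i = n")
    case True
    then show ?thesis using ab[of n] lbot[OF that] n by (simp add: d_def)
  next
    case False
    have "1 \<le> i" using that by auto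
    then show ?thesis using False \<alpha>[of i n] \<beta>[of i n] ab[of i] ab[of n] lbot[OF that] lbot[of n] that n
      by (simp add: d_def)
  qed
  show ?thesis
  proof (cases "2 \<le> n - t")
    case False
    then have "\<alpha> i = d" if "i \<in> {2..n}" for i using bot[of i] that n by auto
    then show ?thesis using weight_split_const[OF n \<alpha> \<beta> sum(1) ab] by blast
  next
    case True
    define c where "c = \<alpha> 2"
    have mid: "\<alpha> i = c \<and> \<beta> i = - c" if "i \<in> {2..n-t}" for i
    proof (cases "i = 2")
      case True
      then show ?thesis using ab[of 2] lmid[OF that] n by (simp add: c_def)
    next
      case False
      have "i \<le> n" using that by auto
      then show ?thesis using False \<alpha>[of 2 i] \<beta>[of 2 i] ab[of i] ab[of 2] lmid[OF that] lmid[of 2] that n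
        by (simp add: c_def)
    qed
    \<comment> \<open>The drops of \<open>\<alpha>\<close> and \<open>\<beta>\<close> between the
      two blocks are nonnegative integers with sum 1, so exactly one of them is 0.\<close>
    have "d \<le> c" "-1 - d \<le> - c"
      using \<alpha>[of 2 n] \<beta>[of 2 n] True n mid[of 2] bot[of n] by auto
    then consider "c = d" | "c = d + 1" by linarith
    then show ?thesis
    proof cases
      case 1
      have "\<alpha> i = d" if "i \<in> {2..n}" for i
        using bot[of i] mid[of i] that 1 by (cases "i \<le> n - t") auto
      then show ?thesis using weight_split_const[OF n \<alpha> \<beta> sum(1) ab] by blast
    next
      case 2
      have "\<beta> i = - c" if "i \<in> {2..n}" for i
        using bot[of i] mid[of i] that 2 by (cases "i \<le> n - t") auto
      then show ?thesis using weight_split_const[OF n \<beta> \<alpha> sum(2) ba] by blast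
    qed
  qed
qed

section \<open>Factors of weight 0 and irreducibility of combinations\<close>

lemma semi_cong:
  assumes "semi n lam f" "\<And>i. i \<in> {1..n} \<Longrightarrow> lam i = mu i"
  shows "semi n mu f"
  using assms by (auto simp: semi_def)

lemma invariants_const: "(\<lambda>x. c) \<in> invariants n"
  by (auto simp: invariants_def act_def polyfun.const)

lemma invariants_mult: "f \<in> invariants n \<Longrightarrow> g \<in> invariants n \<Longrightarrow> (\<lambda>x. f x * g x) \<in> invariants n"
  by (auto simp: invariants_def act_def fun_eq_iff intro: polyfun.mult)

lemma invariants_diff: "f \<in> invariants n \<Longrightarrow> g \<in> invariants n \<Longrightarrow> (\<lambda>x. f x - g x) \<in> invariants n"
  by (auto simp: invariants_def act_def fun_eq_iff intro: polyfun_diff)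

text \<open>On the relevant indices the weight is \<open>lam_t n 0\<close>. The expansion then has
  one term, the empty minor 1, and its coefficient is an invariant.\<close>

lemma semi_weight_0_invariant:
  fixes f :: "'k::alg_closed_field gl \<Rightarrow> 'k"
  assumes f: "semi n \<alpha> f" "\<forall>i\<in>{1..n}. \<alpha> i = 0" and n: "0 < n"
  shows "f \<in> invariants n"
proof -
  have "semi n (lam_t n 0) f" by (rule semi_cong[OF f(1)]) (use f(2) in \<open>auto simp: lam_t_def\<close>)
  from semi_expand[OF this n] have "f = (\<lambda>x. \<Sum>J\<in>index_sets n 0.
     f (conjg n (pm n (sperm n (n - 0) 0 J)) (companion n (\<lambda>j. s_inv n j x))) * u_tI n 0 J x)" .
  moreover have "index_sets n 0 = {{}}" by (auto simp: index_sets_def dest: finite_subset)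
  moreover have "u_tI n 0 {} x = 1" for x :: "'k gl" by (simp add: u_tI_def)
  ultimately have "f = (\<lambda>x. f (conjg n (pm n (sperm n (n - 0) 0 {})) (companion n (\<lambda>j. s_inv n j x))))"
    by simp
  then show ?thesis using invariants_companion[OF semiD(1)[OF f(1)]] by metis
qed

lemma polyfun_u_combination:
  assumes t: "t < n"
  shows "(\<lambda>x :: 'k::alg_closed_field gl. \<Sum>I\<in>index_sets n t. c I * u_tI n t I x) \<in> polyfun n"
  by (intro polyfun_sum polyfun.mult polyfun.const polyfun_u_tI t)

text \<open>Expand \<open>h\<close> in the minors with invariant coefficients \<open>q J\<close>.
  Independence gives \<open>g * q I = c I\<close>, a nonzero constant.\<close>

lemma u_combination_factor_unit:
  fixes c :: "nat set \<Rightarrow> 'k::alg_closed_field" and g h :: "'k gl \<Rightarrow> 'k"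
  assumes t: "t < n" and c: "I \<in> index_sets n t" "c I \<noteq> 0"
    and g: "semi n \<alpha> g" "\<forall>i\<in>{1..n}. \<alpha> i = 0" and h: "semi n \<beta> h" "\<And>i. i \<in> {1..n} \<Longrightarrow> \<beta> i = lam_t n t i"
    and gh: "\<And>x. (\<Sum>I\<in>index_sets n t. c I * u_tI n t I x) = g x * h x"
  shows "polyfun_unit n g"
proof -
  have gi: "g \<in> invariants n" using semi_weight_0_invariant[OF g] t by simp
  have hs: "semi n (lam_t n t) h" using semi_cong[OF h] .
  define q where "q J x = h (conjg n (pm n (sperm n (n - t) t J)) (companion n (\<lambda>j. s_inv n j x)))" for J x
  have q: "q J \<in> invariants n" for J
    unfolding q_def by (rule invariants_companion[OF semiD(1)[OF hs]])
  have hq: "h x = (\<Sum>J\<in>index_sets n t. q J x * u_tI n t J x)" for x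
    unfolding q_def by (rule fun_cong[OF semi_expand[OF hs t]])
  have "(\<Sum>J\<in>index_sets n t. (g x * q J x - c J) * u_tI n t J x) = 0" for x
    using gh[of x] by (simp add: hq sum_distrib_left left_diff_distrib sum_subtractf mult.assoc)
  moreover have "(\<lambda>x. g x * q J x - c J) \<in> invariants n" for J
    by (rule invariants_diff[OF invariants_mult[OF gi q] invariants_const])
  ultimately have "(\<lambda>x. g x * q I x - c I) = (\<lambda>x. 0)"
    by (intro u_tI_independent[of n t "\<lambda>J x. g x * q J x - c J", OF _ t _ c(1)]) auto
  then have "g x * (q I x * inverse (c I)) = 1" for x
    using c(2) by (auto simp: fun_eq_iff field_simps)
  moreover have "(\<lambda>x. q I x * inverse (c I)) \<in> polyfun n"
    using q[of I] by (intro polyfun.mult polyfun.const) (simp add: invariants_def)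
  ultimately show ?thesis
    using gi by (auto simp: polyfun_unit_def invariants_def fun_eq_iff
        intro!: bexI[of _ "\<lambda>x. q I x * inverse (c I)"])
qed

lemma u_combination_B_semi_invariant:
  fixes c :: "nat set \<Rightarrow> 'k::alg_closed_field"
  assumes t: "t < n"
  shows "B_semi_invariant n (lam_t n t) (\<lambda>x. \<Sum>I\<in>index_sets n t. c I * u_tI n t I x)"
  by (intro B_semi_invariant_sum u_tI_B_semi_invariant t)

lemma u_combination_irreducible:
  fixes c :: "nat set \<Rightarrow> 'k::alg_closed_field"
  assumes t: "1 \<le> t" "t < n" and c: "\<exists>I\<in>index_sets n t. c I \<noteq> 0"
  shows "polyfun_irreducible n (\<lambda>x. \<Sum>I\<in>index_sets n t. c I * u_tI n t I x)"
proof -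
  define f where "f x = (\<Sum>I\<in>index_sets n t. c I * u_tI n t I x)" for x :: "'k gl"
  obtain I where I: "I \<in> index_sets n t" "c I \<noteq> 0" using c by blast
  have fp: "f \<in> polyfun n" unfolding f_def by (rule polyfun_u_combination[OF t(2)])
  have fs: "semi n (lam_t n t) f"
    by (intro Uinv_weight_semi B_semi_invariant_Uinv_weight fp)
       (unfold f_def, rule u_combination_B_semi_invariant[OF t(2)])
  have f0: "f \<noteq> (\<lambda>x. 0)"
  proof
    assume "f = (\<lambda>x. 0)"
    then have "(\<lambda>x. c I) = (\<lambda>x :: 'k gl. 0)"
      by (intro u_tI_independent[of n t "\<lambda>J x. c J", OF _ t(2) _ I(1)])
         (auto intro: invariants_const simp: f_def fun_eq_iff)
    then show False using I(2) by (auto simp: fun_eq_iff)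
  qed
  have "\<not> polyfun_unit n f"
  proof
    assume "polyfun_unit n f"
    then obtain g where "\<And>x. f x * g x = 1" unfolding polyfun_unit_def by (metis (mono_tags))
    \<comment> \<open>A unit does not vanish at the zero matrix, which conjugation fixes; so its
      weight would have to be 0, whereas the first coordinate is \<open>t > 0\<close>.\<close>
    then have nz: "f (\<lambda>i j. 0) \<noteq> 0" by (metis mult_zero_left zero_neq_one)
    have "power_int \<tau> (- lam_t n t 1) = power_int \<tau> 0" if "\<tau> \<noteq> 0" for \<tau> :: 'k
    proof -
      have "conjg n (dg1 n 1 \<tau>) (\<lambda>i j. 0) = (\<lambda>i j. 0)"
        by (auto simp: conjg_def mmult_def fun_eq_iff)
      then have "f (\<lambda>i j. 0) = power_int \<tau> (- lam_t n t 1) * f (\<lambda>i j. 0)"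
        using semiD(3)[OF fs, of 1 \<tau> "\<lambda>i j. 0"] that t by simp
      then show ?thesis using nz by simp
    qed
    from power_int_inj[OF this] show False using t by (simp add: lam_t_def)
  qed
  moreover have "polyfun_unit n g \<or> polyfun_unit n h"
    if g: "g \<in> polyfun n" and h: "h \<in> polyfun n" and "f = (\<lambda>x. g x * h x)" for g h
  proof -
    have gh: "f x = g x * h x" and hg: "f x = h x * g x" for x using that(3) by (simp_all add: mult.commute)
    obtain \<alpha> where \<alpha>: "semi n \<alpha> g" using factor_semi[OF fs f0 g h gh] by blast
    obtain \<beta> where \<beta>: "semi n \<beta> h" using factor_semi[OF fs f0 h g hg] by blast
    have g0: "g \<noteq> (\<lambda>x. 0)" and h0: "h \<noteq> (\<lambda>x. 0)" using f0 gh by auto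
    have ab: "\<alpha> i + \<beta> i = lam_t n t i" if "i \<in> {1..n}" for i
      by (rule semi_weight_unique[OF fs f0 \<alpha> \<beta> gh that])
    have "(\<forall>i\<in>{1..n}. \<alpha> i = 0) \<or> (\<forall>i\<in>{1..n}. \<beta> i = 0)"
      by (rule weight_split[OF t semi_dominant[OF \<alpha> _ _ _ g0] semi_dominant[OF \<beta> _ _ _ h0]
        semi_weight_sum[OF \<alpha> g0] semi_weight_sum[OF \<beta> h0] ab])
    then show ?thesis
    proof
      assume a0: "\<forall>i\<in>{1..n}. \<alpha> i = 0"
      have "\<beta> i = lam_t n t i" if "i \<in> {1..n}" for i using ab[OF that] a0 that by simp
      then have "polyfun_unit n g"
        by (rule u_combination_factor_unit[where c = c and I = I, OF t(2) I \<alpha> a0 \<beta>]) (use gh in \<open>auto simp: f_def\<close>)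
      then show ?thesis ..
    next
      assume b0: "\<forall>i\<in>{1..n}. \<beta> i = 0"
      have "\<alpha> i = lam_t n t i" if "i \<in> {1..n}" for i using ab[OF that] b0 that by simp
      then have "polyfun_unit n h"
        by (rule u_combination_factor_unit[where c = c and I = I, OF t(2) I \<beta> b0 \<alpha>]) (use hg in \<open>auto simp: f_def\<close>)
      then show ?thesis ..
    qed
  qed
  ultimately have "polyfun_irreducible n f" using fp f0 unfolding polyfun_irreducible_def by blast
  then show ?thesis by (simp add: f_def[abs_def])
qed

section \<open>Reflection in the antidiagonal\<close>

text \<open>The anti-automorphism of the matrix algebra that preserves the Borel subgroup; it
  interchanges the two families of semi-invariants.\<close>
definition theta :: "nat \<Rightarrow> 'k::zero gl \<Rightarrow> 'k gl" where
  "theta n x = (\<lambda>i j. if i \<in> {1..n} \<and> j \<in> {1..n} then x (n + 1 - j) (n + 1 - i) else 0)"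

lemma refl_in: "i \<in> {1..n} \<Longrightarrow> n + 1 - i \<in> {1..n::nat}"
  by auto

lemma is_mat_theta [simp]: "is_mat n (theta n x)"
  by (auto simp: is_mat_def theta_def)

lemma theta_theta: "theta n (theta n x) = trunc n x"
  by (auto simp: theta_def trunc_def fun_eq_iff)

lemma theta_trunc [simp]: "theta n (trunc n x) = theta n x"
  by (auto simp: theta_def trunc_def fun_eq_iff)

lemma sum_refl: "(\<Sum>l=1..n. f (n + 1 - l)) = (\<Sum>l=1..n::nat. f l)"
  by (rule sum.reindex_bij_witness[of _ "\<lambda>l. n + 1 - l" "\<lambda>l. n + 1 - l"]) auto

lemma prod_refl: "(\<Prod>l=1..n. f (n + 1 - l)) = (\<Prod>l=1..n::nat. f l)"
  by (rule prod.reindex_bij_witness[of _ "\<lambda>l. n + 1 - l" "\<lambda>l. n + 1 - l"]) auto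

lemma theta_mmult: "theta n (mmult n a b) = mmult n (theta n b) (theta n a)"
proof (intro ext)
  fix i j
  show "theta n (mmult n a b) i j = mmult n (theta n b) (theta n a) i j"
  proof (cases "i \<in> {1..n} \<and> j \<in> {1..n}")
    case True
    then have "theta n (mmult n a b) i j = (\<Sum>l=1..n. a (n + 1 - j) l * b l (n + 1 - i))"
      using refl_in[of i n] refl_in[of j n] by (simp add: theta_def mmult_def)
    also have "\<dots> = (\<Sum>l=1..n. a (n + 1 - j) (n + 1 - l) * b (n + 1 - l) (n + 1 - i))"
      by (rule sum_refl[symmetric])
    also have "\<dots> = mmult n (theta n b) (theta n a) i j"
      using True by (auto simp: mmult_def theta_def mult.commute intro!: sum.cong)
    finally show ?thesis .
  qed (auto simp: theta_def mmult_def)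
qed

lemma theta_idm: "theta n (idm n) = idm n"
  by (auto simp: theta_def idm_def fun_eq_iff)

lemma theta_GL:
  assumes "g \<in> GL n"
  shows "theta n g \<in> GL n" "minv n (theta n g) = theta n (minv n g)"
proof -
  have "mmult n (theta n g) (theta n (minv n g)) = idm n" "mmult n (theta n (minv n g)) (theta n g) = idm n"
    using GL_minv[OF assms] by (simp_all flip: theta_mmult add: theta_idm)
  then show "theta n g \<in> GL n" "minv n (theta n g) = theta n (minv n g)"
    by (auto intro!: GL_I minv_eq)
qed

lemma polyfun_theta:
  assumes "f \<in> polyfun n"
  shows "(\<lambda>x. f (theta n x)) \<in> polyfun n"
  by (rule polyfun_compose[OF assms]) (auto simp: theta_def intro!: polyfun.coord)

lemma polyfun_theta_theta: "f \<in> polyfun n \<Longrightarrow> f (theta n (theta n x)) = f x"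
  by (simp add: theta_theta polyfun_trunc)

lemma act_theta:
  assumes "g \<in> GL n"
  shows "act n g (\<lambda>x. f (theta n x)) x = f (conjg n (theta n g) (theta n x))"
  using assms by (simp add: act_def theta_mmult conjg_def theta_GL mmult_assoc)

text \<open>An anti-automorphism turns conjugation by the inverse of \<open>g\<close> into
  conjugation by \<open>theta n g\<close>, while \<open>act\<close> uses the inverse of the latter;
  hence the inverted scalar.\<close>

lemma act_theta_scalar:
  fixes f :: "'k::field gl \<Rightarrow> 'k"
  assumes g: "g \<in> GL n" and f: "f \<in> polyfun n" and c: "c \<noteq> 0"
    and h: "act n (theta n g) f = (\<lambda>x. c * f x)"
  shows "act n g (\<lambda>x. f (theta n x)) = (\<lambda>x. inverse c * f (theta n x))"
proof
  fix x
  let ?z = "conjg n (theta n g) (theta n x)"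
  note G = theta_GL[OF g]
  have "f (theta n x) = f (conjg n (minv n (theta n g)) ?z)"
    using conj_minv_conj(1)[OF G(1), of "theta n x"] polyfun_trunc[OF f, of "theta n x"] by simp
  also have "\<dots> = c * f ?z" using fun_cong[OF h, of ?z] by (simp add: act_eq_conj[OF G(1)])
  finally show "act n g (\<lambda>x. f (theta n x)) x = inverse c * f (theta n x)"
    using c by (simp add: act_theta[OF g])
qed

lemma theta_Borel:
  assumes "b \<in> Borel n"
  shows "theta n b \<in> Borel n"
proof -
  have "theta n b i j = 0" if "j < i" for i j
    using that assms by (auto simp: theta_def Borel_def)
  then show ?thesis using assms theta_GL[of b n] by (auto simp: Borel_def)
qed

lemma theta_Unip:
  assumes "u \<in> Unip n"
  shows "theta n u \<in> Unip n"
proof -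
  have "theta n u i i = 1" if "i \<in> {1..n}" for i
    using that refl_in[OF that] assms by (simp add: theta_def Unip_def)
  then show ?thesis using assms theta_Borel[of u n] by (auto simp: Unip_def)
qed

lemma theta_Torus:
  assumes "d \<in> Torus n"
  shows "theta n d \<in> Torus n"
proof -
  have "theta n d i j = 0" if "i \<noteq> j" for i j
  proof (cases "i \<in> {1..n} \<and> j \<in> {1..n}")
    case True
    then have "n + 1 - j \<noteq> n + 1 - i" using that by auto
    then show ?thesis using assms by (simp add: theta_def Torus_def)
  qed (auto simp: theta_def)
  then show ?thesis using assms theta_GL[of d n] by (auto simp: Torus_def)
qed

lemma character_theta:
  fixes b :: "'k::field gl"
  assumes mu: "\<And>i. i \<in> {1..n} \<Longrightarrow> mu i = - lam (n + 1 - i)"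
  shows "inverse (character n lam (theta n b)) = character n mu b"
proof -
  have "character n lam (theta n b) = (\<Prod>i=1..n. power_int (b (n + 1 - i) (n + 1 - i)) (lam i))"
    unfolding character_def by (intro prod.cong) (auto simp: theta_def)
  also have "\<dots> = (\<Prod>i=1..n. power_int (b (n + 1 - i) (n + 1 - i)) (lam (n + 1 - (n + 1 - i))))"
    by (intro prod.cong) auto
  also have "\<dots> = (\<Prod>i=1..n. power_int (b i i) (lam (n + 1 - i)))"
    by (rule prod_refl)
  finally show ?thesis
    unfolding character_def by (auto simp: mu power_int_minus simp flip: prod_inversef[unfolded o_def] intro!: prod.cong)
qed

lemma character_nonzero:
  fixes b :: "'k::field gl"
  assumes "b \<in> Borel n"
  shows "character n lam b \<noteq> 0"
  unfolding character_def using Borel_diag_nonzero[OF assms] by (simp add: prod_zero_iff)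

lemma B_semi_invariant_theta:
  fixes f :: "'k::field gl \<Rightarrow> 'k"
  assumes mu: "\<And>i. i \<in> {1..n} \<Longrightarrow> mu i = - lam (n + 1 - i)"
    and f: "f \<in> polyfun n" "B_semi_invariant n lam f"
  shows "B_semi_invariant n mu (\<lambda>x. f (theta n x))"
  unfolding B_semi_invariant_def
proof
  fix b :: "'k gl" assume b: "b \<in> Borel n"
  have ct: "inverse (character n lam (theta n b)) = character n mu b"
    by (rule character_theta) (rule mu)
  have "act n (theta n b) f = (\<lambda>x. character n lam (theta n b) * f x)"
    using f(2) theta_Borel[OF b] by (simp add: B_semi_invariant_def)
  from act_theta_scalar[OF _ f(1) character_nonzero[OF theta_Borel[OF b]] this]
  show "act n b (\<lambda>x. f (theta n x)) = (\<lambda>x. character n mu b * f (theta n x))"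
    using b by (simp add: Borel_def ct)
qed

lemma Uinv_weight_theta:
  fixes f :: "'k::field gl \<Rightarrow> 'k"
  assumes mu: "\<And>i. i \<in> {1..n} \<Longrightarrow> mu i = - lam (n + 1 - i)"
    and f: "f \<in> Uinv_weight n lam"
  shows "(\<lambda>x. f (theta n x)) \<in> Uinv_weight n mu"
  unfolding Uinv_weight_def
proof (intro CollectI conjI ballI)
  have fp: "f \<in> polyfun n" using f by (simp add: Uinv_weight_def)
  show "(\<lambda>x. f (theta n x)) \<in> polyfun n" by (rule polyfun_theta[OF fp])
  fix u :: "'k gl" assume u: "u \<in> Unip n"
  have "act n (theta n u) f = (\<lambda>x. 1 * f x)"
    using f theta_Unip[OF u] by (simp add: Uinv_weight_def)
  from act_theta_scalar[OF _ fp _ this] show "act n u (\<lambda>x. f (theta n x)) = (\<lambda>x. f (theta n x))"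
    using u by (simp add: Unip_def Borel_def)
next
  have fp: "f \<in> polyfun n" using f by (simp add: Uinv_weight_def)
  fix d :: "'k gl" assume d: "d \<in> Torus n"
  have dB: "theta n d \<in> Borel n" using theta_Torus[OF d] by (auto simp: Torus_def Borel_def)
  have ct: "inverse (character n lam (theta n d)) = character n mu d"
    by (rule character_theta) (rule mu)
  have "act n (theta n d) f = (\<lambda>x. character n lam (theta n d) * f x)"
    using f theta_Torus[OF d] by (simp add: Uinv_weight_def)
  from act_theta_scalar[OF _ fp character_nonzero[OF dB] this]
  show "act n d (\<lambda>x. f (theta n x)) = (\<lambda>x. character n mu d * f (theta n x))"
    using d by (simp add: Torus_def ct)
qed

lemma invariants_theta:
  assumes f: "f \<in> invariants n"
  shows "(\<lambda>x. f (theta n x)) \<in> invariants n"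
proof -
  have fp: "f \<in> polyfun n" using f by (simp add: invariants_def)
  have "act n g (\<lambda>x. f (theta n x)) = (\<lambda>x. f (theta n x))" if g: "g \<in> GL n" for g
    using act_theta_scalar[OF g fp, of 1] f theta_GL(1)[OF g] by (simp add: invariants_def)
  then show ?thesis using polyfun_theta[OF fp] by (simp add: invariants_def)
qed

section \<open>Exchange of the two families under the reflection\<close>

lemma mu_t_refl: "t < n \<Longrightarrow> i \<in> {1..n} \<Longrightarrow> mu_t n t i = - lam_t n t (n + 1 - i)"
  by (auto simp: mu_t_def lam_t_def)

lemma lam_t_refl:
  assumes "t < n" "i \<in> {1..n}"
  shows "lam_t n t i = - mu_t n t (n + 1 - i)"
  using mu_t_refl[OF assms(1) refl_in[OF assms(2)]] assms(2) by simp

lemma rev_permutes: "(\<lambda>i. if i < n then n - Suc i else i) permutes {0..<n::nat}"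
  by (rule bij_imp_permutes, rule bij_betw_byWitness[where f' = "\<lambda>i. if i < n then n - Suc i else i"]) auto

text \<open>\<open>qmat\<close> of the reflected matrix is obtained by transposing and by reversing
  both rows and columns. The two reversals contribute the same sign, which cancels.\<close>

lemma s_inv_theta:
  fixes x :: "'k::idom gl"
  shows "s_inv n j (theta n x) = s_inv n j x"
proof -
  let ?r = "\<lambda>i. if i < n then n - Suc i else i"
  define A where "A = qmat n x"
  define B where "B = mat n n (\<lambda>(i, j). A $$ (?r i, j))"
  have A: "A \<in> carrier_mat n n" by (simp add: A_def)
  have B: "B \<in> carrier_mat n n" by (simp add: B_def)
  have ri: "i < n \<Longrightarrow> n - Suc i < n" for i by simp
  have "qmat n (theta n x) = mat n n (\<lambda>(i, j). transpose_mat B $$ (?r i, j))"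
  proof (intro eq_matI)
    fix i j assume "i < dim_row (mat n n (\<lambda>(i, j). transpose_mat B $$ (?r i, j)))"
      "j < dim_col (mat n n (\<lambda>(i, j). transpose_mat B $$ (?r i, j)))"
    then have ij: "i < n" "j < n" by auto
    then have s: "Suc (n - Suc i) = n + 1 - Suc i" "Suc (n - Suc j) = n + 1 - Suc j" by auto
    show "qmat n (theta n x) $$ (i, j) = mat n n (\<lambda>(i, j). transpose_mat B $$ (?r i, j)) $$ (i, j)"
      using ij by (auto simp: qmat_def A_def B_def theta_def s ri One_nat_def)
  qed (auto simp: qmat_def)
  then have "det (qmat n (theta n x)) = signof ?r * det (transpose_mat B)"
    using det_permute_rows[of "transpose_mat B" n ?r] B rev_permutes[of n] by simp
  also have "det (transpose_mat B) = det B" by (rule det_transpose[OF B])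
  also have "det B = signof ?r * det A"
    unfolding B_def by (rule det_permute_rows[OF A rev_permutes])
  also have "signof ?r * (signof ?r * det A) = det A" by (simp add: sign_def)
  finally show ?thesis by (simp only: A_def flip: coeff_det_qmat)
qed

text \<open>Reflection carries the line through \<open>x\<close> in direction
  \<open>(n + 1 - i, n)\<close> to the line through its reflection in direction
  \<open>(1, i)\<close>, so both derivatives read the same univariate polynomial.\<close>

lemma pdiff_theta:
  fixes f :: "'k::field gl \<Rightarrow> 'k"
  assumes f: "f \<in> polyfun n" "\<And>x. f (theta n x) = f x" and i: "i \<in> {1..n}"
  shows "pdiff 1 i f (theta n x) = pdiff (n + 1 - i) n f x"
proof -
  have "f (\<lambda>a b. theta n x a b + \<tau> * elem 1 i a b) = f (\<lambda>a b. x a b + \<tau> * elem (n + 1 - i) n a b)" for \<tau>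
  proof -
    have "f (\<lambda>a b. theta n x a b + \<tau> * elem 1 i a b) = f (theta n (\<lambda>a b. x a b + \<tau> * elem (n + 1 - i) n a b))"
      by (rule polyfun_cong[OF f(1)]) (use i in \<open>auto simp: theta_def elem_def\<close>)
    then show ?thesis by (simp add: f(2))
  qed
  then show ?thesis by (simp add: pdiff_def)
qed

text \<open>Reflection exchanges the entries of the two matrices and reverses the order of the
  \<open>t\<close> rows. The resulting sign depends on \<open>t\<close> only, so one scalar serves
  all \<open>I\<close> and \<open>x\<close>.\<close>

lemma v_tI_theta:
  assumes t: "t < n"
  obtains \<epsilon> :: "'k::alg_closed_field" where "\<epsilon> * \<epsilon> = 1"
    "\<And>I x. v_tI n t I x = \<epsilon> * u_tI n t I (theta n (x :: 'k gl))"
proof -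
  let ?r = "\<lambda>i. if i < t then t - Suc i else i"
  have e: "signof ?r * signof ?r = (1::'k)" by (simp add: sign_def)
  have "u_tI n t I (theta n x) = signof ?r * v_tI n t I x" for I and x :: "'k gl"
  proof -
    let ?l = "sorted_list_of_set I"
    let ?V = "mat t t (\<lambda>(a, b). pdiff (1 + a) n (s_inv n (?l ! b)) x)"
    have "pdiff 1 (n - t + 1 + a) (s_inv n (?l ! b)) (theta n x) = ?V $$ (?r a, b)" if ab: "a < t" "b < t" for a b
    proof -
      have "pdiff 1 (n - t + 1 + a) (s_inv n (?l ! b)) (theta n x) =
          pdiff (n + 1 - (n - t + 1 + a)) n (s_inv n (?l ! b)) x"
        by (rule pdiff_theta[OF polyfun_s_inv s_inv_theta]) (use ab t in auto)
      also have "n + 1 - (n - t + 1 + a) = 1 + (t - Suc a)" using ab t by auto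
      finally show ?thesis using ab by simp
    qed
    then have "mat t t (\<lambda>(a, b). pdiff 1 (n - t + 1 + a) (s_inv n (?l ! b)) (theta n x)) =
        mat t t (\<lambda>(a, b). ?V $$ (?r a, b))"
      by (intro cong_mat refl) auto
    then have "u_tI n t I (theta n x) = det (mat t t (\<lambda>(a, b). ?V $$ (?r a, b)))"
      by (simp add: u_tI_def Let_def)
    also have "\<dots> = signof ?r * det ?V" by (rule det_permute_rows) (simp, rule rev_permutes)
    finally show ?thesis by (simp add: v_tI_def Let_def)
  qed
  then have "v_tI n t I x = signof ?r * u_tI n t I (theta n x)" for I and x :: "'k gl"
    using e by (simp flip: mult.assoc)
  with e show ?thesis by (rule that)
qed

lemma Uinv_weight_cmult:
  assumes "f \<in> Uinv_weight n lam"
  shows "(\<lambda>x. c * f x) \<in> Uinv_weight n lam"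
  using assms by (auto simp: Uinv_weight_def act_def fun_eq_iff intro: polyfun.mult polyfun.const)

lemma invariants_cmult: "f \<in> invariants n \<Longrightarrow> (\<lambda>x. c * f x) \<in> invariants n"
  by (intro invariants_mult invariants_const)

text \<open>Composition with \<open>theta\<close> is an involution that preserves invariants and
  exchanges the two weights. It carries the first basis to the second up to the sign
  \<open>\<epsilon>\<close>, which is moved into the coefficients.\<close>

lemma v_tI_basis:
  assumes t: "t < n"
  shows "is_module_basis (invariants n) (Uinv_weight n (mu_t n t)) (index_sets n t)
    (v_tI n t :: nat set \<Rightarrow> 'k::alg_closed_field gl \<Rightarrow> 'k)"
proof -
  obtain \<epsilon> :: 'k where e: "\<epsilon> * \<epsilon> = 1"
    and v: "\<And>I x. v_tI n t I x = \<epsilon> * u_tI n t I (theta n (x :: 'k gl))"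
    using v_tI_theta[OF t, where 'k = 'k] by metis
  note ub = u_tI_basis[OF t, where 'k = 'k, unfolded is_module_basis_def]
  show ?thesis
    unfolding is_module_basis_def
  proof (intro conjI ballI allI impI)
    fix I assume "I \<in> index_sets n t"
    then have "(\<lambda>x :: 'k gl. \<epsilon> * u_tI n t I (theta n x)) \<in> Uinv_weight n (mu_t n t)"
      by (intro Uinv_weight_cmult bspec[OF conjunct1[OF ub]]
          Uinv_weight_theta[where mu = "mu_t n t" and lam = "lam_t n t", OF mu_t_refl[OF t]])
    then show "(v_tI n t I :: 'k gl \<Rightarrow> 'k) \<in> Uinv_weight n (mu_t n t)" by (simp add: v[abs_def])
  next
    fix f :: "'k gl \<Rightarrow> 'k" assume f: "f \<in> Uinv_weight n (mu_t n t)"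
    have fp: "f \<in> polyfun n" using f by (simp add: Uinv_weight_def)
    have "(\<lambda>x. f (theta n x)) \<in> Uinv_weight n (lam_t n t)"
      by (rule Uinv_weight_theta[where mu = "lam_t n t" and lam = "mu_t n t", OF lam_t_refl[OF t] f])
    then obtain c where c: "\<And>I. I \<in> index_sets n t \<Longrightarrow> c I \<in> invariants n"
      and fc: "(\<lambda>x. f (theta n x)) = (\<lambda>x. \<Sum>I\<in>index_sets n t. c I x * u_tI n t I x)"
      using bspec[OF conjunct1[OF conjunct2[OF ub]], of "\<lambda>x. f (theta n x)"] by blast
    have "f x = (\<Sum>I\<in>index_sets n t. (\<epsilon> * c I (theta n x)) * v_tI n t I x)" for x
    proof -
      have "f x = f (theta n (theta n x))" by (rule polyfun_theta_theta[OF fp, symmetric])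
      also have "\<dots> = (\<Sum>I\<in>index_sets n t. c I (theta n x) * u_tI n t I (theta n x))"
        by (rule fun_cong[OF fc])
      also have "\<dots> = (\<Sum>I\<in>index_sets n t. (\<epsilon> * c I (theta n x)) * v_tI n t I x)"
      proof (intro sum.cong refl)
        fix I
        have "(\<epsilon> * c I (theta n x)) * v_tI n t I x = (\<epsilon> * \<epsilon>) * (c I (theta n x) * u_tI n t I (theta n x))"
          by (simp only: v mult_ac)
        then show "c I (theta n x) * u_tI n t I (theta n x) = (\<epsilon> * c I (theta n x)) * v_tI n t I x"
          unfolding e mult_1_left by (rule sym)
      qed
      finally show ?thesis .
    qed
    then show "\<exists>c. (\<forall>I\<in>index_sets n t. c I \<in> invariants n) \<and> f = (\<lambda>x. \<Sum>I\<in>index_sets n t. c I x * v_tI n t I x)"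
      using invariants_cmult[OF invariants_theta[OF c]]
      by (intro exI[of _ "\<lambda>I x. \<epsilon> * c I (theta n x)"]) auto
  next
    fix c :: "nat set \<Rightarrow> 'k gl \<Rightarrow> 'k" and I
    assume c: "(\<forall>I\<in>index_sets n t. c I \<in> invariants n) \<and> (\<lambda>x. \<Sum>I\<in>index_sets n t. c I x * v_tI n t I x) = (\<lambda>x. 0)"
      and I: "I \<in> index_sets n t"
    let ?c = "\<lambda>I x. \<epsilon> * c I (theta n x)"
    have ci: "c I \<in> invariants n" if "I \<in> index_sets n t" for I using c that by blast
    have "(\<Sum>I\<in>index_sets n t. ?c I x * u_tI n t I x) = 0" for x
    proof -
      have "(\<Sum>I\<in>index_sets n t. ?c I x * u_tI n t I x) = (\<Sum>I\<in>index_sets n t. c I (theta n x) * v_tI n t I (theta n x))"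
        by (intro sum.cong refl) (simp add: v polyfun_theta_theta[OF polyfun_u_tI[OF _ t]] mult_ac)
      also have "\<dots> = 0" by (rule fun_cong[OF conjunct2[OF c]])
      finally show ?thesis .
    qed
    then have "?c I = (\<lambda>x. 0)"
      using invariants_cmult[OF invariants_theta[OF ci]]
      by (intro u_tI_independent[of n t ?c, OF _ t _ I]) auto
    moreover have "\<epsilon> \<noteq> 0" using e by auto
    ultimately have "c I (theta n x) = 0" for x by (auto simp: fun_eq_iff)
    from this[of "theta n _"] show "c I = (\<lambda>x. 0)"
      using polyfun_theta_theta[of "c I" n] ci[OF I] by (auto simp: invariants_def fun_eq_iff)
  qed
qed

lemma polyfun_unit_theta:
  assumes "polyfun_unit n (\<lambda>x. g (theta n x))" "g \<in> polyfun n"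
  shows "polyfun_unit n g"
proof -
  obtain k where k: "k \<in> polyfun n" "\<And>x. g (theta n x) * k x = 1"
    using assms(1) unfolding polyfun_unit_def by (metis (mono_tags))
  have "g x * k (theta n x) = 1" for x
    using k(2)[of "theta n x"] polyfun_theta_theta[OF assms(2), of x] by simp
  then show ?thesis using assms(2) polyfun_theta[OF k(1)] by (auto simp: polyfun_unit_def fun_eq_iff intro!: bexI[of _ "\<lambda>x. k (theta n x)"])
qed

text \<open>Composition with \<open>theta\<close> is an involutive ring automorphism of the
  polynomial functions, so factorizations and units can be carried back and forth.\<close>

lemma polyfun_irreducible_theta:
  assumes f: "polyfun_irreducible n f"
  shows "polyfun_irreducible n (\<lambda>x. f (theta n x))"
proof -
  have fp: "f \<in> polyfun n" and f0: "f \<noteq> (\<lambda>x. 0)" and fu: "\<not> polyfun_unit n f"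
    and fi: "\<And>g h. g \<in> polyfun n \<Longrightarrow> h \<in> polyfun n \<Longrightarrow> f = (\<lambda>x. g x * h x) \<Longrightarrow> polyfun_unit n g \<or> polyfun_unit n h"
    using f unfolding polyfun_irreducible_def by blast+
  have "(\<lambda>x. f (theta n x)) \<noteq> (\<lambda>x. 0)"
  proof
    assume "(\<lambda>x. f (theta n x)) = (\<lambda>x. 0)"
    then have "f (theta n (theta n x)) = 0" for x by (metis (mono_tags))
    then show False using f0 polyfun_theta_theta[OF fp] by auto
  qed
  moreover have "\<not> polyfun_unit n (\<lambda>x. f (theta n x))" using polyfun_unit_theta[OF _ fp] fu by blast
  moreover have "polyfun_unit n g \<or> polyfun_unit n h"
    if g: "g \<in> polyfun n" and h: "h \<in> polyfun n" and gh: "(\<lambda>x. f (theta n x)) = (\<lambda>x. g x * h x)" for g h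
  proof -
    have "f x = g (theta n x) * h (theta n x)" for x
      using fun_cong[OF gh, of "theta n x"] polyfun_theta_theta[OF fp, of x] by simp
    then have "polyfun_unit n (\<lambda>x. g (theta n x)) \<or> polyfun_unit n (\<lambda>x. h (theta n x))"
      by (intro fi polyfun_theta g h) auto
    then show ?thesis using polyfun_unit_theta g h by blast
  qed
  ultimately show ?thesis using polyfun_theta[OF fp] unfolding polyfun_irreducible_def by blast
qed

lemma v_combination:
  fixes c :: "nat set \<Rightarrow> 'k::alg_closed_field"
  assumes t: "1 \<le> t" "t < n" and c: "\<exists>I\<in>index_sets n t. c I \<noteq> 0"
  shows "polyfun_irreducible n (\<lambda>x. \<Sum>I\<in>index_sets n t. c I * v_tI n t I x)"
    "B_semi_invariant n (mu_t n t) (\<lambda>x. \<Sum>I\<in>index_sets n t. c I * v_tI n t I x)"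
proof -
  obtain \<epsilon> :: 'k where e: "\<epsilon> * \<epsilon> = 1"
    and v: "\<And>I x. v_tI n t I x = \<epsilon> * u_tI n t I (theta n (x :: 'k gl))"
    using v_tI_theta[OF t(2), where 'k = 'k] by metis
  have e0: "\<epsilon> \<noteq> 0" using e by auto
  define f where "f x = (\<Sum>I\<in>index_sets n t. (c I * \<epsilon>) * u_tI n t I x)" for x :: "'k gl"
  have fv: "(\<lambda>x. \<Sum>I\<in>index_sets n t. c I * v_tI n t I x) = (\<lambda>x. f (theta n x))"
    by (simp add: f_def v mult.assoc)
  have "polyfun_irreducible n f"
    unfolding f_def by (rule u_combination_irreducible[OF t]) (use c e0 in auto)
  then show "polyfun_irreducible n (\<lambda>x. \<Sum>I\<in>index_sets n t. c I * v_tI n t I x)"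
    unfolding fv by (rule polyfun_irreducible_theta)
  have fB: "f \<in> polyfun n" "B_semi_invariant n (lam_t n t) f"
    unfolding f_def by (rule polyfun_u_combination[OF t(2)], rule u_combination_B_semi_invariant[OF t(2)])
  show "B_semi_invariant n (mu_t n t) (\<lambda>x. \<Sum>I\<in>index_sets n t. c I * v_tI n t I x)"
    unfolding fv by (rule B_semi_invariant_theta[where mu = "mu_t n t" and lam = "lam_t n t", OF mu_t_refl[OF t(2)] fB])
qed

theorem theorem2p2:
  fixes n t :: nat
  assumes "n \<ge> 2" and "1 \<le> t" and "t \<le> n - 1"
  shows "is_module_basis (invariants n) (Uinv_weight n (lam_t n t)) (index_sets n t)
           (u_tI n t :: nat set \<Rightarrow> ('k::alg_closed_field gl \<Rightarrow> 'k))
       \<and> is_module_basis (invariants n) (Uinv_weight n (mu_t n t)) (index_sets n t)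
           (v_tI n t :: nat set \<Rightarrow> ('k gl \<Rightarrow> 'k))
       \<and> (\<forall>c :: nat set \<Rightarrow> 'k. (\<exists>I\<in>index_sets n t. c I \<noteq> 0) \<longrightarrow>
           polyfun_irreducible n (\<lambda>x. \<Sum>I\<in>index_sets n t. c I * u_tI n t I x) \<and>
           B_semi_invariant n (lam_t n t) (\<lambda>x. \<Sum>I\<in>index_sets n t. c I * u_tI n t I x))
       \<and> (\<forall>c :: nat set \<Rightarrow> 'k. (\<exists>I\<in>index_sets n t. c I \<noteq> 0) \<longrightarrow>
           polyfun_irreducible n (\<lambda>x. \<Sum>I\<in>index_sets n t. c I * v_tI n t I x) \<and>
           B_semi_invariant n (mu_t n t) (\<lambda>x. \<Sum>I\<in>index_sets n t. c I * v_tI n t I x))"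
proof -
  have t: "1 \<le> t" "t < n" using assms by auto
  show ?thesis
    using u_tI_basis[OF t(2)] v_tI_basis[OF t(2)] u_combination_irreducible[OF t]
      u_combination_B_semi_invariant[OF t(2)] v_combination[OF t]
    by blast
qed

end
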